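(* Let $n=3$, let $\Omega\subset\mathbb{R}^3$ be a connected bounded open set with Lipschitz boundary, $a\in L^\infty(\Omega)$ with $0<m\le a\le M$, $H\in L^2(\Omega)$, and $F=\nabla f$, $\tilde F=\nabla\tilde f$ with $f,\tilde f\in C^1(\Omega)\cap C(\overline\Omega)$. Suppose $u$ and $\tilde u$ are admissible for $(a,F,H)$ and $(a,\tilde F,H)$ respectively (with constants $\sigma_0,\sigma_1,m,M$), with $u|_{\partial\Omega}=\tilde u|_{\partial\Omega}=0$. Let $v=u+f$ and suppose that the level sets of $v$ can be foliated to one-dimensional curves, with constants $c_g,C_g,K$. Then $$\|u-\tilde u\|_{L^1(\Omega)}\le C\max\left(\|f-\tilde f\|_{W^{1,1}(\Omega)}^{1/2},\ \|f-\tilde f\|_{W^{1,1}(\Omega)}\right)$$ for some constant $C=C(\Omega,m,M,K,\sigma_0,\sigma_1,c_g,C_g)$ independent of $\tilde u$ and $\tilde\sigma$.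
   Context: Admissibility: fix $\sigma_0,\sigma_1>0$. For data $(a,F,H)$, $u\in C^1(\overline\Omega)$ is admissible if $u$ minimizes $\int_\Omega(a|Dw+F|+Hw)\,dx$ over $w\in H_0^1(\Omega)$ and there is $\sigma\in C(\Omega)$ with $0<\sigma_0\le\sigma\le\sigma_1$ such that $J=\sigma(\nabla u+F)$ and $m\le|J|\le M$. Here $J$ is the flux field of the problem (a solution of the dual problem of maximizing $\int_\Omega F\cdot b\,dx$ over $b\in L^2(\Omega;\mathbb{R}^n)$ with $|b|\le a$ a.e. and $\int_\Omega(\nabla w\cdot b+Hw)\,dx=0$ for all $w\in H^1_0(\Omega)$); thus $\nabla\cdot J=H$ weakly, $|J|=a$ and $\sigma=a/|\nabla u+F|$. $\tilde\sigma$ is the coefficient belonging to $\tilde u$. Foliation ($n=3$): the level sets of $v$ can be foliated to one-dimensional curves if for almost every $t$ in the range of $v$ there is a $C^1$ function $g_t$ on the surface $\{v=t\}\cap\Omega$ with $0<c_g\le|\nabla g_t|\le C_g$ (surface gradient; constants independent of $t$), such that for almost every $r\in\mathbb{R}$ every connected component of $\{v=t\}\cap\{g_t=r\}\cap\Omega$ is a $C^1$ curve reaching $\partial\Omega$, and $\sup_{t,r}\int_{\{v=t\}\cap\{g_t=r\}\cap\Omega}dl\le K<\infty$. *)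

theory Defs
  imports "HOL-Analysis.Analysis"
begin

definition grad :: "('a::euclidean_space \<Rightarrow> real) \<Rightarrow> 'a \<Rightarrow> 'a" where
  "grad f x = (THE D. GDERIV f x :> D)"

lemma grad_eqI:
  assumes "GDERIV f x :> D" shows "grad f x = D"
  unfolding grad_def
proof (rule the_equality)
  fix E assume "GDERIV f x :> E"
  with assms have "(\<lambda>h. h \<bullet> E) = (\<lambda>h. h \<bullet> D)"
    unfolding gderiv_def by (blast intro: has_derivative_unique)
  then have "\<forall>h. h \<bullet> E = h \<bullet> D" by (simp add: fun_eq_iff)
  then show "E = D" by (metis vector_eq_ldot)
qed (fact assms)

definition C1_on :: "'a::euclidean_space set \<Rightarrow> ('a \<Rightarrow> real) \<Rightarrow> bool" where
  "C1_on \<Omega> f \<longleftrightarrow> (\<forall>x\<in>\<Omega>. f differentiable (at x)) \<and> continuous_on \<Omega> (grad f)"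

text \<open>Membership in $C^1(\overline\Omega)$ for open \<open>\<Omega>\<close>: the function and its gradient on \<open>\<Omega>\<close>
  extend continuously to the closure.\<close>

definition C1_closure :: "'a::euclidean_space set \<Rightarrow> ('a \<Rightarrow> real) \<Rightarrow> bool" where
  "C1_closure \<Omega> f \<longleftrightarrow> continuous_on (closure \<Omega>) f \<and>
     (\<exists>G. continuous_on (closure \<Omega>) G \<and> (\<forall>x\<in>\<Omega>. GDERIV f x :> G x))"

text \<open>Near each boundary point, \<open>\<Omega>\<close> is the part of a ball lying above the graph of a Lipschitz
  function over the hyperplane orthogonal to a unit vector \<open>e\<close>.\<close>

definition lipschitz_boundary :: "'a::euclidean_space set \<Rightarrow> bool" where
  "lipschitz_boundary \<Omega> \<longleftrightarrow> (\<forall>p\<in>frontier \<Omega>. \<exists>r>0. \<exists>e L \<gamma>. norm e = 1 \<and>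
     L-lipschitz_on {y. y \<bullet> e = 0} \<gamma> \<and>
     \<Omega> \<inter> ball p r = {x \<in> ball p r. \<gamma> (x - (x \<bullet> e) *\<^sub>R e) < x \<bullet> e})"

definition L2_on :: "'a::euclidean_space set \<Rightarrow> ('a \<Rightarrow> 'b::euclidean_space) \<Rightarrow> bool" where
  "L2_on \<Omega> f \<longleftrightarrow> f \<in> borel_measurable (lebesgue_on \<Omega>) \<and>
     integrable (lebesgue_on \<Omega>) (\<lambda>x. (norm (f x))\<^sup>2)"

definition L1_norm :: "'a::euclidean_space set \<Rightarrow> ('a \<Rightarrow> real) \<Rightarrow> real" where
  "L1_norm \<Omega> h = (LINT x|lebesgue_on \<Omega>. \<bar>h x\<bar>)"

text \<open>Only applied to functions in $C^1(\Omega)$, whose weak gradient is the classical one.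
  Where it is used, \<open>h\<close> and \<open>grad h\<close> are bounded on the bounded set \<open>\<Omega>\<close>, so both integrals
  are finite.\<close>

definition W11_norm :: "'a::euclidean_space set \<Rightarrow> ('a \<Rightarrow> real) \<Rightarrow> real" where
  "W11_norm \<Omega> h = (LINT x|lebesgue_on \<Omega>. \<bar>h x\<bar>) + (LINT x|lebesgue_on \<Omega>. norm (grad h x))"

primrec k_times_cont_diff :: "nat \<Rightarrow> ('a::euclidean_space \<Rightarrow> real) \<Rightarrow> bool" where
  "k_times_cont_diff 0 f \<longleftrightarrow> continuous_on UNIV f"
| "k_times_cont_diff (Suc k) f \<longleftrightarrow> (\<forall>x. f differentiable (at x)) \<and>
     (\<forall>b\<in>Basis. k_times_cont_diff k (\<lambda>x. frechet_derivative f (at x) b))"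

definition test_function :: "'a::euclidean_space set \<Rightarrow> ('a \<Rightarrow> real) \<Rightarrow> bool" where
  "test_function \<Omega> \<phi> \<longleftrightarrow> (\<forall>k. k_times_cont_diff k \<phi>) \<and>
     (\<exists>S. compact S \<and> S \<subseteq> \<Omega> \<and> (\<forall>x. x \<notin> S \<longrightarrow> \<phi> x = 0))"

text \<open>\<open>H1_grad \<Omega> w g\<close>: $w \in H^1(\Omega)$ with weak gradient $Dw = g$. The gradient is determined
  only almost everywhere, hence the relational form.\<close>

definition H1_grad :: "'a::euclidean_space set \<Rightarrow> ('a \<Rightarrow> real) \<Rightarrow> ('a \<Rightarrow> 'a) \<Rightarrow> bool" where
  "H1_grad \<Omega> w g \<longleftrightarrow> L2_on \<Omega> w \<and> L2_on \<Omega> g \<and>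
     (\<forall>\<phi>. test_function \<Omega> \<phi> \<longrightarrow>
        (LINT x|lebesgue_on \<Omega>. w x *\<^sub>R grad \<phi> x) = - (LINT x|lebesgue_on \<Omega>. \<phi> x *\<^sub>R g x))"

text \<open>$H^1_0(\Omega)$ as the closure of the test functions in $H^1(\Omega)$.\<close>

definition H10 :: "'a::euclidean_space set \<Rightarrow> ('a \<Rightarrow> real) \<Rightarrow> bool" where
  "H10 \<Omega> w \<longleftrightarrow> (\<exists>g. H1_grad \<Omega> w g \<and>
     (\<exists>\<phi>. (\<forall>k::nat. test_function \<Omega> (\<phi> k)) \<and>
        (\<lambda>k. LINT x|lebesgue_on \<Omega>. (\<phi> k x - w x)\<^sup>2 + (norm (grad (\<phi> k) x - g x))\<^sup>2)
          \<longlonglongrightarrow> 0))"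

definition energy ::
  "'a::euclidean_space set \<Rightarrow> ('a \<Rightarrow> real) \<Rightarrow> ('a \<Rightarrow> 'a) \<Rightarrow> ('a \<Rightarrow> real) \<Rightarrow>
   ('a \<Rightarrow> real) \<Rightarrow> ('a \<Rightarrow> 'a) \<Rightarrow> real" where
  "energy \<Omega> a F H w g = (LINT x|lebesgue_on \<Omega>. a x * norm (g x + F x) + H x * w x)"

definition minimizer ::
  "'a::euclidean_space set \<Rightarrow> ('a \<Rightarrow> real) \<Rightarrow> ('a \<Rightarrow> 'a) \<Rightarrow> ('a \<Rightarrow> real) \<Rightarrow>
   ('a \<Rightarrow> real) \<Rightarrow> bool" where
  "minimizer \<Omega> a F H u \<longleftrightarrow> H10 \<Omega> u \<and>
     (\<forall>gu w gw. H1_grad \<Omega> u gu \<and> H10 \<Omega> w \<and> H1_grad \<Omega> w gw \<longrightarrow>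
        energy \<Omega> a F H u gu \<le> energy \<Omega> a F H w gw)"

definition dual_feasible ::
  "'a::euclidean_space set \<Rightarrow> ('a \<Rightarrow> real) \<Rightarrow> ('a \<Rightarrow> real) \<Rightarrow> ('a \<Rightarrow> 'a) \<Rightarrow> bool" where
  "dual_feasible \<Omega> a H b \<longleftrightarrow> L2_on \<Omega> b \<and> (AE x in lebesgue_on \<Omega>. norm (b x) \<le> a x) \<and>
     (\<forall>w g. H10 \<Omega> w \<and> H1_grad \<Omega> w g \<longrightarrow>
        (LINT x|lebesgue_on \<Omega>. g x \<bullet> b x + H x * w x) = 0)"

definition dual_solution ::
  "'a::euclidean_space set \<Rightarrow> ('a \<Rightarrow> real) \<Rightarrow> ('a \<Rightarrow> 'a) \<Rightarrow> ('a \<Rightarrow> real) \<Rightarrow>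
   ('a \<Rightarrow> 'a) \<Rightarrow> bool" where
  "dual_solution \<Omega> a F H J \<longleftrightarrow> dual_feasible \<Omega> a H J \<and>
     (\<forall>b. dual_feasible \<Omega> a H b \<longrightarrow>
        (LINT x|lebesgue_on \<Omega>. F x \<bullet> b x) \<le> (LINT x|lebesgue_on \<Omega>. F x \<bullet> J x))"

text \<open>The conditions on \<open>J\<close> force \<open>F\<close> to be bounded on \<open>\<Omega>\<close>, so the integrals in \<open>energy\<close>
  and \<open>dual_solution\<close> are not affected by the default value of the Bochner integral.
  The identities $|J| = a$ and $\sigma = a/|\nabla u + F|$ are consequences and not assumed.\<close>

definition admissible ::
  "'a::euclidean_space set \<Rightarrow> real \<Rightarrow> real \<Rightarrow> real \<Rightarrow> real \<Rightarrow>
   ('a \<Rightarrow> real) \<Rightarrow> ('a \<Rightarrow> 'a) \<Rightarrow> ('a \<Rightarrow> real) \<Rightarrow> ('a \<Rightarrow> real) \<Rightarrow> bool" where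
  "admissible \<Omega> \<sigma>\<^sub>0 \<sigma>\<^sub>1 m M a F H u \<longleftrightarrow> C1_closure \<Omega> u \<and> minimizer \<Omega> a F H u \<and>
     (\<exists>\<sigma> J. continuous_on \<Omega> \<sigma> \<and> (\<forall>x\<in>\<Omega>. \<sigma>\<^sub>0 \<le> \<sigma> x \<and> \<sigma> x \<le> \<sigma>\<^sub>1) \<and>
        dual_solution \<Omega> a F H J \<and>
        (\<forall>x\<in>\<Omega>. J x = \<sigma> x *\<^sub>R (grad u x + F x) \<and> m \<le> norm (J x) \<and> norm (J x) \<le> M))"

definition hausdorff1 :: "'a::metric_space set \<Rightarrow> ennreal" where
  "hausdorff1 S = (SUP \<delta>\<in>{0::real<..}.
     INF U\<in>{U :: nat \<Rightarrow> 'a set. S \<subseteq> (\<Union>i. U i) \<and> (\<forall>i. bounded (U i) \<and> diameter (U i) \<le> \<delta>)}.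
       (\<Sum>i. ennreal (diameter (U i))))"

text \<open>For a $C^1$ surface \<open>S = {x \<in> \<Omega>. v x = t}\<close> with \<open>grad v \<noteq> 0\<close>: \<open>g\<close> is $C^1$ on \<open>S\<close> with
  surface gradient \<open>D\<close>. The derivative is taken within \<open>S\<close>, so only the values of \<open>g\<close> on \<open>S\<close>
  matter; it fixes \<open>D\<close> up to a normal component, which the orthogonality condition removes.\<close>

definition surface_C1_grad ::
  "'a::euclidean_space set \<Rightarrow> ('a \<Rightarrow> real) \<Rightarrow> ('a \<Rightarrow> real) \<Rightarrow> ('a \<Rightarrow> 'a) \<Rightarrow> bool" where
  "surface_C1_grad S v g D \<longleftrightarrow> continuous_on S D \<and>
     (\<forall>x\<in>S. D x \<bullet> grad v x = 0 \<and> (g has_derivative (\<lambda>h. D x \<bullet> h)) (at x within S))"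

text \<open>The curve lies in the open set \<open>\<Omega>\<close>, hence it is parametrized over an open interval and
  reaches the boundary in the limit.\<close>

definition C1_curve_reaching_boundary :: "'a::euclidean_space set \<Rightarrow> 'a set \<Rightarrow> bool" where
  "C1_curve_reaching_boundary \<Omega> S \<longleftrightarrow>
     (\<exists>\<gamma> :: real \<Rightarrow> 'a. \<gamma> C1_differentiable_on {0<..<1} \<and> inj_on \<gamma> {0<..<1} \<and>
        (\<forall>s\<in>{0<..<1}. vector_derivative \<gamma> (at s) \<noteq> 0) \<and> \<gamma> ` {0<..<1} = S) \<and>
     closure S \<inter> frontier \<Omega> \<noteq> {}"

definition foliated ::
  "(real^3) set \<Rightarrow> (real^3 \<Rightarrow> real) \<Rightarrow> real \<Rightarrow> real \<Rightarrow> real \<Rightarrow> bool" where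
  "foliated \<Omega> v c\<^sub>g C\<^sub>g K \<longleftrightarrow>
     (AE t in lborel. t \<in> v ` \<Omega> \<longrightarrow>
        (\<exists>g D. surface_C1_grad {x\<in>\<Omega>. v x = t} v g D \<and>
           (\<forall>x\<in>\<Omega>. v x = t \<longrightarrow> c\<^sub>g \<le> norm (D x) \<and> norm (D x) \<le> C\<^sub>g) \<and>
           (AE r in lborel. \<forall>S \<in> components {x\<in>\<Omega>. v x = t \<and> g x = r}.
              C1_curve_reaching_boundary \<Omega> S) \<and>
           (\<forall>r. hausdorff1 {x\<in>\<Omega>. v x = t \<and> g x = r} \<le> ennreal K)))"

end

theory Submission
  imports Defs
begin

text \<open>
  Let $J, \tilde J$ be the two flux fields. Comparing $J$ with the field $a(\nabla u+F)/|\nabla u+F|$,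
  which is dual feasible by the Euler--Lagrange equation of $u$, gives $|J| = a = |\tilde J|$ almost
  everywhere. Hence $(J-\tilde J)\cdot(\nabla v-\nabla\tilde v)$ dominates a multiple of
  $|J-\tilde J|^2$, while its integral equals $\int (J-\tilde J)\cdot\nabla(f-\tilde f)$ because
  $J-\tilde J$ is orthogonal to gradients of $H^1_0$ functions. So $J-\tilde J$ is small in $L^1$.

  On a level set of $v$ the tangential gradient of $w = u-\tilde u$ is bounded by
  $h = |J-\tilde J|/\sigma_0+|\nabla(f-\tilde f)|$. Each curve of the foliation reaches the boundary,
  where $w$ vanishes, so $|w|$ on the curve is at most $\int h\,dl$. Integrating over curves
  of length at most $K$ and applying the coarea formula twice (for $v$, then for $g_t$) yields
  $\int_\Omega|w| \le C\int_\Omega h$. The coarea formula is used only up to constants and in charts in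
  which the level sets are graphs over coordinate planes and lines. No trace theorem is
  needed, since $w$ itself vanishes on the boundary.
\<close>

section \<open>Images of sets under functions of one variable\<close>

text \<open>The foliating function \<open>g\<close> is chosen anew on every level of
  \<open>v\<close>, with no regularity in the level. The two coarea steps therefore cannot be merged
  into one change of variables in space. The estimate on a single surface is made to conclude
  between integrals in charts of \<open>v\<close> alone: \<open>g\<close> has disappeared before
  \<open>t\<close> is integrated, and only sections of fixed Borel functions remain. Surfaces and
  curves are never measured intrinsically. A chart gives them the density 1 / |partial derivative|.
  Since |grad v| lies between \<open>m / \<sigma>\<^sub>1\<close> and
  \<open>M / \<sigma>\<^sub>0\<close> and the surface gradient of \<open>g\<close> between
  \<open>c\<^sub>g\<close> and \<open>C\<^sub>g\<close>, densities and slopes are bounded from both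
  sides, and the constants come from these bounds. Hausdorff measure enters only as an upper bound
  for parameter lengths, because coordinate projections are 1-Lipschitz. The two powers in the
  result have different origins: the flux difference is controlled through its square, which
  produces the square root, while grad (f - f') enters \<open>h\<close> linearly.\<close>

lemma nn_integral_substitution_inj:
  fixes q q' f :: "real \<Rightarrow> real"
  assumes S: "S \<in> sets borel"
    and der: "\<And>x. x \<in> S \<Longrightarrow> (q has_field_derivative q' x) (at x within S)"
    and inj: "inj_on q S"
    and f: "f \<in> borel_measurable borel" "\<And>t. 0 \<le> f t" "\<And>t. t \<notin> q ` S \<Longrightarrow> f t = 0"
    and meas: "(\<lambda>x. indicator S x * (\<bar>q' x\<bar> * f (q x))) \<in> borel_measurable borel"
  shows "(\<integral>\<^sup>+x. ennreal (indicator S x * (\<bar>q' x\<bar> * f (q x))) \<partial>lborel) = (\<integral>\<^sup>+t. ennreal (f t) \<partial>lborel)"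
proof -
  let ?g = "\<lambda>x. indicator S x * (\<bar>q' x\<bar> * f (q x))"
  have SL: "S \<in> sets lebesgue" using S by simp
  have cv: "((\<lambda>x. \<bar>q' x\<bar> * f (q x)) absolutely_integrable_on S \<and>
        integral S (\<lambda>x. \<bar>q' x\<bar> * f (q x)) = b)
      \<longleftrightarrow> (f absolutely_integrable_on (q ` S) \<and> integral (q ` S) f = b)" for b
    by (rule has_absolute_integral_change_of_variables_1'[OF SL der inj])
  have g0: "0 \<le> ?g x" for x using f(2) by (simp add: indicator_def)
  \<comment> \<open>Since \<open>f\<close> vanishes off the image of \<open>S\<close>, integrating
    over the image and over the whole line is the same.\<close>
  have f_iff: "(f absolutely_integrable_on (q ` S) \<and> integral (q ` S) f = b) \<longleftrightarrow> (f has_integral b) UNIV" for b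
  proof -
    have "f = (\<lambda>t. if t \<in> q ` S then f t else 0)" using f(3) by auto
    then have "(f has_integral b) (q ` S) \<longleftrightarrow> (f has_integral b) UNIV"
      using has_integral_restrict_UNIV[of "q ` S" f b] by simp
    moreover have "f absolutely_integrable_on (q ` S) \<longleftrightarrow> f integrable_on (q ` S)"
      by (rule absolutely_integrable_on_iff_nonneg) (rule f(2))
    ultimately show ?thesis by (auto simp: has_integral_iff)
  qed
  have g_iff: "((\<lambda>x. \<bar>q' x\<bar> * f (q x)) absolutely_integrable_on S \<and>
        integral S (\<lambda>x. \<bar>q' x\<bar> * f (q x)) = b) \<longleftrightarrow> (?g has_integral b) UNIV" for b
  proof -
    have "?g = (\<lambda>x. if x \<in> S then \<bar>q' x\<bar> * f (q x) else 0)" by (auto simp: indicator_def)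
    then have "((\<lambda>x. \<bar>q' x\<bar> * f (q x)) has_integral b) S \<longleftrightarrow> (?g has_integral b) UNIV"
      by (simp only: has_integral_restrict_UNIV)
    moreover have "(\<lambda>x. \<bar>q' x\<bar> * f (q x)) absolutely_integrable_on S \<longleftrightarrow> (\<lambda>x. \<bar>q' x\<bar> * f (q x)) integrable_on S"
      by (rule absolutely_integrable_on_iff_nonneg) (simp add: f(2))
    ultimately show ?thesis by (auto simp: has_integral_iff)
  qed
  have iff: "(?g has_integral b) UNIV \<longleftrightarrow> (f has_integral b) UNIV" for b
    using cv f_iff g_iff by blast
  \<comment> \<open>The change of variables theorem compares finite integrals. Because
    \<open>iff\<close> transfers finiteness in both directions, it also settles the infinite case
    and gives an identity in [0, \<infinity>].\<close>
  show ?thesis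
  proof (cases "(\<integral>\<^sup>+t. ennreal (f t) \<partial>lborel) = \<infinity>")
    case True
    have "(\<integral>\<^sup>+x. ennreal (?g x) \<partial>lborel) = \<infinity>"
    proof (rule ccontr)
      assume "\<not> ?thesis"
      then have "?g integrable_on UNIV"
        by (intro nn_integral_integrable_on meas g0) (simp add: top.not_eq_extremum)
      then obtain b where "(?g has_integral b) UNIV" by blast
      then have "(f has_integral b) UNIV" using iff by blast
      from nn_integral_has_integral_lborel[OF f(1,2) this] True show False by simp
    qed
    with True show ?thesis by simp
  next
    case False
    then have "f integrable_on UNIV"
      by (intro nn_integral_integrable_on f) (simp add: top.not_eq_extremum)
    then obtain b where b: "(f has_integral b) UNIV" by blast
    then have "(?g has_integral b) UNIV" using iff by blast
    from nn_integral_has_integral_lborel[OF meas g0 this] nn_integral_has_integral_lborel[OF f(1,2) b]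
    show ?thesis by simp
  qed
qed

text \<open>Folds of \<open>f\<close> only lower the measure of the image, hence an inequality.
  Applied to \<open>w\<close> along arcs, it turns an integral of the derivative into a bound for
  the set of values that \<open>w\<close> takes there; this replaces the fundamental theorem of
  calculus along a curve.\<close>

lemma emeasure_differentiable_image_le:
  fixes f f' :: "real \<Rightarrow> real" and k :: "real \<Rightarrow> real"
  assumes Z: "Z \<in> sets borel"
    and der: "\<And>x. x \<in> Z \<Longrightarrow> (f has_field_derivative f' x) (at x)"
    and meas: "(\<lambda>x. indicator Z x * \<bar>f' x\<bar>) \<in> borel_measurable borel"
    and le: "\<And>x. x \<in> Z \<Longrightarrow> \<bar>f' x\<bar> \<le> k x"
  shows "f ` Z \<in> sets lebesgue"
    and "emeasure lebesgue (f ` Z) \<le> (\<integral>\<^sup>+x. ennreal (k x) * indicator Z x \<partial>lborel)"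
proof -
  have ZL: "Z \<in> sets lebesgue" using Z by simp
  have "f differentiable_on Z"
    unfolding differentiable_on_def using der
    by (metis differentiable_at_withinI field_differentiable_def field_differentiable_imp_differentiable)
  then show im: "f ` Z \<in> sets lebesgue"
    by (intro differentiable_image_in_sets_lebesgue[OF ZL]) auto
  show "emeasure lebesgue (f ` Z) \<le> (\<integral>\<^sup>+x. ennreal (k x) * indicator Z x \<partial>lborel)"
  proof (cases "(\<integral>\<^sup>+x. ennreal (k x) * indicator Z x \<partial>lborel) = \<infinity>")
    case False
    \<comment> \<open>The bound for images of differentiable maps is applied on
      \<open>real^1\<close>, where multiplication by \<open>c\<close> has determinant
      \<open>c\<close>; \<open>lift\<close> and \<open>drp\<close> pass between it and the
      line.\<close>
    define lift :: "real \<Rightarrow> real^1" where "lift = vec"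
    define drp :: "real^1 \<Rightarrow> real" where "drp = (\<lambda>x. x $ 1)"
    have ZL': "lift ` Z \<in> sets lebesgue"
      unfolding lift_def by (auto intro: differentiable_image_in_sets_lebesgue[OF ZL] differentiable_vec)
    have der': "((lift \<circ> f \<circ> drp) has_derivative (*\<^sub>R) (f' (drp y))) (at y within lift ` Z)"
      if "y \<in> lift ` Z" for y
    proof -
      obtain z where z: "z \<in> Z" "y = vec z" using \<open>y \<in> lift ` Z\<close> unfolding lift_def by blast
      have "(f has_vector_derivative f' z) (at z within Z)"
        using der[OF z(1)] has_field_derivative_at_within has_real_derivative_iff_has_vector_derivative by blast
      then have "((\<lambda>x. vec (f (x $ 1))) has_derivative (*\<^sub>R) (f' z)) (at (vec z) within lift ` Z)"
        unfolding lift_def by (simp add: has_vector_derivative_def has_derivative_vector_1)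
      with z show ?thesis by (simp add: o_def lift_def drp_def)
    qed
    have dm: "\<bar>det (matrix ((*\<^sub>R) c :: real^1 \<Rightarrow> real^1))\<bar> = \<bar>c\<bar>" for c
      by (simp add: det_1 matrix_def axis_def)
    let ?k = "\<lambda>x. indicator Z x * \<bar>f' x\<bar>"
    have kle: "(\<integral>\<^sup>+x. ennreal (?k x) \<partial>lborel) \<le> (\<integral>\<^sup>+x. ennreal (k x) * indicator Z x \<partial>lborel)"
      by (intro nn_integral_mono) (auto simp: indicator_def le intro!: ennreal_leI)
    then obtain r where r: "(\<integral>\<^sup>+x. ennreal (?k x) \<partial>lborel) = ennreal r" "0 \<le> r"
      using False by (metis ennreal_cases infinity_ennreal_def top.extremum_unique)
    have "(?k has_integral r) UNIV"
      by (rule nn_integral_has_integral[OF meas _ r]) (simp add: indicator_def)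
    moreover have "?k = (\<lambda>x. if x \<in> Z then \<bar>f' x\<bar> else 0)" by (auto simp: indicator_def)
    ultimately have "((\<lambda>x. \<bar>f' x\<bar>) has_integral r) Z" by (simp only: has_integral_restrict_UNIV)
    then have hi: "((\<lambda>y. \<bar>f' (drp y)\<bar>) has_integral r) (lift ` Z)"
      unfolding drp_def lift_def
      by (intro has_integral_vec1_D) (simp add: o_def image_comp)
    then have "(\<lambda>y. \<bar>det (matrix ((*\<^sub>R) (f' (drp y)) :: real^1 \<Rightarrow> real^1))\<bar>) integrable_on (lift ` Z)"
      unfolding dm by blast
    note mi = measurable_differentiable_image[OF ZL' der' this] measure_differentiable_image[OF ZL' der' this]
    have "integral (lift ` Z) (\<lambda>y. \<bar>det (matrix ((*\<^sub>R) (f' (drp y)) :: real^1 \<Rightarrow> real^1))\<bar>) = r"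
      using hi unfolding dm by (rule integral_unique)
    with mi have mr: "measure lebesgue ((lift \<circ> f \<circ> drp) ` (lift ` Z)) \<le> r"
      and lm: "(lift \<circ> f \<circ> drp) ` (lift ` Z) \<in> lmeasurable" by simp_all
    have eq: "(lift \<circ> f \<circ> drp) ` (lift ` Z) = vec ` (f ` Z)"
      by (auto simp: lift_def drp_def image_comp o_def)
    \<comment> \<open>Back to the line: a measure is the integral of 1, and integrals are invariant
      under \<open>vec\<close>.\<close>
    have "((\<lambda>y::real^1. 1::real) has_integral measure lebesgue (vec ` (f ` Z) :: (real^1) set)) (vec ` (f ` Z))"
      using lm eq lmeasure_integral lmeasurable_iff_integrable_on by (metis has_integral_integral)
    then have "((\<lambda>y. 1::real) has_integral measure lebesgue (vec ` (f ` Z) :: (real^1) set)) (f ` Z)"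
      using has_integral_vec1_I[of "\<lambda>_. 1::real" _ "vec ` (f ` Z)"] by (simp add: o_def image_comp)
    then have I: "(\<lambda>y. 1::real) integrable_on f ` Z"
        "integral (f ` Z) (\<lambda>y. 1::real) = measure lebesgue (vec ` (f ` Z) :: (real^1) set)"
      by (auto simp: has_integral_iff)
    then have "f ` Z \<in> lmeasurable" using lmeasurable_iff_integrable_on by blast
    moreover from this I have "measure lebesgue (f ` Z) = measure lebesgue (vec ` (f ` Z) :: (real^1) set)"
      by (simp add: lmeasure_integral)
    ultimately have "f ` Z \<in> lmeasurable"
      "measure lebesgue (f ` Z) = measure lebesgue (vec ` (f ` Z) :: (real^1) set)" by auto
    with mr eq have "emeasure lebesgue (f ` Z) \<le> ennreal r"
      by (simp add: emeasure_eq_measure2 ennreal_leI)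
    also have "\<dots> \<le> (\<integral>\<^sup>+x. ennreal (k x) * indicator Z x \<partial>lborel)"
      using kle r by simp
    finally show ?thesis .
  qed simp
qed

text \<open>The projection \<open>p c\<close> is 1-Lipschitz and inverts the parametrization
  \<open>x c\<close>, so a covering set casts on \<open>Z c\<close> a shadow contained in an
  interval no longer than its diameter. Parameter length is thus at most the length of the piece,
  without any rectifiability of the pieces.\<close>

lemma sum_emeasure_le_hausdorff1:
  fixes Z :: "'c \<Rightarrow> real set" and x :: "'c \<Rightarrow> real \<Rightarrow> 'a::heine_borel" and p :: "'c \<Rightarrow> 'a \<Rightarrow> real"
  assumes fin: "finite C"
    and comp: "\<And>c. c \<in> C \<Longrightarrow> compact (Z c)"
    and cont: "\<And>c. c \<in> C \<Longrightarrow> continuous_on (Z c) (x c)"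
    and sub: "\<And>c. c \<in> C \<Longrightarrow> x c ` Z c \<subseteq> L"
    and disj: "\<And>c d. c \<in> C \<Longrightarrow> d \<in> C \<Longrightarrow> c \<noteq> d \<Longrightarrow> x c ` Z c \<inter> x d ` Z d = {}"
    and lip: "\<And>c a b. c \<in> C \<Longrightarrow> \<bar>p c a - p c b\<bar> \<le> dist a b"
    and px: "\<And>c z. c \<in> C \<Longrightarrow> z \<in> Z c \<Longrightarrow> p c (x c z) = z"
  shows "(\<Sum>c\<in>C. emeasure lborel (Z c)) \<le> hausdorff1 L"
proof -
  \<comment> \<open>The disjoint compact pieces have positive distance, so a set of a fine cover meets only one of them.\<close>
  have "\<exists>\<delta>>0. \<forall>c\<in>C. \<forall>d\<in>C. c \<noteq> d \<longrightarrow> (\<forall>a\<in>x c ` Z c. \<forall>b\<in>x d ` Z d. \<delta> < dist a b)"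
  proof -
    let ?P = "{(c, d). c \<in> C \<and> d \<in> C \<and> c \<noteq> d}"
    have "\<exists>e>0. \<forall>a\<in>x c ` Z c. \<forall>b\<in>x d ` Z d. e \<le> dist a b" if "(c, d) \<in> ?P" for c d
    proof (rule separate_compact_closed)
      have cd: "c \<in> C" "d \<in> C" "c \<noteq> d" using \<open>(c, d) \<in> ?P\<close> by auto
      show "compact (x c ` Z c)" using cd by (intro compact_continuous_image comp cont)
      show "closed (x d ` Z d)" using cd by (intro compact_imp_closed compact_continuous_image comp cont)
      show "x c ` Z c \<inter> x d ` Z d = {}" using cd by (rule disj)
    qed
    then have "\<forall>q. \<exists>e. e > 0 \<and> (q \<in> ?P \<longrightarrow>
        (\<forall>a\<in>x (fst q) ` Z (fst q). \<forall>b\<in>x (snd q) ` Z (snd q). e \<le> dist a b))"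
      by (intro allI, case_tac "q \<in> ?P") (auto intro: zero_less_one)
    then obtain e where e: "\<And>q. e q > 0" "\<And>q. q \<in> ?P \<Longrightarrow>
        \<forall>a\<in>x (fst q) ` Z (fst q). \<forall>b\<in>x (snd q) ` Z (snd q). e q \<le> dist a b"
      unfolding choice_iff by blast
    have finP: "finite ?P" by (rule finite_subset[of _ "C \<times> C"]) (use fin in auto)
    \<comment> \<open>Halving makes the inequalities strict; the inserted 1 keeps the minimum
      defined when there are no pairs.\<close>
    define \<delta> where "\<delta> = Min (insert 1 (e ` ?P)) / 2"
    have "0 < Min (insert 1 (e ` ?P))" using finP e by (subst Min_gr_iff) auto
    moreover have lt: "\<delta> < e q" if "q \<in> ?P" for q
    proof -
      have "Min (insert 1 (e ` ?P)) \<le> e q" using finP that by (intro Min_le) auto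
      with \<open>0 < Min _\<close> show ?thesis unfolding \<delta>_def by linarith
    qed
    moreover have "\<delta> < dist a b" if "c \<in> C" "d \<in> C" "c \<noteq> d" "a \<in> x c ` Z c" "b \<in> x d ` Z d" for c d a b
    proof -
      have "e (c, d) \<le> dist a b" using e(2)[of "(c, d)"] that by auto
      moreover have "\<delta> < e (c, d)" using lt[of "(c, d)"] that by simp
      ultimately show ?thesis by simp
    qed
    ultimately show ?thesis
      by (intro exI[of _ \<delta>]) (auto simp: \<delta>_def)
  qed
  then obtain \<delta> where \<delta>: "\<delta> > 0"
    and sep: "\<And>c d a b. c \<in> C \<Longrightarrow> d \<in> C \<Longrightarrow> c \<noteq> d \<Longrightarrow> a \<in> x c ` Z c \<Longrightarrow> b \<in> x d ` Z d \<Longrightarrow> \<delta> < dist a b"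
    by blast
  let ?\<U> = "{U :: nat \<Rightarrow> 'a set. L \<subseteq> (\<Union>i. U i) \<and> (\<forall>i. bounded (U i) \<and> diameter (U i) \<le> \<delta>)}"
  have "(\<Sum>c\<in>C. emeasure lborel (Z c)) \<le> (\<Sum>i. ennreal (diameter (U i)))" if U: "U \<in> ?\<U>" for U
  proof -
    \<comment> \<open>\<open>B c i\<close> is the shadow of the part of \<open>U i\<close> on piece
      \<open>c\<close>, \<open>I c i\<close> its interval hull, and \<open>J c i\<close> the price
      of this hull, charged only to a piece that \<open>U i\<close> meets.\<close>
    define B where "B c i = p c ` (U i \<inter> x c ` Z c)" for c i
    define I where "I c i = (if B c i = {} then {} else {Inf (B c i)..Sup (B c i)})" for c i
    define J where "J c i = (if B c i = {} then 0 else ennreal (diameter (U i)))" for c i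
    have dist_B: "\<bar>s - t\<bar> \<le> diameter (U i)" if c: "c \<in> C" and "s \<in> B c i" "t \<in> B c i" for c i s t
    proof -
      obtain a b where "a \<in> U i" "b \<in> U i" "s = p c a" "t = p c b"
        using \<open>s \<in> B c i\<close> \<open>t \<in> B c i\<close> by (auto simp: B_def)
      moreover have "dist a b \<le> diameter (U i)" using U calculation by (intro diameter_bounded_bound) auto
      ultimately show ?thesis using lip[OF c, of a b] by simp
    qed
    have bdd: "bdd_below (B c i)" "bdd_above (B c i)" if "c \<in> C" for c i
    proof -
      have "bounded (B c i)"
      proof (cases "B c i = {}")
        case False
        then obtain s where "s \<in> B c i" by blast
        then show ?thesis unfolding bounded_def using dist_B[OF that]
          by (intro exI[of _ s] exI[of _ "diameter (U i)"]) (auto simp: dist_real_def)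
      qed auto
      then show "bdd_below (B c i)" "bdd_above (B c i)"
        by (auto intro: bounded_imp_bdd_below bounded_imp_bdd_above)
    qed
    have len: "emeasure lborel (I c i) \<le> J c i" if c: "c \<in> C" for c i
    proof (cases "B c i = {}")
      case False
      have "t - diameter (U i) \<le> Inf (B c i)" if "t \<in> B c i" for t
        using dist_B[OF c that] False by (intro cInf_greatest) (force simp: abs_le_iff)+
      then have "Sup (B c i) \<le> Inf (B c i) + diameter (U i)"
        using False by (intro cSup_least) (auto simp: algebra_simps)
      moreover have "Inf (B c i) \<le> Sup (B c i)" using False bdd[OF c] by (intro cInf_le_cSup)
      ultimately show ?thesis using False by (simp add: I_def J_def ennreal_leI)
    qed (simp add: I_def J_def)
    have one: "emeasure lborel (Z c) \<le> (\<Sum>i. J c i)" if c: "c \<in> C" for c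
    proof -
      have "Z c \<subseteq> (\<Union>i. I c i)"
      proof
        fix z assume z: "z \<in> Z c"
        then have "x c z \<in> L" using sub[OF c] by auto
        then obtain i where "x c z \<in> U i" using U by auto
        then have "z \<in> B c i" unfolding B_def using z px[OF c z] by (metis IntI image_eqI)
        then have "z \<in> I c i" unfolding I_def using bdd[OF c] by (auto intro: cInf_lower cSup_upper)
        then show "z \<in> (\<Union>i. I c i)" by blast
      qed
      then have "emeasure lborel (Z c) \<le> emeasure lborel (\<Union>i. I c i)"
        by (intro emeasure_mono) (auto simp: I_def)
      also have "\<dots> \<le> (\<Sum>i. emeasure lborel (I c i))"
        by (intro emeasure_subadditive_countably) (auto simp: I_def)
      also have "\<dots> \<le> (\<Sum>i. J c i)" using len[OF c] by (intro suminf_le) auto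
      finally show ?thesis .
    qed
    have "(\<Sum>c\<in>C. emeasure lborel (Z c)) \<le> (\<Sum>c\<in>C. \<Sum>i. J c i)" by (intro sum_mono one)
    also have "\<dots> = (\<Sum>i. \<Sum>c\<in>C. J c i)" by (subst suminf_sum) auto
    also have "\<dots> \<le> (\<Sum>i. ennreal (diameter (U i)))"
    proof (intro suminf_le)
      fix i
      show "(\<Sum>c\<in>C. J c i) \<le> ennreal (diameter (U i))"
      proof (cases "\<exists>c\<in>C. B c i \<noteq> {}")
        case True
        then obtain c where c: "c \<in> C" "B c i \<noteq> {}" by blast
        have "J d i = 0" if d: "d \<in> C" "d \<noteq> c" for d
        proof (rule ccontr)
          assume "J d i \<noteq> 0"
          then have "B d i \<noteq> {}" by (auto simp: J_def)
          with c obtain a b where "a \<in> U i" "a \<in> x c ` Z c" "b \<in> U i" "b \<in> x d ` Z d" by (auto simp: B_def)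
          moreover from this have "dist a b \<le> diameter (U i)" using U by (intro diameter_bounded_bound) auto
          moreover have "diameter (U i) \<le> \<delta>" using U by auto
          ultimately show False using sep[of c d a b] c d by force
        qed
        then have "(\<Sum>c\<in>C. J c i) = J c i" using fin c by (subst sum.remove[of _ c]) auto
        then show ?thesis using c by (simp add: J_def)
      qed (simp add: J_def)
    qed auto
    finally show ?thesis .
  qed
  then have "(\<Sum>c\<in>C. emeasure lborel (Z c)) \<le> (INF U\<in>?\<U>. \<Sum>i. ennreal (diameter (U i)))"
    by (intro INF_greatest) auto
  \<comment> \<open>\<open>hausdorff1\<close> is a supremum over mesh sizes, so a bound at the
    single mesh \<open>\<delta>\<close> is enough.\<close>
  also have "\<dots> \<le> hausdorff1 L" unfolding hausdorff1_def by (rule SUP_upper) (use \<delta> in auto)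
  finally show ?thesis .
qed

text \<open>Separation needs compact pieces. Each Borel piece is therefore shrunk to a compact
  subset at an arbitrarily small loss by inner regularity, and finite partial sums exhaust the
  series.\<close>

lemma suminf_emeasure_le_hausdorff1:
  fixes Z :: "nat \<Rightarrow> real set" and x :: "nat \<Rightarrow> real \<Rightarrow> 'a::heine_borel" and p :: "nat \<Rightarrow> 'a \<Rightarrow> real"
  assumes Z: "\<And>c. Z c \<in> sets borel" "\<And>c. bounded (Z c)"
    and cont: "\<And>c. continuous_on (Z c) (x c)"
    and sub: "\<And>c. x c ` Z c \<subseteq> L"
    and disj: "\<And>c d. c \<noteq> d \<Longrightarrow> x c ` Z c \<inter> x d ` Z d = {}"
    and lip: "\<And>c a b. \<bar>p c a - p c b\<bar> \<le> dist a b"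
    and px: "\<And>c z. z \<in> Z c \<Longrightarrow> p c (x c z) = z"
  shows "(\<Sum>c. emeasure lborel (Z c)) \<le> hausdorff1 L"
proof (rule suminf_le_const)
  fix n
  have Zm: "Z c \<in> lmeasurable" for c
    using Z by (intro bounded_set_imp_lmeasurable) auto
  show "(\<Sum>c<n. emeasure lborel (Z c)) \<le> hausdorff1 L"
  proof (rule ennreal_le_epsilon)
    fix e :: real assume e: "0 < e"
    \<comment> \<open>The \<open>n\<close> pieces share the total loss \<open>e\<close>; the added 1
      covers \<open>n = 0\<close>.\<close>
    define \<epsilon> where "\<epsilon> = e / (real n + 1)"
    have \<epsilon>: "\<epsilon> > 0" "n * \<epsilon> \<le> e" using e by (auto simp: \<epsilon>_def field_simps)
    have "\<exists>T. compact T \<and> T \<subseteq> Z c \<and> emeasure lborel (Z c) \<le> emeasure lborel T + ennreal \<epsilon>" for c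
    proof -
      obtain T where T': "closed T" "T \<subseteq> Z c" "Z c - T \<in> lmeasurable" "emeasure lebesgue (Z c - T) < ennreal \<epsilon>"
        using sets_lebesgue_inner_closed[OF fmeasurableD[OF Zm] \<epsilon>(1)] by blast
      then have T: "compact T" "T \<subseteq> Z c" "Z c - T \<in> lmeasurable" "emeasure lebesgue (Z c - T) < ennreal \<epsilon>"
        using bounded_subset[OF Z(2)] by (auto simp: compact_eq_bounded_closed)
      have "emeasure lebesgue (Z c) = emeasure lebesgue T + emeasure lebesgue (Z c - T)"
        using T Zm by (subst plus_emeasure) (auto simp: Un_absorb1 Diff_partition fmeasurableD lmeasurable_compact)
      with T have "emeasure lebesgue (Z c) \<le> emeasure lebesgue T + ennreal \<epsilon>"
        by (simp add: add_left_mono)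
      then show ?thesis using T Z(1)
        by (intro exI[of _ T]) (simp add: borel_compact)
    qed
    then obtain T where T: "\<And>c. compact (T c)" "\<And>c. T c \<subseteq> Z c"
      "\<And>c. emeasure lborel (Z c) \<le> emeasure lborel (T c) + ennreal \<epsilon>" by metis
    have "(\<Sum>c<n. emeasure lborel (Z c)) \<le> (\<Sum>c<n. emeasure lborel (T c) + ennreal \<epsilon>)"
      by (intro sum_mono T)
    also have "\<dots> = (\<Sum>c<n. emeasure lborel (T c)) + ennreal (n * \<epsilon>)"
      using \<epsilon> by (simp add: sum.distrib ennreal_mult ennreal_of_nat_eq_real_of_nat)
    also have "(\<Sum>c<n. emeasure lborel (T c)) \<le> hausdorff1 L"
    proof (rule sum_emeasure_le_hausdorff1)
      show "compact (T c)" "continuous_on (T c) (x c)" "x c ` T c \<subseteq> L" for c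
        using T(1,2) cont sub continuous_on_subset by (blast+)
      show "x c ` T c \<inter> x d ` T d = {}" if "c \<noteq> d" for c d using disj[OF that] T(2) by blast
      show "p c (x c z) = z" if "z \<in> T c" for c z using px that T(2) by blast
    qed (use lip in auto)
    also have "ennreal (n * \<epsilon>) \<le> ennreal e" using \<epsilon> by (intro ennreal_leI) auto
    finally show "(\<Sum>c<n. emeasure lborel (Z c)) \<le> hausdorff1 L + ennreal e"
      by (simp add: add_mono)
  qed
qed auto

text \<open>Let R be the series on the right. Each |w y| on \<open>L\<close> is at most R, because
  the arcs have to carry \<open>w\<close> from values near 0 to \<open>w y\<close>. Integrating the
  constant R over parameter sets of total length at most \<open>hausdorff1 L\<close> produces the
  factor \<open>K\<close>. The arcs need not be strung together in order; it suffices that they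
  cover \<open>L\<close>.\<close>

lemma curve_family_estimate:
  fixes x \<tau> :: "nat \<Rightarrow> real \<Rightarrow> 'a::euclidean_space" and p :: "nat \<Rightarrow> 'a \<Rightarrow> real"
    and w :: "'a \<Rightarrow> real" and b :: "nat \<Rightarrow> real \<Rightarrow> real"
  assumes Z: "\<And>c. Z c \<in> sets borel" "\<And>c. bounded (Z c)"
    and der: "\<And>c z. z \<in> Z c \<Longrightarrow> (x c has_vector_derivative \<tau> c z) (at z)"
    and L: "L = (\<Union>c. x c ` Z c)" "L \<subseteq> \<Omega>"
    and disj: "\<And>c d. c \<noteq> d \<Longrightarrow> x c ` Z c \<inter> x d ` Z d = {}"
    and lip: "\<And>c a b. \<bar>p c a - p c b\<bar> \<le> dist a b"
    and px: "\<And>c z. z \<in> Z c \<Longrightarrow> p c (x c z) = z"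
    and H: "hausdorff1 L \<le> ennreal K"
    and w: "\<And>y. y \<in> \<Omega> \<Longrightarrow> (w has_derivative w' y) (at y)"
      "continuous_on (closure \<Omega>) w" "\<And>y. y \<in> frontier \<Omega> \<Longrightarrow> w y = 0"
    and meas: "\<And>c. (\<lambda>z. indicator (Z c) z * \<bar>w' (x c z) (\<tau> c z)\<bar>) \<in> borel_measurable borel"
    and bd: "\<And>c z. z \<in> Z c \<Longrightarrow> \<bar>w' (x c z) (\<tau> c z)\<bar> \<le> b c z"
    and comp: "\<And>S. S \<in> components L \<Longrightarrow> closure S \<inter> frontier \<Omega> \<noteq> {}"
  shows "(\<Sum>c. \<integral>\<^sup>+z. ennreal \<bar>w (x c z)\<bar> * indicator (Z c) z \<partial>lborel)
    \<le> ennreal K * (\<Sum>c. \<integral>\<^sup>+z. ennreal (b c z) * indicator (Z c) z \<partial>lborel)"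
proof -
  let ?R = "\<Sum>c. \<integral>\<^sup>+z. ennreal (b c z) * indicator (Z c) z \<partial>lborel"
  have wx: "((\<lambda>z. w (x c z)) has_field_derivative w' (x c z) (\<tau> c z)) (at z)" if z: "z \<in> Z c" for c z
  proof -
    have "x c z \<in> \<Omega>" using L z by blast
    then have "((w \<circ> x c) has_derivative (w' (x c z) \<circ> (\<lambda>h. h *\<^sub>R \<tau> c z))) (at z)"
      using der[OF z, unfolded has_vector_derivative_def] w(1) by (intro diff_chain_at) auto
    moreover have "linear (w' (x c z))" using w(1)[OF \<open>x c z \<in> \<Omega>\<close>] has_derivative_linear by blast
    ultimately show ?thesis
      by (simp add: has_field_derivative_def o_def linear_cmul mult_commute_abs)
  qed
  note img = emeasure_differentiable_image_le[OF Z(1) wx meas bd]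
  \<comment> \<open>The component of \<open>y\<close> is connected and its closure contains a zero of \<open>w\<close>, so its image under \<open>w\<close>
    contains all values strictly between \<open>0\<close> and \<open>w y\<close>. No parametrization of the component is needed.\<close>
  have point: "ennreal \<bar>w y\<bar> \<le> ?R" if y: "y \<in> L" for y
  proof -
    let ?S = "connected_component_set L y"
    have S: "?S \<in> components L" "connected ?S" "y \<in> ?S" "?S \<subseteq> L"
      using y by (auto simp: components_def connected_component_subset)
    obtain q where q: "q \<in> closure ?S" "q \<in> frontier \<Omega>" using comp[OF S(1)] by blast
    have S\<Omega>: "closure ?S \<subseteq> closure \<Omega>" using S(4) L(2) by (intro closure_mono) auto
    have "w ` closure ?S \<subseteq> closure (w ` ?S)"
      using S\<Omega> w(2) by (intro image_closure_subset closed_closure)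
        (auto intro: continuous_on_subset closure_subset[THEN subsetD])
    then have "w q \<in> closure (w ` ?S)" using q(1) by blast
    \<comment> \<open>The boundary point does not lie on the component, so 0 is only a limit of
      values of \<open>w\<close>.\<close>
    then have z0: "0 \<in> closure (w ` ?S)" using w(3)[OF q(2)] by simp
    have con: "connected (w ` ?S)"
      using S(2) continuous_on_subset[OF w(2)] S\<Omega> closure_subset by (intro connected_continuous_image) blast+
    have "{min 0 (w y)<..<max 0 (w y)} \<subseteq> w ` ?S"
    proof
      fix t assume t: "t \<in> {min 0 (w y)<..<max 0 (w y)}"
      then have "\<bar>t\<bar> > 0" by (auto simp: min_def max_def split: if_splits)
      with z0 obtain s where s: "s \<in> w ` ?S" "dist s 0 < \<bar>t\<bar>" unfolding closure_approachable by blast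
      moreover have "w y \<in> w ` ?S" using S(3) by blast
      ultimately have "(s \<le> t \<and> t \<le> w y) \<or> (w y \<le> t \<and> t \<le> s)"
        using t by (auto simp: min_def max_def dist_real_def split: if_splits)
      then show "t \<in> w ` ?S"
        using con[unfolded connected_iff_interval] s(1) \<open>w y \<in> w ` ?S\<close> by blast
    qed
    \<comment> \<open>A component may run through infinitely many pieces; countable subadditivity
      adds up the lengths of their images under \<open>w\<close>.\<close>
    also have "w ` ?S \<subseteq> (\<Union>c. (\<lambda>z. w (x c z)) ` Z c)" using S(4) L(1) by blast
    finally have "emeasure lebesgue {min 0 (w y)<..<max 0 (w y)} \<le> emeasure lebesgue (\<Union>c. (\<lambda>z. w (x c z)) ` Z c)"
      using img(1) by (intro emeasure_mono) auto
    also have "\<dots> \<le> (\<Sum>c. emeasure lebesgue ((\<lambda>z. w (x c z)) ` Z c))"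
      using img(1) by (intro emeasure_subadditive_countably) auto
    also have "\<dots> \<le> ?R" using img(2) by (intro suminf_le) auto
    finally show ?thesis by (simp add: min_def max_def split: if_splits)
  qed
  define R where "R = ?R"
  have "(\<Sum>c. \<integral>\<^sup>+z. ennreal \<bar>w (x c z)\<bar> * indicator (Z c) z \<partial>lborel)
      \<le> (\<Sum>c. \<integral>\<^sup>+z. R * indicator (Z c) z \<partial>lborel)"
    using point L unfolding R_def by (intro suminf_le nn_integral_mono) (auto simp: indicator_def)
  also have "\<dots> = (\<Sum>c. emeasure lborel (Z c) * R)"
    using Z(1) by (simp add: nn_integral_cmult_indicator mult.commute)
  also have "\<dots> = (\<Sum>c. emeasure lborel (Z c)) * R" by (rule ennreal_suminf_multc)
  also have "(\<Sum>c. emeasure lborel (Z c)) \<le> hausdorff1 L"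
  proof (rule suminf_emeasure_le_hausdorff1[OF Z _ _ disj lip px])
    show "continuous_on (Z c) (x c)" for c
      using der has_vector_derivative_continuous by (intro continuous_at_imp_continuous_on) blast
  qed (use L(1) in auto)
  also have "\<dots> \<le> ennreal K" by (rule H)
  finally show ?thesis unfolding R_def by (simp add: mult_right_mono)
qed

section \<open>Level sets as graphs\<close>

text \<open>Orthonormal coordinates between two Euclidean types, typically a product whose last
  factor is singled out and \<open>real^3\<close>. Invariance of Lebesgue measure is part of the
  notion because the types differ and integrals have to be moved from one to the other.\<close>

definition coord_iso :: "('m::euclidean_space \<Rightarrow> 'n::euclidean_space) \<Rightarrow> ('n \<Rightarrow> 'm) \<Rightarrow> bool" where
  "coord_iso A B \<longleftrightarrow> linear A \<and> linear B \<and> (\<forall>x. norm (A x) = norm x) \<and> (\<forall>x. B (A x) = x) \<and>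
     (\<forall>y. A (B y) = y) \<and> distr lborel borel A = lborel"

text \<open>A linear bijection of the standard bases sends boxes to boxes with the same side
  lengths, and Lebesgue measure is determined by its values on boxes.\<close>

lemma coord_iso_Basis:
  fixes A :: "'m::euclidean_space \<Rightarrow> 'n::euclidean_space"
  assumes A: "linear A" "bij_betw A Basis Basis"
  shows "\<exists>B. coord_iso A B"
proof -
  define B where "B y = (\<Sum>b\<in>Basis. (y \<bullet> A b) *\<^sub>R b)" for y
  have AB: "A b \<in> Basis" if "b \<in> Basis" for b using A(2) that by (auto simp: bij_betw_def)
  have inj: "A b = A c \<longleftrightarrow> b = c" if "b \<in> Basis" "c \<in> Basis" for b c
    using A(2) that by (auto simp: bij_betw_def inj_on_def)
  have exp: "A x = (\<Sum>b\<in>Basis. (x \<bullet> b) *\<^sub>R A b)" for x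
  proof -
    have "A x = A (\<Sum>b\<in>Basis. (x \<bullet> b) *\<^sub>R b)" by (simp add: euclidean_representation)
    also have "\<dots> = (\<Sum>b\<in>Basis. (x \<bullet> b) *\<^sub>R A b)" using A(1) by (simp add: linear_sum linear_cmul)
    finally show ?thesis .
  qed
  have inner: "A x \<bullet> A b = x \<bullet> b" if b: "b \<in> Basis" for x b
  proof -
    have "A x \<bullet> A b = (\<Sum>c\<in>Basis. (x \<bullet> c) * (if c = b then 1 else 0))"
      unfolding exp[of x] inner_sum_left using b
      by (intro sum.cong) (auto simp: inner_Basis AB inj)
    then show ?thesis using b by (simp add: if_distrib cong: if_cong)
  qed
  have sums: "(\<Sum>c\<in>Basis. f c) = (\<Sum>b\<in>Basis. f (A b))" for f :: "'n \<Rightarrow> 'n"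
    using sum.reindex_bij_betw[OF A(2), of f] by simp
  have AB': "A (B y) = y" for y
    unfolding B_def linear_sum[OF A(1)] linear_cmul[OF A(1)]
    using sums[of "\<lambda>c. (y \<bullet> c) *\<^sub>R c"] by (simp add: euclidean_representation)
  have BA: "B (A x) = x" for x
    unfolding B_def by (simp add: inner euclidean_representation cong: sum.cong)
  have linB: "linear B"
    unfolding B_def by (intro linearI) (auto simp: inner_add_left scaleR_add_left sum.distrib scaleR_sum_right)
  have norm: "norm (A x) = norm x" for x
  proof -
    have "(norm (A x))\<^sup>2 = (\<Sum>c\<in>Basis. (A x \<bullet> c)\<^sup>2)" unfolding power2_norm_eq_inner by (subst euclidean_inner) (simp add: power2_eq_square)
    also have "\<dots> = (\<Sum>b\<in>Basis. (A x \<bullet> A b)\<^sup>2)" using sum.reindex_bij_betw[OF A(2), of "\<lambda>c. (A x \<bullet> c)\<^sup>2"] by simp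
    also have "\<dots> = (\<Sum>b\<in>Basis. (x \<bullet> b)\<^sup>2)" by (simp add: inner cong: sum.cong)
    also have "\<dots> = (norm x)\<^sup>2" unfolding power2_norm_eq_inner by (subst (2) euclidean_inner) (simp add: power2_eq_square)
    finally show ?thesis by simp
  qed
  have [measurable]: "A \<in> borel_measurable borel"
    using A(1) linear_continuous_on linear_conv_bounded_linear borel_measurable_continuous_onI by blast
  have "lborel = distr lborel borel A"
  proof (rule lborel_eqI)
    fix l u :: 'n assume lu: "\<And>b. b \<in> Basis \<Longrightarrow> l \<bullet> b \<le> u \<bullet> b"
    have Bi: "B y \<bullet> b = y \<bullet> A b" if "b \<in> Basis" for y b using inner[OF that, of "B y"] AB' by simp
    have *: "(\<forall>c\<in>Basis. P c) \<longleftrightarrow> (\<forall>b\<in>Basis. P (A b))" for P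
      using A(2) by (metis bij_betw_imp_surj_on image_iff)
    have "A -` box l u = box (B l) (B u)"
      by (auto simp: mem_box * Bi inner)
    then have "emeasure (distr lborel borel A) (box l u) = emeasure lborel (box (B l) (B u))"
      by (subst emeasure_distr) auto
    also have "\<dots> = (\<Prod>b\<in>Basis. (B u - B l) \<bullet> b)"
      using lu AB by (subst emeasure_lborel_box) (auto simp: Bi)
    also have "(\<Prod>b\<in>Basis. (B u - B l) \<bullet> b) = (\<Prod>b\<in>Basis. (u - l) \<bullet> A b)"
      by (intro prod.cong) (auto simp: inner_diff_left Bi)
    also have "\<dots> = (\<Prod>c\<in>Basis. (u - l) \<bullet> c)"
      using prod.reindex_bij_betw[OF A(2), of "\<lambda>c. (u - l) \<bullet> c"] by simp
    finally show "emeasure (distr lborel borel A) (box l u) = ennreal (\<Prod>b\<in>Basis. (u - l) \<bullet> b)" .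
  qed simp
  then show ?thesis
    unfolding coord_iso_def using A(1) linB norm BA AB' by metis
qed

text \<open>
  Here \<open>A\<close> is a choice of coordinates (with inverse \<open>B\<close>) whose last one can be solved for in
  $G = t$: the level set of \<open>G\<close> in \<open>Q\<close> is the image of the graph of $y \mapsto$ \<open>snd (B (\<xi> (y, t)))\<close>
  under \<open>A\<close>. In these coordinates the level-set measure has density $1/|\partial_e G|$, $e =$ \<open>A (0, 1)\<close>.
\<close>

definition graph_chart ::
  "('n::euclidean_space \<Rightarrow> real) \<Rightarrow> ('n \<Rightarrow> 'n \<Rightarrow> real) \<Rightarrow> real \<Rightarrow> 'n set \<Rightarrow>
   ('a::euclidean_space \<times> real \<Rightarrow> 'n) \<Rightarrow> ('n \<Rightarrow> 'a \<times> real) \<Rightarrow> ('a \<times> real) set \<Rightarrow> ('a \<times> real \<Rightarrow> 'n) \<Rightarrow> bool" where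
  "graph_chart G G' \<kappa> Q A B U \<xi> \<longleftrightarrow>
     coord_iso A B \<and> open U \<and> \<xi> \<in> borel_measurable borel \<and>
     (\<forall>x\<in>Q. (fst (B x), G x) \<in> U \<and> \<xi> (fst (B x), G x) = x \<and> \<kappa> < \<bar>G' x (A (0, 1))\<bar>) \<and>
     (\<forall>y t. (y, t) \<in> U \<longrightarrow> \<xi> (y, t) \<in> Q \<and> G (\<xi> (y, t)) = t \<and> fst (B (\<xi> (y, t))) = y \<and>
        ((\<lambda>y. \<xi> (y, t)) has_derivative
          (\<lambda>k. A (k, - G' (\<xi> (y, t)) (A (k, 0)) / G' (\<xi> (y, t)) (A (0, 1))))) (at y)) \<and>
     (\<lambda>p. indicator U p / \<bar>G' (\<xi> p) (A (0, 1))\<bar> :: real) \<in> borel_measurable borel \<and>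
     (\<forall>\<phi>. \<phi> \<in> borel_measurable borel \<longrightarrow> (\<forall>x. 0 \<le> \<phi> x) \<longrightarrow> (\<forall>x. x \<notin> Q \<longrightarrow> \<phi> x = 0) \<longrightarrow>
       (\<integral>\<^sup>+x. ennreal (\<phi> x) \<partial>lborel) =
       (\<integral>\<^sup>+t. \<integral>\<^sup>+y. ennreal (indicator U (y, t) / \<bar>G' (\<xi> (y, t)) (A (0, 1))\<bar> * \<phi> (\<xi> (y, t))) \<partial>lborel \<partial>lborel))"

lemma graph_chartD:
  assumes "graph_chart G G' \<kappa> Q A B U \<xi>"
  shows "coord_iso A B" "open U" "\<xi> \<in> borel_measurable borel"
    "(\<lambda>p. indicator U p / \<bar>G' (\<xi> p) (A (0, 1))\<bar> :: real) \<in> borel_measurable borel"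
    and "x \<in> Q \<Longrightarrow> (fst (B x), G x) \<in> U" "x \<in> Q \<Longrightarrow> \<xi> (fst (B x), G x) = x"
      "x \<in> Q \<Longrightarrow> \<kappa> < \<bar>G' x (A (0, 1))\<bar>"
    and "(y, t) \<in> U \<Longrightarrow> \<xi> (y, t) \<in> Q" "(y, t) \<in> U \<Longrightarrow> G (\<xi> (y, t)) = t"
      "(y, t) \<in> U \<Longrightarrow> fst (B (\<xi> (y, t))) = y"
      "(y, t) \<in> U \<Longrightarrow> ((\<lambda>y. \<xi> (y, t)) has_derivative
          (\<lambda>k. A (k, - G' (\<xi> (y, t)) (A (k, 0)) / G' (\<xi> (y, t)) (A (0, 1))))) (at y)"
  using assms unfolding graph_chart_def by blast+

text \<open>In the coordinates \<open>A\<close>, the map \<open>\<Phi>\<close> replaces the last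
  coordinate by the value of \<open>G\<close>. It is injective by Rolle's theorem on vertical
  segments, which stay in the convex set; it is open by invariance of domain; and its inverse is
  differentiable because its derivative is inverted explicitly. The integral formula is Fubini's
  theorem combined with a one-variable substitution on each vertical line.\<close>

lemma level_chart:
  fixes A :: "'a::euclidean_space \<times> real \<Rightarrow> 'n::euclidean_space" and G :: "'n \<Rightarrow> real"
  assumes iso: "coord_iso A B" and Q: "open Q" "convex Q"
    and der: "\<And>x. x \<in> Q \<Longrightarrow> (G has_derivative G' x) (at x)"
    and cont: "continuous_on Q (\<lambda>x. G' x (A (0, 1)))"
    and low: "0 \<le> \<kappa>" "\<And>x. x \<in> Q \<Longrightarrow> \<kappa> < \<bar>G' x (A (0, 1))\<bar>"
  shows "\<exists>U \<xi>. graph_chart G G' \<kappa> Q A B U \<xi>"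
proof -
  let ?e = "A (0, 1)"
  have nz: "G' x ?e \<noteq> 0" if "x \<in> Q" for x using low(1) low(2)[OF that] by auto
  have A: "linear A" "\<And>x. B (A x) = x" "\<And>y. A (B y) = y" "distr lborel borel A = lborel" and linB: "linear B"
    using iso by (auto simp: coord_iso_def)
  have contA: "continuous_on X A" for X using A(1) linear_continuous_on linear_conv_bounded_linear by blast
  have contB: "continuous_on X B" for X using linB linear_continuous_on linear_conv_bounded_linear by blast
  have [measurable]: "A \<in> borel_measurable borel" using contA borel_measurable_continuous_onI by blast
  have derA: "(A has_derivative A) F" for F using A(1) by (simp add: linear_imp_has_derivative)
  define O' where "O' = A -` Q"
  define \<Phi> where "\<Phi> p = (fst p, G (A p))" for p
  have opO: "open O'" unfolding O'_def using contA Q(1) by (intro open_vimage) auto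
  have convO: "convex O'" unfolding O'_def using A(1) Q(2) by (intro convex_linear_vimage)
  have linG': "linear (G' x)" if "x \<in> Q" for x using der[OF that] has_derivative_linear by blast
  have der\<Phi>: "(\<Phi> has_derivative (\<lambda>h. (fst h, G' (A p) (A h)))) (at p)" if "p \<in> O'" for p
  proof -
    have "((\<lambda>p. G (A p)) has_derivative (\<lambda>h. G' (A p) (A h))) (at p)"
      using has_derivative_compose[OF derA der] that by (auto simp: O'_def)
    then show ?thesis unfolding \<Phi>_def by (auto intro!: derivative_eq_intros)
  qed
  have derq: "((\<lambda>s. G (A (y, s))) has_field_derivative G' (A (y, s)) ?e) (at s)" if "(y, s) \<in> O'" for y s
  proof -
    have "((\<lambda>s. (y, s)) has_derivative (\<lambda>h. (0, h))) (at s)" by (auto intro!: derivative_eq_intros)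
    from has_derivative_compose[OF has_derivative_compose[OF this derA] der] that
    have "((\<lambda>s. G (A (y, s))) has_derivative (\<lambda>h. G' (A (y, s)) (A (0, h)))) (at s)"
      by (auto simp: O'_def)
    moreover have "(\<lambda>h. G' (A (y, s)) (A (0, h))) = (*) (G' (A (y, s)) ?e)"
    proof
      fix h
      have "A (0, h) = h *\<^sub>R ?e" using linear_cmul[OF A(1), of h "(0,1)"] by simp
      then show "G' (A (y, s)) (A (0, h)) = G' (A (y, s)) ?e * h"
        using linear_cmul[OF linG', of "A (y, s)" h ?e] that by (simp only:) (simp add: O'_def)
    qed
    ultimately show ?thesis unfolding has_field_derivative_def by (simp only:)
  qed
  have injq: "s = s'" if "(y, s) \<in> O'" "(y, s') \<in> O'" "G (A (y, s)) = G (A (y, s'))" for y s s'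
  proof -
    have "False" if st: "s < s'" "(y, s) \<in> O'" "(y, s') \<in> O'" "G (A (y, s)) = G (A (y, s'))" for s s'
    proof -
      have sec: "(y, r) \<in> O'" if "s \<le> r" "r \<le> s'" for r
      proof -
        have "r \<in> closed_segment s s'" using that st by (simp add: closed_segment_eq_real_ivl)
        then obtain u where u: "0 \<le> u" "u \<le> 1" "r = (1 - u) * s + u * s'" by (auto simp: closed_segment_def)
        have "(1 - u) *\<^sub>R (y, s) + u *\<^sub>R (y, s') \<in> O'"
          using convO st u by (intro convexD) auto
        moreover have "(1 - u) *\<^sub>R (y, s) + u *\<^sub>R (y, s') = (y, r)" using u by (simp add: algebra_simps)
        ultimately show ?thesis by simp
      qed
      have "\<exists>z. s < z \<and> z < s' \<and> (\<lambda>h. G' (A (y, z)) ?e * h) = (\<lambda>v. 0)"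
      proof (rule Rolle_deriv[OF st(1) st(4)])
        show "continuous_on {s..s'} (\<lambda>r. G (A (y, r)))"
          using derq[OF sec] DERIV_isCont by (intro continuous_at_imp_continuous_on) fastforce
        show "((\<lambda>r. G (A (y, r))) has_derivative (*) (G' (A (y, r)) ?e)) (at r)" if "s < r" "r < s'" for r
          using derq[OF sec[of r]] that unfolding has_field_derivative_def by simp
      qed
      then obtain z where z: "s < z" "z < s'" "(\<lambda>h. G' (A (y, z)) ?e * h) = (\<lambda>v. 0)" by blast
      have "G' (A (y, z)) ?e * 1 = 0" using z(3) by metis
      moreover have "A (y, z) \<in> Q" using sec[of z] z(1,2) by (simp add: O'_def)
      ultimately show False using nz by simp
    qed
    with that show ?thesis by (metis linorder_neqE_linordered_idom)
  qed
  have inj\<Phi>: "inj_on \<Phi> O'" unfolding inj_on_def \<Phi>_def using injq by auto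
  have cont\<Phi>: "continuous_on O' \<Phi>"
    using der\<Phi> has_derivative_continuous by (blast intro: continuous_at_imp_continuous_on)
  define U where "U = \<Phi> ` O'"
  define \<psi> where "\<psi> = inv_into O' \<Phi>"
  have opU: "open U" unfolding U_def using opO cont\<Phi> inj\<Phi> by (intro invariance_of_domain_gen) auto
  have \<psi>\<Phi>: "\<psi> (\<Phi> p) = p" if "p \<in> O'" for p unfolding \<psi>_def using inj\<Phi> that by (rule inv_into_f_f)
  have \<Phi>\<psi>: "\<Phi> (\<psi> p) = p" "\<psi> p \<in> O'" if "p \<in> U" for p
    using that \<psi>\<Phi> by (auto simp: U_def)
  have cont\<psi>: "continuous_on U \<psi>"
    unfolding U_def using opO cont\<Phi> \<psi>\<Phi> by (intro continuous_on_inverse_open) auto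
  \<comment> \<open>The value 0 off \<open>U\<close> makes \<open>\<xi>\<close> a total Borel
    function; the integrals see it only together with the factor \<open>indicator U\<close>.\<close>
  define \<xi> where "\<xi> p = (if p \<in> U then A (\<psi> p) else 0)" for p
  have cont\<xi>: "continuous_on U \<xi>"
    using continuous_on_compose2[OF contA cont\<psi>, of UNIV] by (rule continuous_on_eq) (auto simp: \<xi>_def)
  have \<xi>m [measurable]: "\<xi> \<in> borel_measurable borel"
  proof -
    have "\<xi> = (\<lambda>p. if p \<in> U then \<xi> p else 0)" by (auto simp: \<xi>_def)
    also have "\<dots> \<in> borel_measurable borel"
      using opU cont\<xi> by (intro borel_measurable_continuous_on_if) auto
    finally show ?thesis .
  qed
  have \<xi>1: "\<xi> (y, t) \<in> Q \<and> G (\<xi> (y, t)) = t \<and> fst (B (\<xi> (y, t))) = y" if "(y, t) \<in> U" for y t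
    using \<Phi>\<psi>[OF that] that by (auto simp: \<xi>_def O'_def \<Phi>_def A)
  have \<xi>2: "(fst (B x), G x) \<in> U \<and> \<xi> (fst (B x), G x) = x" if "x \<in> Q" for x
  proof -
    have "B x \<in> O'" "\<Phi> (B x) = (fst (B x), G x)" using that by (auto simp: O'_def \<Phi>_def A)
    moreover from this have "(fst (B x), G x) \<in> U" unfolding U_def by (metis imageI)
    ultimately show ?thesis using \<psi>\<Phi>[of "B x"] by (simp add: \<xi>_def A)
  qed
  have \<xi>3: "((\<lambda>y. \<xi> (y, t)) has_derivative
        (\<lambda>k. A (k, - G' (\<xi> (y, t)) (A (k, 0)) / G' (\<xi> (y, t)) ?e))) (at y)" if yt: "(y, t) \<in> U" for y t
  proof -
    let ?x = "\<xi> (y, t)"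
    have xA: "?x = A (\<psi> (y, t))" using yt by (simp add: \<xi>_def)
    have xQ: "?x \<in> Q" using \<xi>1[OF yt] by simp
    \<comment> \<open>The inverse of the derivative of \<open>\<Phi>\<close>: keep the first
      component and solve a scalar linear equation for the last one, whose coefficient is the
      nonzero derivative along \<open>A (0, 1)\<close>.\<close>
    let ?g = "\<lambda>h. (fst h, (snd h - G' ?x (A (fst h, 0))) / G' ?x ?e)"
    have bl: "bounded_linear ?g"
    proof -
      have "bounded_linear (\<lambda>h::'a \<times> real. G' ?x (A (fst h, 0)))"
      proof -
        have "linear (\<lambda>h::'a \<times> real. (fst h, 0::real))" by (intro linearI) auto
        then have "linear (G' ?x \<circ> (A \<circ> (\<lambda>h::'a \<times> real. (fst h, 0::real))))"
          using A(1) linG'[OF xQ] by (intro linear_compose)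
        then show ?thesis by (simp add: linear_conv_bounded_linear o_def)
      qed
      then show ?thesis
        by (intro bounded_linear_Pair bounded_linear_fst bounded_linear_compose[OF bounded_linear_divide]
          bounded_linear_sub bounded_linear_snd)
    qed
    have inv: "?g \<circ> (\<lambda>h. (fst h, G' ?x (A h))) = id"
    proof
      fix h :: "'a \<times> real"
      have "A h = A (fst h, 0) + snd h *\<^sub>R ?e"
        using linear_add[OF A(1), of "(fst h, 0)" "snd h *\<^sub>R (0, 1)"] linear_cmul[OF A(1), of "snd h" "(0,1)"] by simp
      then have "G' ?x (A h) = G' ?x (A (fst h, 0)) + snd h * G' ?x ?e"
        using linG'[OF xQ] by (simp add: linear_add linear_cmul)
      then show "(?g \<circ> (\<lambda>h. (fst h, G' ?x (A h)))) h = id h" using nz[OF xQ] by simp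
    qed
    have "(\<psi> has_derivative ?g) (at (y, t))"
    proof (rule has_derivative_inverse_basic[OF _ bl inv])
      show "(\<Phi> has_derivative (\<lambda>h. (fst h, G' ?x (A h)))) (at (\<psi> (y, t)))"
        using der\<Phi>[OF \<Phi>\<psi>(2)[OF yt]] unfolding xA .
      show "isCont \<psi> (y, t)" using cont\<psi> opU yt by (simp add: continuous_on_eq_continuous_at)
    qed (use opU yt \<Phi>\<psi> in auto)
    then have "((\<lambda>p. A (\<psi> p)) has_derivative (\<lambda>h. A (?g h))) (at (y, t))"
      by (rule has_derivative_compose[OF _ derA])
    then have "(\<xi> has_derivative (\<lambda>h. A (?g h))) (at (y, t))"
      using opU yt by (rule has_derivative_transform_within_open) (auto simp: \<xi>_def)
    moreover have "((\<lambda>y. (y, t)) has_derivative (\<lambda>k. (k, 0))) (at y)" by (auto intro!: derivative_eq_intros)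
    ultimately have "((\<lambda>y. \<xi> (y, t)) has_derivative (\<lambda>k. A (?g (k, 0)))) (at y)"
      by (rule has_derivative_compose[rotated])
    then show ?thesis by simp
  qed
  have Jm [measurable]: "(\<lambda>p. indicator U p / \<bar>G' (\<xi> p) ?e\<bar>) \<in> borel_measurable borel"
  proof -
    have "continuous_on U (\<lambda>p. G' (\<xi> p) ?e)"
      using \<xi>1 by (intro continuous_on_compose2[OF cont cont\<xi>]) auto
    then have "continuous_on U (\<lambda>p. 1 / \<bar>G' (\<xi> p) ?e\<bar>)"
      using nz \<xi>1 by (intro continuous_intros) auto
    then have "(\<lambda>p. indicator U p *\<^sub>R (1 / \<bar>G' (\<xi> p) ?e\<bar>)) \<in> borel_measurable borel"
      using opU by (intro borel_measurable_continuous_on_indicator) auto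
    then show ?thesis by simp
  qed
  have int: "(\<integral>\<^sup>+x. ennreal (\<phi> x) \<partial>lborel) =
       (\<integral>\<^sup>+t. \<integral>\<^sup>+y. ennreal (indicator U (y, t) / \<bar>G' (\<xi> (y, t)) ?e\<bar> * \<phi> (\<xi> (y, t))) \<partial>lborel \<partial>lborel)"
    if \<phi>: "\<phi> \<in> borel_measurable borel" "\<And>x. 0 \<le> \<phi> x" "\<And>x. x \<notin> Q \<Longrightarrow> \<phi> x = 0" for \<phi>
  proof -
    note \<phi>(1)[measurable]
    define F where "F p = indicator U p / \<bar>G' (\<xi> p) ?e\<bar> * \<phi> (\<xi> p)" for p
    have Fm: "F \<in> borel_measurable borel" unfolding F_def by measurable
    have pm: "borel_measurable (lborel \<Otimes>\<^sub>M lborel) = (borel_measurable borel :: ('a \<times> real \<Rightarrow> ennreal) set)"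
      by (subst lborel_prod) simp
    have sec: "(\<integral>\<^sup>+s. ennreal (\<phi> (A (y, s))) \<partial>lborel) = (\<integral>\<^sup>+t. ennreal (F (y, t)) \<partial>lborel)" for y
    proof -
      let ?S = "{s. (y, s) \<in> O'}" and ?q = "\<lambda>s. G (A (y, s))"
      have S: "?S \<in> sets borel"
      proof -
        have "continuous_on UNIV (\<lambda>s::real. (y, s))" by (intro continuous_intros)
        then have "open ((\<lambda>s. (y, s)) -` O')" using opO by (intro open_vimage) auto
        then show ?thesis by (simp add: vimage_def)
      qed
      \<comment> \<open>The substitution factor cancels the density in \<open>F\<close> and leaves
        \<open>\<phi>\<close> on the vertical line, also off \<open>O'\<close>, where
        \<open>\<phi>\<close> vanishes.\<close>
      have eq: "indicator ?S s * (\<bar>G' (A (y, s)) ?e\<bar> * F (y, ?q s)) = \<phi> (A (y, s))" for s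
      proof (cases "(y, s) \<in> O'")
        case True
        then have Q: "A (y, s) \<in> Q" by (simp add: O'_def)
        have "(y, ?q s) \<in> U" "\<xi> (y, ?q s) = A (y, s)" using \<xi>2[OF Q] by (simp_all add: A)
        then show ?thesis using True nz[OF Q] by (simp add: F_def)
      next
        case False
        then show ?thesis using \<phi>(3) by (simp add: O'_def)
      qed
      have F0: "F (y, t) = 0" if t: "t \<notin> ?q ` ?S" for t
      proof (cases "(y, t) \<in> U")
        case True
        then obtain p where "p \<in> O'" "\<Phi> p = (y, t)" by (auto simp: U_def)
        then have "(y, snd p) \<in> O'" "t = ?q (snd p)" by (cases p; auto simp: \<Phi>_def)+
        with t show ?thesis by blast
      qed (simp add: F_def)
      have "(\<integral>\<^sup>+s. ennreal (indicator ?S s * (\<bar>G' (A (y, s)) ?e\<bar> * F (y, ?q s))) \<partial>lborel) = (\<integral>\<^sup>+t. ennreal (F (y, t)) \<partial>lborel)"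
      proof (rule nn_integral_substitution_inj[OF S])
        show "(?q has_real_derivative G' (A (y, s)) ?e) (at s within ?S)" if "s \<in> ?S" for s
          using derq[of y s] that by (auto intro: has_field_derivative_at_within)
        show "inj_on ?q ?S" using injq by (auto simp: inj_on_def)
        show "(\<lambda>t. F (y, t)) \<in> borel_measurable borel" using Fm by measurable
        show "0 \<le> F (y, t)" for t by (simp add: F_def \<phi>(2))
        show "(\<lambda>s. indicator ?S s * (\<bar>G' (A (y, s)) ?e\<bar> * F (y, ?q s))) \<in> borel_measurable borel"
          unfolding eq by measurable
      qed (use F0 in auto)
      then show ?thesis unfolding eq .
    qed
    have "(\<integral>\<^sup>+x. ennreal (\<phi> x) \<partial>lborel) = (\<integral>\<^sup>+x. ennreal (\<phi> x) \<partial>distr lborel borel A)" by (simp add: A)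
    also have "\<dots> = (\<integral>\<^sup>+p. ennreal (\<phi> (A p)) \<partial>lborel)" by (subst nn_integral_distr) auto
    also have "\<dots> = (\<integral>\<^sup>+p. ennreal (\<phi> (A p)) \<partial>(lborel \<Otimes>\<^sub>M lborel))" by (simp add: lborel_prod)
    also have "\<dots> = (\<integral>\<^sup>+y. \<integral>\<^sup>+s. ennreal (\<phi> (A (y, s))) \<partial>lborel \<partial>lborel)"
      by (subst lborel.nn_integral_fst[symmetric]) (auto simp: pm)
    also have "\<dots> = (\<integral>\<^sup>+y. \<integral>\<^sup>+t. ennreal (F (y, t)) \<partial>lborel \<partial>lborel)" by (simp add: sec)
    \<comment> \<open>Exchanging the order makes the level the outer variable: the volume integral
      is now sliced by level sets.\<close>
    also have "\<dots> = (\<integral>\<^sup>+t. \<integral>\<^sup>+y. ennreal (F (y, t)) \<partial>lborel \<partial>lborel)"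
      using Fm by (intro lborel_pair.Fubini'[symmetric]) (auto simp: case_prod_beta' pm)
    finally show ?thesis unfolding F_def .
  qed
  have "graph_chart G G' \<kappa> Q A B U \<xi>"
    unfolding graph_chart_def using iso opU \<xi>m low(2) \<xi>1 \<xi>2 \<xi>3 Jm int by (intro conjI ballI allI impI; blast)
  then show ?thesis by blast
qed

text \<open>A chart reaches only as far as one fixed direction stays transversal to the level sets,
  so many are needed. The \<open>Q i\<close> may overlap; the disjoint Borel pieces
  \<open>P i\<close> assign one chart to each point, which plays the role of a partition of
  unity.\<close>

definition graph_atlas ::
  "('n::euclidean_space \<Rightarrow> real) \<Rightarrow> ('n \<Rightarrow> 'n \<Rightarrow> real) \<Rightarrow> real \<Rightarrow> 'n set \<Rightarrow> (nat \<Rightarrow> 'n set) \<Rightarrow> (nat \<Rightarrow> 'n set) \<Rightarrow>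
   (nat \<Rightarrow> 'a::euclidean_space \<times> real \<Rightarrow> 'n) \<Rightarrow> (nat \<Rightarrow> 'n \<Rightarrow> 'a \<times> real) \<Rightarrow> (nat \<Rightarrow> ('a \<times> real) set) \<Rightarrow>
   (nat \<Rightarrow> 'a \<times> real \<Rightarrow> 'n) \<Rightarrow> bool" where
  "graph_atlas G G' \<kappa> W Q P A B U \<xi> \<longleftrightarrow>
     (\<forall>i. graph_chart G G' \<kappa> (Q i) (A i) (B i) (U i) (\<xi> i) \<and> Q i \<subseteq> W \<and> P i \<subseteq> Q i \<and> P i \<in> sets borel) \<and>
     disjoint_family P \<and> (\<Union>i. P i) = W"

lemma graph_atlasD:
  assumes "graph_atlas G G' \<kappa> W Q P A B U \<xi>"
  shows "graph_chart G G' \<kappa> (Q i) (A i) (B i) (U i) (\<xi> i)" "Q i \<subseteq> W" "P i \<subseteq> Q i" "P i \<in> sets borel"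
    "disjoint_family P" "(\<Union>i. P i) = W"
  using assms unfolding graph_atlas_def by blast+

lemma graph_atlas_integral:
  fixes \<phi> :: "'n::euclidean_space \<Rightarrow> real"
  assumes atlas: "graph_atlas G G' \<kappa> W Q P A B U \<xi>"
    and \<phi>: "\<phi> \<in> borel_measurable borel" "\<And>x. 0 \<le> \<phi> x" "\<And>x. x \<notin> W \<Longrightarrow> \<phi> x = 0"
  shows "(\<integral>\<^sup>+x. ennreal (\<phi> x) \<partial>lborel) =
       (\<Sum>i. \<integral>\<^sup>+t. \<integral>\<^sup>+y. ennreal (indicator (U i) (y, t) / \<bar>G' (\<xi> i (y, t)) (A i (0, 1))\<bar> *
          (indicator (P i) (\<xi> i (y, t)) * \<phi> (\<xi> i (y, t)))) \<partial>lborel \<partial>lborel)"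
proof -
  note at = graph_atlasD[OF atlas]
  note [measurable] = \<phi>(1) at(4)
  have "ennreal (\<phi> x) = (\<Sum>i. ennreal (indicator (P i) x * \<phi> x))" for x
  proof (cases "x \<in> W")
    case True
    then obtain j where j: "x \<in> P j" using at(6) by blast
    have "x \<in> P i \<longleftrightarrow> i = j" for i using at(5) j unfolding disjoint_family_on_def by blast
    then have "ennreal (indicator (P i) x * \<phi> x) = (if i = j then ennreal (\<phi> x) else 0)" for i
      by (simp add: indicator_def)
    then show ?thesis using sums_single[of j "\<lambda>_. ennreal (\<phi> x)"] by (simp add: sums_iff)
  qed (simp add: \<phi>(3))
  then have "(\<integral>\<^sup>+x. ennreal (\<phi> x) \<partial>lborel) = (\<integral>\<^sup>+x. (\<Sum>i. ennreal (indicator (P i) x * \<phi> x)) \<partial>lborel)" by simp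
  also have "\<dots> = (\<Sum>i. \<integral>\<^sup>+x. ennreal (indicator (P i) x * \<phi> x) \<partial>lborel)"
    by (rule nn_integral_suminf) measurable
  also have "\<dots> = (\<Sum>i. \<integral>\<^sup>+t. \<integral>\<^sup>+y. ennreal (indicator (U i) (y, t) / \<bar>G' (\<xi> i (y, t)) (A i (0, 1))\<bar> *
          (indicator (P i) (\<xi> i (y, t)) * \<phi> (\<xi> i (y, t)))) \<partial>lborel \<partial>lborel)"
  proof (intro arg_cong[of _ _ suminf] ext)
    fix i
    have "(\<lambda>x. indicator (P i) x * \<phi> x) \<in> borel_measurable borel" by measurable
    moreover have "\<forall>x. 0 \<le> indicator (P i) x * \<phi> x" "\<forall>x. x \<notin> Q i \<longrightarrow> indicator (P i) x * \<phi> x = 0"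
      using at(3)[of i] \<phi>(2) by (auto simp: indicator_def)
    ultimately show "(\<integral>\<^sup>+x. ennreal (indicator (P i) x * \<phi> x) \<partial>lborel) =
      (\<integral>\<^sup>+t. \<integral>\<^sup>+y. ennreal (indicator (U i) (y, t) / \<bar>G' (\<xi> i (y, t)) (A i (0, 1))\<bar> *
          (indicator (P i) (\<xi> i (y, t)) * \<phi> (\<xi> i (y, t)))) \<partial>lborel \<partial>lborel)"
      using at(1)[of i, unfolded graph_chart_def] by blast
  qed
  finally show ?thesis .
qed

text \<open>A choice of coordinates that is good at a point stays good on a small ball, and
  Lindelof's theorem leaves countably many such domains. With \<open>A\<^sub>0\<close> the empty set
  becomes a chart domain as well, so that the family can be enumerated by all of \<open>nat\<close>
  even if it is finite or empty.\<close>

lemma graph_atlas_exists: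
  fixes W :: "'n::euclidean_space set" and A\<^sub>0 :: "'a::euclidean_space \<times> real \<Rightarrow> 'n" and G :: "'n \<Rightarrow> real"
  assumes W: "open W" and ne: "coord_iso A\<^sub>0 B\<^sub>0" and \<kappa>: "0 \<le> \<kappa>"
    and der: "\<And>x. x \<in> W \<Longrightarrow> (G has_derivative G' x) (at x)"
    and cont: "\<And>e. continuous_on W (\<lambda>x. G' x e)"
    and ex: "\<And>x. x \<in> W \<Longrightarrow> \<exists>(A :: 'a \<times> real \<Rightarrow> 'n) B. coord_iso A B \<and> \<kappa> < \<bar>G' x (A (0, 1))\<bar>"
  shows "\<exists>Q P (A :: nat \<Rightarrow> 'a \<times> real \<Rightarrow> 'n) B U \<xi>. graph_atlas G G' \<kappa> W Q P A B U \<xi>"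
proof -
  define good where "good Q \<longleftrightarrow> open Q \<and> convex Q \<and> Q \<subseteq> W \<and>
    (\<exists>(A :: 'a \<times> real \<Rightarrow> 'n) B. coord_iso A B \<and> (\<forall>x\<in>Q. \<kappa> < \<bar>G' x (A (0, 1))\<bar>))" for Q
  have good0: "good {}" unfolding good_def using ne by auto
  have cover: "\<Union>{Q. good Q} = W"
  proof (intro equalityI subsetI)
    fix x assume x: "x \<in> W"
    obtain A :: "'a \<times> real \<Rightarrow> 'n" and B where A: "coord_iso A B" "\<kappa> < \<bar>G' x (A (0, 1))\<bar>" using ex[OF x] by blast
    have "continuous_on W (\<lambda>x. \<bar>G' x (A (0, 1))\<bar>)" using cont by (intro continuous_on_rabs)
    then have "open (W \<inter> (\<lambda>x. \<bar>G' x (A (0, 1))\<bar>) -` {\<kappa><..})"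
      using W by (intro continuous_open_preimage) auto
    then obtain r where r: "r > 0" "ball x r \<subseteq> W \<inter> (\<lambda>x. \<bar>G' x (A (0, 1))\<bar>) -` {\<kappa><..}"
      using x A(2) open_contains_ball by (metis (no_types, lifting) IntI greaterThan_iff vimageI)
    then have "good (ball x r)" unfolding good_def using A(1) by (auto simp: convex_ball)
    with r(1) show "x \<in> \<Union>{Q. good Q}" by (auto intro!: exI[of _ "ball x r"])
  qed (auto simp: good_def)
  obtain F where F: "F \<subseteq> {Q. good Q}" "countable F" "\<Union>F = \<Union>{Q. good Q}"
    by (rule Lindelof[of "{Q. good Q}"]) (auto simp: good_def)
  define Q where "Q = from_nat_into (insert {} F)"
  have rQ: "range Q = insert {} F" unfolding Q_def using F(2) by (intro range_from_nat_into) auto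
  have gQ: "good (Q i)" for i using rQ F(1) good0 by (metis insertE mem_Collect_eq rangeI subsetD)
  have UQ: "(\<Union>i. Q i) = W" using rQ F(3) cover by simp
  have "\<exists>(A :: 'a \<times> real \<Rightarrow> 'n) B U \<xi>. graph_chart G G' \<kappa> (Q i) A B U \<xi>" for i
  proof -
    obtain A :: "'a \<times> real \<Rightarrow> 'n" and B where A: "coord_iso A B" "\<And>x. x \<in> Q i \<Longrightarrow> \<kappa> < \<bar>G' x (A (0, 1))\<bar>"
      and Qi: "open (Q i)" "convex (Q i)" "Q i \<subseteq> W" using gQ[of i] unfolding good_def by blast
    have d: "(G has_derivative G' x) (at x)" if "x \<in> Q i" for x using der that Qi(3) by blast
    have c: "continuous_on (Q i) (\<lambda>x. G' x (A (0, 1)))" using cont Qi(3) continuous_on_subset by blast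
    show ?thesis using level_chart[OF A(1) Qi(1,2) d c \<kappa> A(2)] by blast
  qed
  then obtain A :: "nat \<Rightarrow> 'a \<times> real \<Rightarrow> 'n" and B U \<xi> where
    chart: "\<And>i. graph_chart G G' \<kappa> (Q i) (A i) (B i) (U i) (\<xi> i)" by metis
  define P where "P = disjointed Q"
  have "P i \<in> sets borel" for i
    unfolding P_def disjointed_def using gQ by (intro sets.Diff sets.finite_UN) (auto simp: good_def)
  moreover have "P i \<subseteq> Q i" for i unfolding P_def by (rule disjointed_subset)
  moreover have "(\<Union>i. P i) = W" unfolding P_def UN_disjointed_eq UQ ..
  moreover have "disjoint_family P" unfolding P_def by (rule disjoint_family_disjointed)
  moreover have "Q i \<subseteq> W" for i using gQ[of i] by (simp add: good_def)
  ultimately have "graph_atlas G G' \<kappa> W Q P A B U \<xi>" unfolding graph_atlas_def using chart by blast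
  then show ?thesis by blast
qed

text \<open>The derivative is a pointwise limit of difference quotients of a Borel function. This
  supplies measurability along arcs, where the derivative of \<open>w\<close> is not assumed to be
  continuous.\<close>

lemma borel_measurable_derivative:
  fixes f f' :: "real \<Rightarrow> real"
  assumes V: "open V" and der: "\<And>z. z \<in> V \<Longrightarrow> (f has_field_derivative f' z) (at z)"
  shows "(\<lambda>z. indicator V z * f' z) \<in> borel_measurable borel"
proof (rule borel_measurable_LIMSEQ_real)
  define F where "F z = indicator V z * f z" for z
  have "continuous_on V f" using der DERIV_isCont by (intro continuous_at_imp_continuous_on) blast
  then have [measurable]: "F \<in> borel_measurable borel"
    using borel_measurable_continuous_on_indicator[of V f] V by (simp add: F_def[abs_def])
  note [measurable] = borel_open[OF V]
  show "(\<lambda>z. indicator V z * ((F (z + inverse (Suc n)) - F z) / inverse (Suc n))) \<in> borel_measurable borel" for n :: nat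
    by measurable
  fix z
  show "(\<lambda>n. indicator V z * ((F (z + inverse (Suc n)) - F z) / inverse (Suc n))) \<longlonglongrightarrow> indicator V z * f' z"
  proof (cases "z \<in> V")
    case True
    have "(F has_field_derivative f' z) (at z)"
      using der[OF True] by (rule has_field_derivative_transform_within_open[OF _ V True]) (simp add: F_def)
    then have "(\<lambda>h. (F (z + h) - F z) / h) \<midarrow>0\<rightarrow> f' z" by (simp add: DERIV_def)
    moreover have "filterlim (\<lambda>n. inverse (real (Suc n))) (at 0) sequentially"
      using LIMSEQ_inverse_real_of_nat by (simp add: filterlim_at eventually_sequentially)
    ultimately have "(\<lambda>n. (F (z + inverse (Suc n)) - F z) / inverse (Suc n)) \<longlonglongrightarrow> f' z"
      by (rule filterlim_compose)
    then show ?thesis using True by simp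
  qed simp
qed

section \<open>Integration along a foliation\<close>

lemma coord_iso_norm_inverse: "coord_iso A B \<Longrightarrow> norm (B y) = norm y"
  unfolding coord_iso_def by metis

lemma coord_iso_norm_axis:
  fixes A :: "'a::euclidean_space \<times> real \<Rightarrow> 'n::euclidean_space"
  assumes "coord_iso A B" shows "norm (A (0, 1)) = 1"
proof -
  have "norm (A (0, 1)) = norm (0::'a, 1::real)" using assms unfolding coord_iso_def by blast
  then show ?thesis by (simp add: norm_Pair)
qed

text \<open>The kernel of \<open>f\<close> is a graph over the first factor of the coordinates, and
  \<open>T k\<close> is its vector above \<open>k\<close>. For \<open>f\<close> the derivative of
  the defining function these are the tangent vectors of a level set, and
  \<open>\<beta> / \<kappa>\<close> bounds the slope of the graph.\<close>

lemma graph_tangent: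
  fixes A :: "'a::euclidean_space \<times> real \<Rightarrow> 'n::euclidean_space" and f :: "'n \<Rightarrow> real"
  assumes iso: "coord_iso A B" and f: "linear f" "f (A (0, 1)) \<noteq> 0"
  defines "T \<equiv> (\<lambda>k. A (k, - f (A (k, 0)) / f (A (0, 1))))"
  shows graph_tangent_zero: "f (T k) = 0"
    and graph_tangent_fst: "fst (B (T k)) = k"
    and graph_tangent_onto: "f d = 0 \<Longrightarrow> T (fst (B d)) = d"
    and graph_tangent_bound: "(\<And>h. \<bar>f h\<bar> \<le> \<beta> * norm h) \<Longrightarrow> 0 < \<kappa> \<Longrightarrow> \<kappa> < \<bar>f (A (0, 1))\<bar> \<Longrightarrow>
        norm (T k) \<le> (1 + \<beta> / \<kappa>) * norm k"
proof -
  have A: "linear A" "\<And>x. norm (A x) = norm x" "\<And>x. B (A x) = x" "\<And>y. A (B y) = y"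
    using iso by (auto simp: coord_iso_def)
  have split: "A (k, s) = A (k, 0) + s *\<^sub>R A (0, 1)" for k s
    using linear_add[OF A(1), of "(k, 0)" "s *\<^sub>R (0, 1)"] linear_cmul[OF A(1), of s "(0,1)"] by simp
  have fs: "f (A (k, s)) = f (A (k, 0)) + s * f (A (0, 1))" for k s
  proof -
    have "f (A (k, s)) = f (A (k, 0) + s *\<^sub>R A (0, 1))" using split by metis
    also have "\<dots> = f (A (k, 0)) + s * f (A (0, 1))" using f(1) by (simp add: linear_add linear_cmul)
    finally show ?thesis .
  qed
  show "f (T k) = 0" unfolding T_def using fs[of k "- f (A (k, 0)) / f (A (0, 1))"] f(2) by simp
  show "fst (B (T k)) = k" unfolding T_def by (simp add: A)
  show "T (fst (B d)) = d" if d: "f d = 0" for d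
  proof -
    have "f (A (fst (B d), snd (B d))) = 0" using d by (simp add: A)
    then have "snd (B d) = - f (A (fst (B d), 0)) / f (A (0, 1))"
      unfolding fs[of "fst (B d)" "snd (B d)"] using f(2) by (simp add: field_simps)
    then show ?thesis unfolding T_def by (metis A(4) prod.collapse)
  qed
  show "norm (T k) \<le> (1 + \<beta> / \<kappa>) * norm k"
    if \<beta>: "\<And>h. \<bar>f h\<bar> \<le> \<beta> * norm h" and \<kappa>: "0 < \<kappa>" "\<kappa> < \<bar>f (A (0, 1))\<bar>"
  proof -
    have nk: "norm (A (k, 0)) = norm k" using A(2)[of "(k, 0)"] by (simp add: norm_Pair)
    have n1: "norm (A (0, 1)) = 1" using A(2)[of "(0, 1)"] by (simp add: norm_Pair)
    have fk: "\<bar>f (A (k, 0))\<bar> \<le> \<beta> * norm k" using \<beta>[of "A (k, 0)"] nk by simp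
    have "norm (T k) \<le> norm (A (k, 0)) + norm ((- f (A (k, 0)) / f (A (0, 1))) *\<^sub>R A (0, 1))"
      unfolding T_def using split[of k "- f (A (k, 0)) / f (A (0, 1))"] norm_triangle_ineq by metis
    also have "\<dots> = norm k + \<bar>f (A (k, 0))\<bar> / \<bar>f (A (0, 1))\<bar>" by (simp add: nk n1)
    also have "\<bar>f (A (k, 0))\<bar> / \<bar>f (A (0, 1))\<bar> \<le> (\<beta> * norm k) / \<kappa>"
      using fk \<kappa> by (intro frac_le) auto
    finally show ?thesis by (simp add: algebra_simps)
  qed
qed

text \<open>Two graph charts are nested: \<open>\<xi>1 c (_, t)\<close> parametrizes a patch of the
  surface over a plane, and \<open>\<xi>2 c (_, r)\<close> a level curve, in that plane, of
  \<open>g\<close> pulled back. \<open>N c \<psi>\<close> is \<open>\<psi>\<close> on the resulting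
  space curve times the densities of both charts. In the constant,
  \<open>1 / (\<kappa>1 * \<kappa>2)\<close> bounds the density from above,
  \<open>\<beta> * (C\<^sub>g * T1)\<close> bounds its reciprocal, and
  \<open>T1 * (1 + C\<^sub>g * T1 / \<kappa>2)\<close> bounds the speed of the curve.\<close>

lemma level_curve_estimate:
  fixes A1 :: "nat \<Rightarrow> (real \<times> real) \<times> real \<Rightarrow> 'n::euclidean_space"
    and A2 :: "nat \<Rightarrow> real \<times> real \<Rightarrow> real \<times> real"
    and v g w h :: "'n \<Rightarrow> real" and v' w' :: "'n \<Rightarrow> 'n \<Rightarrow> real" and D :: "'n \<Rightarrow> 'n"
    and \<Omega> :: "'n set" and t r \<beta> \<kappa>1 \<kappa>2 C\<^sub>g K :: real and B1 \<xi>1 U1 P1 B2 \<xi>2 U2 P2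
  defines "S \<equiv> {x\<in>\<Omega>. v x = t}"
  defines "T \<equiv> (\<lambda>c y k. A1 c (k, - v' (\<xi>1 c (y, t)) (A1 c (k, 0)) / v' (\<xi>1 c (y, t)) (A1 c (0, 1))))"
  defines "G' \<equiv> (\<lambda>c y k. D (\<xi>1 c (y, t)) \<bullet> T c y k)"
  defines "N \<equiv> (\<lambda>c \<psi> z. indicator (U2 c) (z, r) / \<bar>G' c (\<xi>2 c (z, r)) (A2 c (0, 1))\<bar> *
      (indicator (P2 c) (\<xi>2 c (z, r)) * (indicator (U1 c) (\<xi>2 c (z, r), t) /
         \<bar>v' (\<xi>1 c (\<xi>2 c (z, r), t)) (A1 c (0, 1))\<bar> *
       (indicator (P1 c) (\<xi>1 c (\<xi>2 c (z, r), t)) * (\<psi> (\<xi>1 c (\<xi>2 c (z, r), t)) :: real)))))"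
  assumes \<Omega>: "bounded \<Omega>"
    and chart1: "\<And>c. graph_chart v v' \<kappa>1 (Q1 c) (A1 c) (B1 c) (U1 c) (\<xi>1 c)"
    and PQ1: "\<And>c. Q1 c \<subseteq> \<Omega>" "\<And>c. P1 c \<subseteq> Q1 c" "\<And>c. P1 c \<in> sets borel"
    and chart2: "\<And>c. graph_chart (\<lambda>y. g (\<xi>1 c (y, t))) (G' c) \<kappa>2 (Q2 c) (A2 c) (B2 c) (U2 c) (\<xi>2 c)"
    and PQ2: "\<And>c. Q2 c \<subseteq> {y. (y, t) \<in> U1 c}" "\<And>c. P2 c \<subseteq> Q2 c" "\<And>c. P2 c \<in> sets borel"
    and cover: "\<And>x. x \<in> S \<Longrightarrow> \<exists>c. x \<in> P1 c \<and> fst (B1 c x) \<in> P2 c"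
    and disj: "\<And>x c d. x \<in> P1 c \<Longrightarrow> fst (B1 c x) \<in> P2 c \<Longrightarrow> x \<in> P1 d \<Longrightarrow> fst (B1 d x) \<in> P2 d \<Longrightarrow> c = d"
    and v': "\<And>x. x \<in> \<Omega> \<Longrightarrow> linear (v' x)" "\<And>x h. x \<in> \<Omega> \<Longrightarrow> \<bar>v' x h\<bar> \<le> \<beta> * norm h"
    and D: "\<And>x. x \<in> S \<Longrightarrow> norm (D x) \<le> C\<^sub>g"
    and pos: "0 < \<kappa>1" "0 < \<kappa>2" "0 < \<beta>" "0 < C\<^sub>g" "0 \<le> K"
    and comp: "\<And>E. E \<in> components {x\<in>\<Omega>. v x = t \<and> g x = r} \<Longrightarrow> closure E \<inter> frontier \<Omega> \<noteq> {}"
    and H: "hausdorff1 {x\<in>\<Omega>. v x = t \<and> g x = r} \<le> ennreal K"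
    and w: "\<And>x. x \<in> \<Omega> \<Longrightarrow> (w has_derivative w' x) (at x)" "continuous_on (closure \<Omega>) w"
      "\<And>x. x \<in> frontier \<Omega> \<Longrightarrow> w x = 0" "w \<in> borel_measurable borel"
    and h: "\<And>x \<tau>. x \<in> \<Omega> \<Longrightarrow> v' x \<tau> = 0 \<Longrightarrow> \<bar>w' x \<tau>\<bar> \<le> h x * norm \<tau>" "\<And>x. 0 \<le> h x"
      "h \<in> borel_measurable borel"
  defines "T1 \<equiv> 1 + \<beta> / \<kappa>1"
  shows "(\<Sum>c. \<integral>\<^sup>+z. ennreal (N c (\<lambda>x. \<bar>w x\<bar>) z) \<partial>lborel)
    \<le> ennreal (1 / (\<kappa>1 * \<kappa>2) * K * (T1 * (1 + C\<^sub>g * T1 / \<kappa>2) * (\<beta> * (C\<^sub>g * T1)))) *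
      (\<Sum>c. \<integral>\<^sup>+z. ennreal (N c h z) \<partial>lborel)"
proof -
  \<comment> \<open>\<open>\<eta>\<close> is the planar curve, \<open>x\<close> the space curve
    above it, \<open>\<tau>\<close> its velocity and \<open>\<rho>\<close> the product of the two
    densities. \<open>Z c\<close> keeps those parameters whose points belong to the pieces assigned
    to \<open>c\<close>.\<close>
  define \<eta> where "\<eta> c z = \<xi>2 c (z, r)" for c z
  define x where "x c z = \<xi>1 c (\<eta> c z, t)" for c z
  define Z where "Z c = {z. (z, r) \<in> U2 c \<and> \<eta> c z \<in> P2 c \<and> x c z \<in> P1 c}" for c
  define T2 where "T2 c z k = A2 c (k, - G' c (\<eta> c z) (A2 c (k, 0)) / G' c (\<eta> c z) (A2 c (0, 1)))" for c z and k :: real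
  define \<tau> where "\<tau> c z = T c (\<eta> c z) (T2 c z 1)" for c z
  define \<rho> where "\<rho> c z = 1 / (\<bar>G' c (\<eta> c z) (A2 c (0, 1))\<bar> * \<bar>v' (x c z) (A1 c (0, 1))\<bar>)" for c z
  \<comment> \<open>This recovers the parameter of a point on the curve. It is composed of
    isometries and coordinate projections, hence 1-Lipschitz, as the comparison with Hausdorff
    measure requires.\<close>
  define p where "p c y = fst (B2 c (fst (B1 c y)))" for c y
  define \<Lambda> where "\<Lambda> = T1 * (1 + C\<^sub>g * T1 / \<kappa>2)"
  have T1: "T1 > 0" unfolding T1_def using pos by (simp add: add_pos_nonneg)
  have \<Lambda>0: "\<Lambda> \<ge> 0" unfolding \<Lambda>_def using T1 pos by simp
  note c1 = graph_chartD[OF chart1] and c2 = graph_chartD[OF chart2]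
  note iso1 = c1(1) and iso2 = c2(1)
  have [measurable]: "\<xi>1 c \<in> borel_measurable borel" "\<xi>2 c \<in> borel_measurable borel" "U2 c \<in> sets borel" for c
    using c1(3) c2(3) c2(2)[THEN borel_open] by blast+
  note [measurable] = PQ1(3) PQ2(3) w(4) h(3)
  have \<eta>m [measurable]: "\<eta> c \<in> borel_measurable borel" for c unfolding \<eta>_def by measurable
  have xm [measurable]: "x c \<in> borel_measurable borel" for c unfolding x_def by measurable
  have Zm [measurable]: "Z c \<in> sets borel" for c
  proof -
    have "Z c = (\<lambda>z. (z, r)) -` U2 c \<inter> (\<eta> c -` P2 c \<inter> x c -` P1 c)" by (auto simp: Z_def)
    moreover have "(\<lambda>z. (z, r)) -` U2 c \<in> sets borel" "\<eta> c -` P2 c \<in> sets borel" "x c -` P1 c \<in> sets borel"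
      using measurable_sets[of "\<lambda>z. (z, r)" borel borel "U2 c"] measurable_sets[OF \<eta>m PQ2(3)] measurable_sets[OF xm PQ1(3)]
      by auto
    ultimately show ?thesis by auto
  qed
  have nB: "norm (fst (B1 c y)) \<le> norm y" "\<bar>fst (B2 c q)\<bar> \<le> norm q" for c y q
  proof -
    have "norm (B1 c y) = norm y" "norm (B2 c q) = norm q"
      using coord_iso_norm_inverse iso1 iso2 by blast+
    then show "norm (fst (B1 c y)) \<le> norm y" "\<bar>fst (B2 c q)\<bar> \<le> norm q"
      using norm_fst_le[of "fst (B1 c y)" "snd (B1 c y)"] norm_fst_le[of "fst (B2 c q)" "snd (B2 c q)"] by simp_all
  qed
  have linp: "linear (p c)" for c
  proof -
    have "linear (B1 c)" "linear (B2 c)" using iso1[of c] iso2[of c] by (auto simp: coord_iso_def)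
    then have "linear (fst \<circ> (B2 c \<circ> (fst \<circ> B1 c)))" by (intro linear_compose linear_fst)
    then show ?thesis by (simp add: p_def[abs_def] o_def)
  qed
  have lip: "\<bar>p c a - p c b\<bar> \<le> dist a b" for c a b
  proof -
    have "p c a - p c b = p c (a - b)" using linp by (simp add: linear_diff)
    also have "\<bar>\<dots>\<bar> \<le> norm (a - b)" unfolding p_def using nB(2)[of c "fst (B1 c (a - b))"] nB(1)[of c "a - b"] by linarith
    finally show ?thesis by (simp add: dist_norm)
  qed
  have f2: "\<eta> c z \<in> Q2 c" "(\<eta> c z, t) \<in> U1 c" "g (x c z) = r" "fst (B2 c (\<eta> c z)) = z"
     "(\<eta> c has_derivative T2 c z) (at z)" "\<kappa>2 < \<bar>G' c (\<eta> c z) (A2 c (0, 1))\<bar>"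
     "x c z \<in> Q1 c" "x c z \<in> \<Omega>" "v (x c z) = t" "fst (B1 c (x c z)) = \<eta> c z"
     "((\<lambda>y. \<xi>1 c (y, t)) has_derivative T c (\<eta> c z)) (at (\<eta> c z))" "\<kappa>1 < \<bar>v' (x c z) (A1 c (0, 1))\<bar>"
     if z: "(z, r) \<in> U2 c" for c z
  proof -
    show q: "\<eta> c z \<in> Q2 c" "g (x c z) = r" "fst (B2 c (\<eta> c z)) = z" "(\<eta> c has_derivative T2 c z) (at z)"
      using c2(8-11)[OF z] by (simp_all add: \<eta>_def[abs_def] x_def T2_def[abs_def])
    show "\<kappa>2 < \<bar>G' c (\<eta> c z) (A2 c (0, 1))\<bar>" by (rule c2(7)[OF q(1)])
    show u: "(\<eta> c z, t) \<in> U1 c" using q(1) PQ2(1) by blast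
    show q': "x c z \<in> Q1 c" "v (x c z) = t" "fst (B1 c (x c z)) = \<eta> c z"
      "((\<lambda>y. \<xi>1 c (y, t)) has_derivative T c (\<eta> c z)) (at (\<eta> c z))"
      using c1(8-11)[OF u] by (simp_all add: x_def T_def)
    show "x c z \<in> \<Omega>" using q'(1) PQ1(1) by blast
    show "\<kappa>1 < \<bar>v' (x c z) (A1 c (0, 1))\<bar>" by (rule c1(7)[OF q'(1)])
  qed
  have T: "v' (x c z) (T c (\<eta> c z) k) = 0" "norm (T c (\<eta> c z) k) \<le> T1 * norm k" if z: "(z, r) \<in> U2 c" for c z k
  proof -
    have ne: "v' (x c z) (A1 c (0, 1)) \<noteq> 0" using f2(12)[OF z] pos by auto
    note lin = v'(1)[OF f2(8)[OF z]]
    show "v' (x c z) (T c (\<eta> c z) k) = 0"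
      using graph_tangent_zero[OF iso1 lin ne, of k] by (simp add: T_def x_def)
    show "norm (T c (\<eta> c z) k) \<le> T1 * norm k"
      using graph_tangent_bound[OF iso1 lin ne v'(2)[OF f2(8)[OF z]] pos(1) f2(12)[OF z], of k]
      by (simp add: T_def x_def T1_def)
  qed
  have linT: "linear (T c (\<eta> c z))" if z: "(z, r) \<in> U2 c" for c z
    using f2(11)[OF z] has_derivative_linear by blast
  have G'bound: "\<bar>G' c (\<eta> c z) k\<bar> \<le> C\<^sub>g * T1 * norm k" if z: "(z, r) \<in> U2 c" for c z k
  proof -
    have "\<bar>G' c (\<eta> c z) k\<bar> \<le> norm (D (x c z)) * norm (T c (\<eta> c z) k)"
      unfolding G'_def x_def by (rule Cauchy_Schwarz_ineq2)
    also have "\<dots> \<le> C\<^sub>g * (T1 * norm k)"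
      using D[of "x c z"] f2(8,9)[OF z] T(2)[OF z] pos by (intro mult_mono) (auto simp: S_def)
    finally show ?thesis by (simp add: mult.assoc)
  qed
  have linG': "linear (G' c (\<eta> c z))" if z: "(z, r) \<in> U2 c" for c z
    unfolding G'_def using linT[OF z] by (intro linearI) (simp_all add: linear_add linear_cmul inner_add_right)
  \<comment> \<open>The velocity is tangent to the level surface of \<open>v\<close>, so
    \<open>h\<close> controls the derivative of \<open>w\<close> along it; the slope bounds of the
    two charts multiply to bound its length.\<close>
  have \<tau>: "\<bar>w' (x c z) (\<tau> c z)\<bar> \<le> \<Lambda> * h (x c z)" if z: "(z, r) \<in> U2 c" for c z
  proof -
    have "norm (\<tau> c z) \<le> T1 * norm (T2 c z 1)" unfolding \<tau>_def by (rule T(2)[OF z])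
    also have "norm (T2 c z 1) \<le> (1 + C\<^sub>g * T1 / \<kappa>2) * norm (1::real)"
      unfolding T2_def using f2(6)[OF z] pos
      by (intro graph_tangent_bound[OF iso2 linG'[OF z] _ G'bound[OF z]]) auto
    finally have "norm (\<tau> c z) \<le> \<Lambda>" using T1 by (simp add: \<Lambda>_def)
    then have "h (x c z) * norm (\<tau> c z) \<le> h (x c z) * \<Lambda>" by (intro mult_left_mono h(2))
    moreover have "\<bar>w' (x c z) (\<tau> c z)\<bar> \<le> h (x c z) * norm (\<tau> c z)"
      using T(1)[OF z] by (intro h(1) f2(8)[OF z]) (simp add: \<tau>_def)
    ultimately show ?thesis by (simp add: mult.commute)
  qed
  have n1: "norm (A1 c (0, 1)) = 1" "norm (A2 c (0, 1)) = 1" for c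
    using iso1 iso2 coord_iso_norm_axis by blast+
  \<comment> \<open>The upper bound removes the density from the integral of |w|; the lower bound
    puts it back into the integral of \<open>h\<close>.\<close>
  have \<rho>: "\<rho> c z \<le> 1 / (\<kappa>1 * \<kappa>2)" "1 / (\<beta> * (C\<^sub>g * T1)) \<le> \<rho> c z" if z: "(z, r) \<in> U2 c" for c z
  proof -
    have b: "\<bar>v' (x c z) (A1 c (0, 1))\<bar> \<le> \<beta>" "\<bar>G' c (\<eta> c z) (A2 c (0, 1))\<bar> \<le> C\<^sub>g * T1"
      using v'(2)[OF f2(8)[OF z], of "A1 c (0, 1)"] G'bound[OF z, of "A2 c (0, 1)"] by (simp_all add: n1)
    show "\<rho> c z \<le> 1 / (\<kappa>1 * \<kappa>2)" unfolding \<rho>_def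
      using f2(6,12)[OF z] pos by (subst mult.commute) (intro frac_le mult_mono mult_pos_pos; simp)
    show "1 / (\<beta> * (C\<^sub>g * T1)) \<le> \<rho> c z" unfolding \<rho>_def
      using f2(6,12)[OF z] pos b by (subst (2) mult.commute) (intro frac_le mult_mono mult_pos_pos; simp)
  qed
  have N: "N c \<psi> z = indicator (Z c) z * (\<rho> c z * \<psi> (x c z))" for c \<psi> z
  proof (cases "z \<in> Z c")
    case True
    then show ?thesis using f2(2)[of z c]
      by (simp add: N_def \<rho>_def Z_def x_def[symmetric] \<eta>_def[symmetric])
  next
    case False
    then show ?thesis by (auto simp: N_def Z_def x_def \<eta>_def indicator_def)
  qed
  have Z_U: "(z, r) \<in> U2 c" if "z \<in> Z c" for c z using that by (simp add: Z_def)
  have derx: "(x c has_vector_derivative \<tau> c z) (at z)" if z: "(z, r) \<in> U2 c" for c z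
  proof -
    have "(x c has_derivative (\<lambda>k. T c (\<eta> c z) (T2 c z k))) (at z)"
      unfolding x_def[abs_def] by (rule has_derivative_compose[OF f2(5)[OF z] f2(11)[OF z]])
    moreover have "T c (\<eta> c z) (T2 c z k) = k *\<^sub>R \<tau> c z" for k
    proof -
      have "T2 c z k = k *\<^sub>R T2 c z 1"
        using linear_cmul[OF has_derivative_linear[OF f2(5)[OF z]], of k 1] by simp
      then show ?thesis unfolding \<tau>_def using linear_cmul[OF linT[OF z]] by simp
    qed
    ultimately show ?thesis by (simp add: has_vector_derivative_def)
  qed
  let ?L = "{x\<in>\<Omega>. v x = t \<and> g x = r}"
  have main: "(\<Sum>c. \<integral>\<^sup>+z. ennreal \<bar>w (x c z)\<bar> * indicator (Z c) z \<partial>lborel)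
    \<le> ennreal K * (\<Sum>c. \<integral>\<^sup>+z. ennreal (\<Lambda> * h (x c z)) * indicator (Z c) z \<partial>lborel)"
  proof (rule curve_family_estimate[where \<Omega> = \<Omega> and L = ?L and p = p and \<tau> = \<tau> and w' = w'])
    show "Z c \<in> sets borel" for c by (rule Zm)
    show "bounded (Z c)" for c
    proof -
      obtain M where M: "\<And>x. x \<in> \<Omega> \<Longrightarrow> norm x \<le> M" using \<Omega> by (auto simp: bounded_iff)
      have "norm z \<le> M" if z: "z \<in> Z c" for z
        using nB(2)[of c "\<eta> c z"] nB(1)[of c "x c z"] M[of "x c z"] f2(4,8,10)[OF Z_U[OF z]] by simp
      then show ?thesis by (auto simp: bounded_iff)
    qed
    show "(x c has_vector_derivative \<tau> c z) (at z)" if "z \<in> Z c" for c z using derx Z_U[OF that] by blast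
    show "?L = (\<Union>c. x c ` Z c)"
    proof (intro equalityI subsetI)
      fix y assume "y \<in> (\<Union>c. x c ` Z c)"
      then obtain c z where "z \<in> Z c" "y = x c z" by blast
      then show "y \<in> ?L" using f2(3,8,9)[OF Z_U[OF \<open>z \<in> Z c\<close>]] by simp
    next
      fix y assume y: "y \<in> ?L"
      then obtain c where c: "y \<in> P1 c" "fst (B1 c y) \<in> P2 c" using cover[of y] by (auto simp: S_def)
      \<comment> \<open>The two chart inverses read off the parameter of \<open>y\<close>, and
        \<open>g y = r\<close> places it on the slice of the second chart at level
        \<open>r\<close>.\<close>
      let ?q = "fst (B1 c y)" let ?z = "fst (B2 c ?q)"
      have y1: "\<xi>1 c (?q, t) = y" using c1(6)[of y c] c(1) PQ1(2) y by blast
      have "(?z, g (\<xi>1 c (?q, t))) \<in> U2 c \<and> \<xi>2 c (?z, g (\<xi>1 c (?q, t))) = ?q" using c2(5,6)[of ?q c] c(2) PQ2(2) by blast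
      moreover have "g y = r" using y by simp
      ultimately have zU: "(?z, r) \<in> U2 c" and \<eta>z: "\<eta> c ?z = ?q" unfolding y1 \<eta>_def by simp_all
      have xz: "x c ?z = y" unfolding x_def \<eta>z y1 ..
      have "?z \<in> Z c" unfolding Z_def mem_Collect_eq \<eta>z xz using zU c by blast
      then have "x c ?z \<in> x c ` Z c" by (rule imageI)
      then show "y \<in> (\<Union>c. x c ` Z c)" unfolding xz by blast
    qed
    show "x c ` Z c \<inter> x d ` Z d = {}" if "c \<noteq> d" for c d
    proof (rule ccontr)
      assume "x c ` Z c \<inter> x d ` Z d \<noteq> {}"
      then obtain a b where ab: "a \<in> Z c" "b \<in> Z d" "x c a = x d b" by blast
      then have "c = d" using f2(10)[OF Z_U[OF ab(1)]] f2(10)[OF Z_U[OF ab(2)]]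
        by (intro disj[of "x c a"]) (auto simp: Z_def)
      with that show False by simp
    qed
    show "\<bar>p c a - p c b\<bar> \<le> dist a b" for c a b by (rule lip)
    show "p c (x c z) = z" if "z \<in> Z c" for c z using f2(4,10)[OF Z_U[OF that]] by (simp add: p_def)
    show "(\<lambda>z. indicator (Z c) z * \<bar>w' (x c z) (\<tau> c z)\<bar>) \<in> borel_measurable borel" for c
    proof -
      \<comment> \<open>\<open>Z c\<close> need not be open. The derivative is taken on the larger
        open set \<open>?V\<close>, shown measurable there, and then restricted.\<close>
      let ?V = "{z. (z, r) \<in> U2 c}"
      have "continuous_on UNIV (\<lambda>z::real. (z, r))" by (intro continuous_intros)
      then have "open ((\<lambda>z. (z, r)) -` U2 c)" using c2(2) by (intro open_vimage) auto
      then have V: "open ?V" by (simp add: vimage_def)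
      have "((\<lambda>z. w (x c z)) has_field_derivative w' (x c z) (\<tau> c z)) (at z)" if "z \<in> ?V" for z
      proof -
        have z: "(z, r) \<in> U2 c" using that by simp
        have "((\<lambda>z. w (x c z)) has_derivative (\<lambda>k. w' (x c z) (k *\<^sub>R \<tau> c z))) (at z)"
          using has_derivative_compose[OF derx[OF z, unfolded has_vector_derivative_def] w(1)[OF f2(8)[OF z]]] .
        moreover have "linear (w' (x c z))" using w(1)[OF f2(8)[OF z]] has_derivative_linear by blast
        ultimately show ?thesis
          by (simp add: has_field_derivative_def linear_cmul mult_commute_abs)
      qed
      from borel_measurable_derivative[OF V this]
      have [measurable]: "(\<lambda>z. indicator ?V z * w' (x c z) (\<tau> c z)) \<in> borel_measurable borel" by simp
      have "(\<lambda>z. indicator (Z c) z * \<bar>w' (x c z) (\<tau> c z)\<bar>) =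
          (\<lambda>z. indicator (Z c) z * \<bar>indicator ?V z * w' (x c z) (\<tau> c z)\<bar>)"
        using Z_U by (auto simp: indicator_def)
      also have "\<dots> \<in> borel_measurable borel" by measurable
      finally show ?thesis .
    qed
    show "\<bar>w' (x c z) (\<tau> c z)\<bar> \<le> \<Lambda> * h (x c z)" if "z \<in> Z c" for c z using \<tau> Z_U[OF that] by blast
  qed (use w comp H in auto)
  have "(\<Sum>c. \<integral>\<^sup>+z. ennreal (N c (\<lambda>x. \<bar>w x\<bar>) z) \<partial>lborel)
      \<le> (\<Sum>c. \<integral>\<^sup>+z. ennreal (1 / (\<kappa>1 * \<kappa>2)) * (ennreal \<bar>w (x c z)\<bar> * indicator (Z c) z) \<partial>lborel)"
  proof (intro suminf_le nn_integral_mono)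
    fix c z
    show "ennreal (N c (\<lambda>x. \<bar>w x\<bar>) z) \<le> ennreal (1 / (\<kappa>1 * \<kappa>2)) * (ennreal \<bar>w (x c z)\<bar> * indicator (Z c) z)"
    proof (cases "z \<in> Z c")
      case True
      then have "N c (\<lambda>x. \<bar>w x\<bar>) z \<le> 1 / (\<kappa>1 * \<kappa>2) * \<bar>w (x c z)\<bar>"
        unfolding N using True mult_right_mono[OF \<rho>(1)[OF Z_U[OF True]], of "\<bar>w (x c z)\<bar>"] by simp
      then have "ennreal (N c (\<lambda>x. \<bar>w x\<bar>) z) \<le> ennreal (1 / (\<kappa>1 * \<kappa>2) * \<bar>w (x c z)\<bar>)" by (rule ennreal_leI)
      also have "\<dots> = ennreal (1 / (\<kappa>1 * \<kappa>2)) * ennreal \<bar>w (x c z)\<bar>" using pos by (intro ennreal_mult) auto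
      finally show ?thesis using True by simp
    qed (simp add: N)
  qed auto
  also have "\<dots> = ennreal (1 / (\<kappa>1 * \<kappa>2)) * (\<Sum>c. \<integral>\<^sup>+z. ennreal \<bar>w (x c z)\<bar> * indicator (Z c) z \<partial>lborel)"
    by (subst nn_integral_cmult) auto
  also have "\<dots> \<le> ennreal (1 / (\<kappa>1 * \<kappa>2)) *
      (ennreal K * (\<Sum>c. \<integral>\<^sup>+z. ennreal (\<Lambda> * h (x c z)) * indicator (Z c) z \<partial>lborel))"
    by (intro mult_left_mono main) auto
  also have "(\<Sum>c. \<integral>\<^sup>+z. ennreal (\<Lambda> * h (x c z)) * indicator (Z c) z \<partial>lborel)
      \<le> (\<Sum>c. \<integral>\<^sup>+z. ennreal (\<Lambda> * (\<beta> * (C\<^sub>g * T1))) * ennreal (N c h z) \<partial>lborel)"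
  proof (intro suminf_le nn_integral_mono)
    fix c z
    show "ennreal (\<Lambda> * h (x c z)) * indicator (Z c) z \<le> ennreal (\<Lambda> * (\<beta> * (C\<^sub>g * T1))) * ennreal (N c h z)"
    proof (cases "z \<in> Z c")
      case True
      have "1 \<le> (\<beta> * (C\<^sub>g * T1)) * \<rho> c z"
        using \<rho>(2)[OF Z_U[OF True]] pos T1 by (simp add: field_simps)
      then have "1 * (\<Lambda> * h (x c z)) \<le> ((\<beta> * (C\<^sub>g * T1)) * \<rho> c z) * (\<Lambda> * h (x c z))"
        using \<Lambda>0 h(2) by (intro mult_right_mono) auto
      then have "ennreal (\<Lambda> * h (x c z)) \<le> ennreal ((\<Lambda> * (\<beta> * (C\<^sub>g * T1))) * N c h z)"
        unfolding N using True by (intro ennreal_leI) (simp add: algebra_simps)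
      also have "\<dots> = ennreal (\<Lambda> * (\<beta> * (C\<^sub>g * T1))) * ennreal (N c h z)"
        using \<Lambda>0 pos T1 by (intro ennreal_mult') auto
      finally show ?thesis using True by simp
    qed simp
  qed auto
  also have "\<dots> = ennreal (\<Lambda> * (\<beta> * (C\<^sub>g * T1))) * (\<Sum>c. \<integral>\<^sup>+z. ennreal (N c h z) \<partial>lborel)"
  proof (subst nn_integral_cmult)
    show "(\<lambda>z. ennreal (N c h z)) \<in> borel_measurable lborel" for c
    proof -
      have "(\<lambda>z. indicator (U2 c) (z, r) / \<bar>G' c (\<xi>2 c (z, r)) (A2 c (0, 1))\<bar>) \<in> borel_measurable borel"
        by (rule measurable_compose[of "\<lambda>z. (z, r)" borel borel, OF _ c2(4)]) measurable
      moreover have "(\<lambda>q. indicator (U1 c) q / \<bar>v' (\<xi>1 c q) (A1 c (0, 1))\<bar>) \<in> borel_measurable borel" by (rule c1(4))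
      then have "(\<lambda>z. indicator (U1 c) (\<eta> c z, t) / \<bar>v' (\<xi>1 c (\<eta> c z, t)) (A1 c (0, 1))\<bar>) \<in> borel_measurable borel"
        by (rule measurable_compose[of "\<lambda>z. (\<eta> c z, t)" borel borel, rotated]) measurable
      ultimately have "(\<lambda>z. indicator (U2 c) (z, r) / \<bar>G' c (\<xi>2 c (z, r)) (A2 c (0, 1))\<bar> *
         (indicator (P2 c) (\<eta> c z) * (indicator (U1 c) (\<eta> c z, t) / \<bar>v' (\<xi>1 c (\<eta> c z, t)) (A1 c (0, 1))\<bar> *
           (indicator (P1 c) (x c z) * h (x c z))))) \<in> borel_measurable borel"
        by measurable
      then show ?thesis unfolding N_def \<eta>_def x_def by simp
    qed
  qed simp
  finally show ?thesis
    using pos \<Lambda>0 T1 by (simp add: \<Lambda>_def mult.assoc[symmetric] ennreal_mult[symmetric] mult_left_mono)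
qed

section \<open>Coordinate changes in the plane and in space, and slice integrals\<close>

lemma coord_iso_id: "coord_iso (\<lambda>p::'a::euclidean_space. p) (\<lambda>p. p)"
  by (simp add: coord_iso_def distr_id2 linear_ident)

lemma coord_iso_swap: "\<exists>B. coord_iso (\<lambda>p::real \<times> real. (snd p, fst p)) B"
proof (rule coord_iso_Basis)
  show "linear (\<lambda>p::real \<times> real. (snd p, fst p))" by (intro linearI) auto
  show "bij_betw (\<lambda>p::real \<times> real. (snd p, fst p)) Basis Basis"
    by (auto simp: bij_betw_def inj_on_def Basis_prod_def)
qed

lemma coord_iso_axis:
  fixes i :: 3
  shows "\<exists>(A :: (real \<times> real) \<times> real \<Rightarrow> real^3) B. coord_iso A B \<and> A (0, 1) = axis i 1"
proof -
  obtain j k :: 3 where jk: "i \<noteq> j" "i \<noteq> k" "j \<noteq> k" "UNIV = {i, j, k}"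
  proof -
    have "i = 1 \<or> i = 2 \<or> i = 3" by (rule exhaust_3)
    then show thesis
      using that[of 2 3] that[of 1 3] that[of 1 2] UNIV_3 by (auto simp: insert_commute)
  qed
  define A where "A = (\<lambda>p :: (real \<times> real) \<times> real.
    fst (fst p) *\<^sub>R axis j 1 + snd (fst p) *\<^sub>R axis k 1 + snd p *\<^sub>R (axis i 1 :: real^3))"
  have lin: "linear A" unfolding A_def by (intro linearI) (auto simp: algebra_simps)
  have B1: "Basis = {((1, 0), 0), ((0, 1), 0), ((0, 0), 1 :: real) :: (real \<times> real) \<times> real}"
    by (auto simp: Basis_prod_def zero_prod_def)
  have B2: "Basis = {axis j 1, axis k 1, axis i 1 :: real^3}"
    using jk(4) by (auto simp: Basis_vec_def)
  have ax: "axis a (1::real) = (axis b 1 :: real^3) \<longleftrightarrow> a = b" for a b by (simp add: axis_eq_axis)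
  have "bij_betw A Basis Basis"
    unfolding B1 B2 bij_betw_def inj_on_def using jk by (auto simp: A_def ax)
  with coord_iso_Basis[OF lin] obtain B where "coord_iso A B" by blast
  moreover have "A (0, 1) = axis i 1" by (simp add: A_def)
  ultimately show ?thesis by blast
qed

lemma borel_measurable_section_integral:
  fixes F :: "'a::euclidean_space \<times> 'b::euclidean_space \<Rightarrow> real"
  assumes [measurable]: "F \<in> borel_measurable borel"
  shows "(\<lambda>t. \<integral>\<^sup>+y. ennreal (F (y, t)) \<partial>lborel) \<in> borel_measurable lborel"
proof (rule lborel.borel_measurable_nn_integral)
  have "continuous_on UNIV (\<lambda>p::'b \<times> 'a. (snd p, fst p))" by (intro continuous_intros)
  from measurable_compose[OF borel_measurable_continuous_onI[OF this] assms]
  have "(\<lambda>p. ennreal (F (snd p, fst p))) \<in> borel_measurable (borel :: ('b \<times> 'a) measure)" by simp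
  then show "(\<lambda>(t, y). ennreal (F (y, t))) \<in> borel_measurable (lborel \<Otimes>\<^sub>M lborel)"
    by (subst lborel_prod) (simp add: case_prod_beta')
qed

text \<open>Pulled back to the parameter domain of a chart of \<open>v\<close>, the function
  \<open>g\<close> is planar with gradient bounded away from 0 and has an atlas of its own; slicing
  by its levels \<open>r\<close> reduces the claim to single curves. The conclusion mentions charts
  of \<open>v\<close> only, so \<open>g\<close> may depend on \<open>t\<close> in any way.\<close>

lemma surface_estimate:
  fixes A1 :: "nat \<Rightarrow> (real \<times> real) \<times> real \<Rightarrow> 'n::euclidean_space"
    and v g w h :: "'n \<Rightarrow> real" and v' w' :: "'n \<Rightarrow> 'n \<Rightarrow> real" and D :: "'n \<Rightarrow> 'n"
    and \<Omega> :: "'n set" and t \<beta> \<kappa>1 c\<^sub>g C\<^sub>g K :: real and B1 \<xi>1 U1 P1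
  defines "S \<equiv> {x\<in>\<Omega>. v x = t}"
  defines "N \<equiv> (\<lambda>i \<psi> y. indicator (U1 i) (y, t) / \<bar>v' (\<xi>1 i (y, t)) (A1 i (0, 1))\<bar> *
       (indicator (P1 i) (\<xi>1 i (y, t)) * (\<psi> (\<xi>1 i (y, t)) :: real)))"
  assumes \<Omega>: "bounded \<Omega>"
    and atlas: "graph_atlas v v' \<kappa>1 \<Omega> Q1 P1 A1 B1 U1 \<xi>1"
    and v': "\<And>x. x \<in> \<Omega> \<Longrightarrow> linear (v' x)" "\<And>x h. x \<in> \<Omega> \<Longrightarrow> \<bar>v' x h\<bar> \<le> \<beta> * norm h"
      "\<And>e. continuous_on \<Omega> (\<lambda>x. v' x e)"
    and D: "continuous_on S D" "\<And>x. x \<in> S \<Longrightarrow> v' x (D x) = 0"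
      "\<And>x. x \<in> S \<Longrightarrow> (g has_derivative (\<lambda>h. D x \<bullet> h)) (at x within S)"
      "\<And>x. x \<in> S \<Longrightarrow> c\<^sub>g \<le> norm (D x)" "\<And>x. x \<in> S \<Longrightarrow> norm (D x) \<le> C\<^sub>g"
    and pos: "0 < \<kappa>1" "0 < c\<^sub>g" "0 < \<beta>" "0 < C\<^sub>g" "0 \<le> K"
    and comp: "AE r in lborel. \<forall>E \<in> components {x\<in>\<Omega>. v x = t \<and> g x = r}. closure E \<inter> frontier \<Omega> \<noteq> {}"
    and H: "\<And>r. hausdorff1 {x\<in>\<Omega>. v x = t \<and> g x = r} \<le> ennreal K"
    and w: "\<And>x. x \<in> \<Omega> \<Longrightarrow> (w has_derivative w' x) (at x)" "continuous_on (closure \<Omega>) w"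
      "\<And>x. x \<in> frontier \<Omega> \<Longrightarrow> w x = 0" "w \<in> borel_measurable borel"
    and h: "\<And>x \<tau>. x \<in> \<Omega> \<Longrightarrow> v' x \<tau> = 0 \<Longrightarrow> \<bar>w' x \<tau>\<bar> \<le> h x * norm \<tau>" "\<And>x. 0 \<le> h x"
      "h \<in> borel_measurable borel"
  defines "T1 \<equiv> 1 + \<beta> / \<kappa>1"
  shows "(\<Sum>i. \<integral>\<^sup>+y. ennreal (N i (\<lambda>x. \<bar>w x\<bar>) y) \<partial>lborel)
    \<le> ennreal (1 / (\<kappa>1 * (c\<^sub>g / 3)) * K * (T1 * (1 + C\<^sub>g * T1 / (c\<^sub>g / 3)) * (\<beta> * (C\<^sub>g * T1)))) *
      (\<Sum>i. \<integral>\<^sup>+y. ennreal (N i h y) \<partial>lborel)"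
proof -
  define Y where "Y i = {y. (y, t) \<in> U1 i}" for i
  define T where "T i y k = A1 i (k, - v' (\<xi>1 i (y, t)) (A1 i (k, 0)) / v' (\<xi>1 i (y, t)) (A1 i (0, 1)))" for i y k
  define G where "G i y = g (\<xi>1 i (y, t))" for i y
  define G' where "G' i y k = D (\<xi>1 i (y, t)) \<bullet> T i y k" for i y k
  note at = graph_atlasD[OF atlas]
  note c1 = graph_chartD[OF at(1)]
  note iso1 = c1(1)
  note [measurable] = c1(3,4) at(4)
  have Yopen: "open (Y i)" for i
  proof -
    have "continuous_on UNIV (\<lambda>y::real \<times> real. (y, t))" by (intro continuous_intros)
    then have "open ((\<lambda>y. (y, t)) -` U1 i)" using c1(2) by (intro open_vimage) auto
    then show ?thesis by (simp add: Y_def vimage_def)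
  qed
  have f: "\<xi>1 i (y, t) \<in> Q1 i" "\<xi>1 i (y, t) \<in> \<Omega>" "\<xi>1 i (y, t) \<in> S" "fst (B1 i (\<xi>1 i (y, t))) = y"
    "((\<lambda>y. \<xi>1 i (y, t)) has_derivative T i y) (at y)"
    "\<kappa>1 < \<bar>v' (\<xi>1 i (y, t)) (A1 i (0, 1))\<bar>" if y: "y \<in> Y i" for i y
  proof -
    have yU: "(y, t) \<in> U1 i" using y by (simp add: Y_def)
    show q: "\<xi>1 i (y, t) \<in> Q1 i" "fst (B1 i (\<xi>1 i (y, t))) = y"
      "((\<lambda>y. \<xi>1 i (y, t)) has_derivative T i y) (at y)"
      using c1(8,10,11)[OF yU] by (simp_all add: T_def[abs_def])
    then show "\<xi>1 i (y, t) \<in> \<Omega>" using at(2) by blast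
    then show "\<xi>1 i (y, t) \<in> S" unfolding S_def using c1(9)[OF yU] by simp
    show "\<kappa>1 < \<bar>v' (\<xi>1 i (y, t)) (A1 i (0, 1))\<bar>" by (rule c1(7)[OF q(1)])
  qed
  have contX: "continuous_on (Y i) (\<lambda>y. \<xi>1 i (y, t))" for i
    using f(5) has_derivative_continuous by (intro continuous_at_imp_continuous_on) blast
  have ne: "v' (\<xi>1 i (y, t)) (A1 i (0, 1)) \<noteq> 0" if "y \<in> Y i" for i y using f(6)[OF that] pos by auto
  \<comment> \<open>\<open>g\<close> is differentiable only within the surface. The chart maps the
    open set \<open>Y i\<close> into the surface, so the pulled back function is differentiable in
    the ordinary sense.\<close>
  have derG: "(G i has_derivative G' i y) (at y)" if y: "y \<in> Y i" for i y
  proof -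
    have X: "((\<lambda>y. \<xi>1 i (y, t)) has_derivative T i y) (at y within Y i)"
      using f(5)[OF y] by (rule has_derivative_at_withinI)
    have "(g has_derivative (\<lambda>h. D (\<xi>1 i (y, t)) \<bullet> h)) (at (\<xi>1 i (y, t)) within (\<lambda>y. \<xi>1 i (y, t)) ` Y i)"
      using D(3)[OF f(3)[OF y]] by (rule has_derivative_subset) (use f(3) in auto)
    from has_derivative_in_compose[OF X this]
    have "((\<lambda>y. g (\<xi>1 i (y, t))) has_derivative (\<lambda>k. D (\<xi>1 i (y, t)) \<bullet> T i y k)) (at y within Y i)" .
    then show ?thesis using y Yopen at_within_open[OF y Yopen]
      by (simp add: G_def[abs_def] G'_def[abs_def])
  qed
  have contG': "continuous_on (Y i) (\<lambda>y. G' i y e)" for i e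
  proof -
    have contA: "continuous_on UNIV (A1 i)"
      using iso1[of i] linear_continuous_on linear_conv_bounded_linear unfolding coord_iso_def by blast
    have vc: "continuous_on (Y i) (\<lambda>y. v' (\<xi>1 i (y, t)) d)" for d
      using f(2) by (intro continuous_on_compose2[OF v'(3) contX]) auto
    have "continuous_on (Y i) (\<lambda>y. (e, - v' (\<xi>1 i (y, t)) (A1 i (e, 0)) / v' (\<xi>1 i (y, t)) (A1 i (0, 1))))"
      using ne by (intro continuous_intros vc) auto
    then have "continuous_on (Y i) (\<lambda>y. T i y e)"
      unfolding T_def by (rule continuous_on_compose2[OF contA]) auto
    moreover have "continuous_on (Y i) (\<lambda>y. D (\<xi>1 i (y, t)))"
      using f(3) by (intro continuous_on_compose2[OF D(1) contX]) auto
    ultimately show ?thesis unfolding G'_def by (intro continuous_intros)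
  qed
  \<comment> \<open>The surface gradient is tangent, hence it is the image under
    \<open>T i y\<close> of its own planar coordinates \<open>?q\<close>. In this direction the
    derivative is |D|^2, while |?q| \<le> |D|; so the absolute values of the two partial derivatives
    add up to at least |D|. One of them is at least \<open>c\<^sub>g / 2\<close>, and the divisor 3
    leaves room for a strict inequality.\<close>
  have exG: "\<exists>(A :: real \<times> real \<Rightarrow> real \<times> real) B. coord_iso A B \<and> c\<^sub>g / 3 < \<bar>G' i y (A (0, 1))\<bar>" if y: "y \<in> Y i" for i y
  proof -
    let ?x = "\<xi>1 i (y, t)"
    let ?d = "D ?x"
    let ?q = "fst (B1 i ?d)"
    have "T i y ?q = ?d" unfolding T_def
      using graph_tangent_onto[OF iso1 v'(1)[OF f(2)[OF y]] ne[OF y] D(2)[OF f(3)[OF y]]] .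
    then have "G' i y ?q = norm ?d * norm ?d" unfolding G'_def by (simp add: power2_norm_eq_inner[symmetric] power2_eq_square)
    moreover have "G' i y ?q = fst ?q * G' i y (1, 0) + snd ?q * G' i y (0, 1)"
    proof -
      have "linear (G' i y)" using derG[OF y] has_derivative_linear by blast
      then have "G' i y (a *\<^sub>R (1, 0) + b *\<^sub>R (0, 1)) = a * G' i y (1, 0) + b * G' i y (0, 1)" for a b
        by (simp only: linear_add linear_cmul real_scaleR_def)
      from this[of "fst ?q" "snd ?q"] show ?thesis by simp
    qed
    moreover have prods: "fst ?q * G' i y (1, 0) \<le> norm ?d * \<bar>G' i y (1, 0)\<bar>" "snd ?q * G' i y (0, 1) \<le> norm ?d * \<bar>G' i y (0, 1)\<bar>"
    proof -
      have "norm ?q \<le> norm ?d"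
      using norm_fst_le[of "fst (B1 i ?d)" "snd (B1 i ?d)"] coord_iso_norm_inverse[OF iso1[of i], of ?d] by simp
      then have le: "\<bar>fst ?q\<bar> \<le> norm ?d" "\<bar>snd ?q\<bar> \<le> norm ?d"
        using norm_fst_le[of "fst ?q" "snd ?q"] norm_snd_le[of "snd ?q" "fst ?q"] by simp_all
      have "a * b \<le> n * \<bar>b\<bar>" if "\<bar>a\<bar> \<le> n" for a b n :: real
        using mult_right_mono[OF that, of "\<bar>b\<bar>"] abs_ge_self[of "a * b"] by (simp add: abs_mult)
      from this[OF le(1)] this[OF le(2)]
      show "fst ?q * G' i y (1, 0) \<le> norm ?d * \<bar>G' i y (1, 0)\<bar>" "snd ?q * G' i y (0, 1) \<le> norm ?d * \<bar>G' i y (0, 1)\<bar>" .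
    qed
    ultimately have "norm ?d * norm ?d \<le> norm ?d * (\<bar>G' i y (1, 0)\<bar> + \<bar>G' i y (0, 1)\<bar>)"
      by (simp add: algebra_simps)
    moreover have d: "c\<^sub>g \<le> norm ?d" using D(4)[OF f(3)[OF y]] .
    then have "0 < norm ?d" using pos(2) by linarith
    ultimately have "norm ?d \<le> \<bar>G' i y (1, 0)\<bar> + \<bar>G' i y (0, 1)\<bar>" using mult_le_cancel_left_pos by blast
    with d have "c\<^sub>g \<le> \<bar>G' i y (1, 0)\<bar> + \<bar>G' i y (0, 1)\<bar>" by linarith
    then have "c\<^sub>g / 3 < \<bar>G' i y (0, 1)\<bar> \<or> c\<^sub>g / 3 < \<bar>G' i y (1, 0)\<bar>" using pos(2) by linarith
    then show ?thesis
    proof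
      assume "c\<^sub>g / 3 < \<bar>G' i y (0, 1)\<bar>"
      then show ?thesis using coord_iso_id by blast
    next
      assume "c\<^sub>g / 3 < \<bar>G' i y (1, 0)\<bar>"
      moreover obtain B where "coord_iso (\<lambda>p::real \<times> real. (snd p, fst p)) B" using coord_iso_swap by blast
      ultimately show ?thesis by (intro exI[of _ "\<lambda>p::real \<times> real. (snd p, fst p)"] exI[of _ B]) simp
    qed
  qed
  have "\<exists>Q P (A :: nat \<Rightarrow> real \<times> real \<Rightarrow> real \<times> real) B U \<xi>. graph_atlas (G i) (G' i) (c\<^sub>g / 3) (Y i) Q P A B U \<xi>" for i
    by (rule graph_atlas_exists[OF Yopen coord_iso_id _ derG contG' exG]) (use pos in simp_all)
  then obtain Q2 P2 and A2 :: "nat \<Rightarrow> nat \<Rightarrow> real \<times> real \<Rightarrow> real \<times> real" and B2 U2 \<xi>2 where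
    atlas2: "\<And>i. graph_atlas (G i) (G' i) (c\<^sub>g / 3) (Y i) (Q2 i) (P2 i) (A2 i) (B2 i) (U2 i) (\<xi>2 i)" by metis
  note at2 = graph_atlasD[OF atlas2]
  note [measurable] = at2(4) graph_chartD(3,4)[OF at2(1)]
  define M where "M i l \<psi> p = indicator (U2 i l) p / \<bar>G' i (\<xi>2 i l p) (A2 i l (0, 1))\<bar> *
          (indicator (P2 i l) (\<xi>2 i l p) * N i \<psi> (\<xi>2 i l p))" for i l \<psi> p
  have Nm: "N i \<psi> \<in> borel_measurable borel" if [measurable]: "\<psi> \<in> borel_measurable borel" for i \<psi>
  proof -
    have "(\<lambda>y. (\<lambda>p. indicator (U1 i) p / \<bar>v' (\<xi>1 i p) (A1 i (0, 1))\<bar>) (y, t)) \<in> borel_measurable borel"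
      by measurable
    then have [measurable]: "(\<lambda>y. indicator (U1 i) (y, t) / \<bar>v' (\<xi>1 i (y, t)) (A1 i (0, 1))\<bar>) \<in> borel_measurable borel" by simp
    show ?thesis unfolding N_def by measurable
  qed
  have Mm: "M i l \<psi> \<in> borel_measurable borel" if "\<psi> \<in> borel_measurable borel" for i l \<psi>
  proof -
    note [measurable] = Nm[OF that]
    show ?thesis unfolding M_def by measurable
  qed
  \<comment> \<open>Pairs of a surface chart and a planar chart are numbered by a single index, the
    form in which the curve estimate takes them.\<close>
  let ?i = "\<lambda>c. fst (prod_decode c)" and ?l = "\<lambda>c. snd (prod_decode c)"
  have flat: "(\<Sum>i. \<Sum>l. F i l) = (\<Sum>c. F (?i c) (?l c))" for F :: "nat \<Rightarrow> nat \<Rightarrow> ennreal"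
    using suminf_ennreal_2dimen[of "\<lambda>i. \<Sum>l. F i l" "\<lambda>p. F (fst p) (snd p)"] by simp
  have decomp: "(\<Sum>i. \<integral>\<^sup>+y. ennreal (N i \<psi> y) \<partial>lborel) =
      (\<integral>\<^sup>+r. (\<Sum>c. \<integral>\<^sup>+z. ennreal (M (?i c) (?l c) \<psi> (z, r)) \<partial>lborel) \<partial>lborel)"
    if \<psi>: "\<psi> \<in> borel_measurable borel" "\<And>x. 0 \<le> \<psi> x" for \<psi>
  proof -
    have "(\<integral>\<^sup>+y. ennreal (N i \<psi> y) \<partial>lborel) = (\<Sum>l. \<integral>\<^sup>+r. \<integral>\<^sup>+z. ennreal (M i l \<psi> (z, r)) \<partial>lborel \<partial>lborel)" for i
      unfolding M_def by (rule graph_atlas_integral[OF atlas2 Nm[OF \<psi>(1)]]) (use \<psi>(2) in \<open>auto simp: N_def Y_def\<close>)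
    then have "(\<Sum>i. \<integral>\<^sup>+y. ennreal (N i \<psi> y) \<partial>lborel) = (\<Sum>i. \<Sum>l. \<integral>\<^sup>+r. \<integral>\<^sup>+z. ennreal (M i l \<psi> (z, r)) \<partial>lborel \<partial>lborel)" by simp
    also have "\<dots> = (\<Sum>c. \<integral>\<^sup>+r. \<integral>\<^sup>+z. ennreal (M (?i c) (?l c) \<psi> (z, r)) \<partial>lborel \<partial>lborel)"
      by (rule flat)
    also have "\<dots> = (\<integral>\<^sup>+r. (\<Sum>c. \<integral>\<^sup>+z. ennreal (M (?i c) (?l c) \<psi> (z, r)) \<partial>lborel) \<partial>lborel)"
      by (rule nn_integral_suminf[symmetric]) (rule borel_measurable_section_integral[OF Mm[OF \<psi>(1)]])
    finally show ?thesis .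
  qed
  let ?C = "1 / (\<kappa>1 * (c\<^sub>g / 3)) * K * (T1 * (1 + C\<^sub>g * T1 / (c\<^sub>g / 3)) * (\<beta> * (C\<^sub>g * T1)))"
  have each: "(\<Sum>c. \<integral>\<^sup>+z. ennreal (M (?i c) (?l c) (\<lambda>x. \<bar>w x\<bar>) (z, r)) \<partial>lborel)
     \<le> ennreal ?C * (\<Sum>c. \<integral>\<^sup>+z. ennreal (M (?i c) (?l c) h (z, r)) \<partial>lborel)"
    if r: "\<forall>E \<in> components {x\<in>\<Omega>. v x = t \<and> g x = r}. closure E \<inter> frontier \<Omega> \<noteq> {}" for r
    unfolding M_def N_def G'_def T_def T1_def
  proof (rule level_curve_estimate[where g = g and w' = w'
        and \<Omega> = \<Omega> and ?Q1.0 = "\<lambda>c. Q1 (?i c)" and ?Q2.0 = "\<lambda>c. Q2 (?i c) (?l c)" and v = v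
        and ?B1.0 = "\<lambda>c. B1 (?i c)" and ?B2.0 = "\<lambda>c. B2 (?i c) (?l c)"])
    show "\<exists>c. x \<in> P1 (?i c) \<and>
        fst (B1 (?i c) x) \<in> P2 (?i c) (?l c)"
      if x: "x \<in> {x \<in> \<Omega>. v x = t}" for x
    proof -
      obtain i where i: "x \<in> P1 i" using at(6) x by blast
      then have "x \<in> Q1 i" using at(3) by blast
      then have "(fst (B1 i x), v x) \<in> U1 i" by (rule c1(5))
      then have "fst (B1 i x) \<in> Y i" using x by (simp add: Y_def)
      then obtain l where "fst (B1 i x) \<in> P2 i l" using at2(6) by blast
      with i show ?thesis by (intro exI[of _ "prod_encode (i, l)"]) simp
    qed
    show "c = d" if "x \<in> P1 (?i c)" "fst (B1 (?i c) x) \<in> P2 (?i c) (?l c)"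
       "x \<in> P1 (?i d)" "fst (B1 (?i d) x) \<in> P2 (?i d) (?l d)" for x c d
    proof -
      have 1: "?i c = ?i d"
        using at(5) that(1,3) unfolding disjoint_family_on_def by blast
      have 2: "?l c = ?l d"
        using at2(5)[of "?i c"] that(2,4) unfolding 1 disjoint_family_on_def by blast
      from 1 2 have "prod_decode c = prod_decode d" by (rule prod_eqI)
      then show ?thesis using inj_prod_decode by (simp add: inj_eq)
    qed
    show "Q2 (?i c) (?l c) \<subseteq> {y. (y, t) \<in> U1 (?i c)}" for c using at2(2) unfolding Y_def .
  qed (use \<Omega> at(1-4) at2(3,4) v' D(5) pos r H w h at2(1)[unfolded G_def[abs_def] G'_def[abs_def] T_def[abs_def]]
      in \<open>simp_all add: S_def\<close>)
  have "(\<Sum>i. \<integral>\<^sup>+y. ennreal (N i (\<lambda>x. \<bar>w x\<bar>) y) \<partial>lborel) =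
     (\<integral>\<^sup>+r. (\<Sum>c. \<integral>\<^sup>+z. ennreal (M (?i c) (?l c) (\<lambda>x. \<bar>w x\<bar>) (z, r)) \<partial>lborel) \<partial>lborel)"
    using w(4) by (intro decomp) auto
  \<comment> \<open>The null set of levels \<open>r\<close> whose components may miss the boundary
    is lost here.\<close>
  also have "\<dots> \<le> (\<integral>\<^sup>+r. ennreal ?C * (\<Sum>c. \<integral>\<^sup>+z. ennreal (M (?i c) (?l c) h (z, r)) \<partial>lborel) \<partial>lborel)"
    using comp each by (intro nn_integral_mono_AE) auto
  also have "\<dots> = ennreal ?C * (\<integral>\<^sup>+r. (\<Sum>c. \<integral>\<^sup>+z. ennreal (M (?i c) (?l c) h (z, r)) \<partial>lborel) \<partial>lborel)"
    by (intro nn_integral_cmult borel_measurable_suminf_order borel_measurable_section_integral Mm h(3))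
  also have "\<dots> = ennreal ?C * (\<Sum>i. \<integral>\<^sup>+y. ennreal (N i h y) \<partial>lborel)" using h by (subst decomp) auto
  finally show ?thesis .
qed

text \<open>The constant of the surface estimate: \<open>\<kappa>\<close> is the lower bound for the
  partial derivative of \<open>v\<close> in its charts, \<open>c\<^sub>g / 3\<close> the one for
  \<open>g\<close>, and \<open>1 + \<beta> / \<kappa>\<close> stretches planar vectors to tangent
  vectors.\<close>

definition foliation_const :: "real \<Rightarrow> real \<Rightarrow> real \<Rightarrow> real \<Rightarrow> real \<Rightarrow> real" where
  "foliation_const \<kappa> \<beta> c\<^sub>g C\<^sub>g K =
     1 / (\<kappa> * (c\<^sub>g / 3)) * K * ((1 + \<beta> / \<kappa>) * (1 + C\<^sub>g * (1 + \<beta> / \<kappa>) / (c\<^sub>g / 3)) * (\<beta> * (C\<^sub>g * (1 + \<beta> / \<kappa>))))"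

text \<open>Both integrals are sliced by the levels of \<open>v\<close> and compared surface by
  surface. The value \<open>\<alpha> / 2\<close> works because a vector of length at least
  \<open>\<alpha>\<close> in three dimensions has a component of size at least
  \<open>\<alpha>\<close> / sqrt 3. The two maxima give the constants the required signs whatever
  \<open>C\<^sub>g\<close> and \<open>K\<close> are.\<close>

lemma foliation_estimate:
  fixes \<Omega> :: "(real^3) set"
  assumes \<Omega>: "open \<Omega>" "bounded \<Omega>"
    and v: "\<And>x. x \<in> \<Omega> \<Longrightarrow> GDERIV v x :> V x" "continuous_on \<Omega> V"
      "\<And>x. x \<in> \<Omega> \<Longrightarrow> \<alpha> \<le> norm (V x)" "\<And>x. x \<in> \<Omega> \<Longrightarrow> norm (V x) \<le> \<beta>"
    and pos: "0 < \<alpha>" "0 < \<beta>" "0 < c\<^sub>g"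
    and fol: "foliated \<Omega> v c\<^sub>g C\<^sub>g K"
    and w: "\<And>x. x \<in> \<Omega> \<Longrightarrow> (w has_derivative w' x) (at x)" "continuous_on (closure \<Omega>) w"
      "\<And>x. x \<in> frontier \<Omega> \<Longrightarrow> w x = 0"
    and h: "\<And>x \<tau>. x \<in> \<Omega> \<Longrightarrow> \<tau> \<bullet> V x = 0 \<Longrightarrow> \<bar>w' x \<tau>\<bar> \<le> h x * norm \<tau>"
      "\<And>x. x \<in> \<Omega> \<Longrightarrow> 0 \<le> h x" "continuous_on \<Omega> h"
  shows "(\<integral>\<^sup>+x. ennreal (indicator \<Omega> x * \<bar>w x\<bar>) \<partial>lborel)
    \<le> ennreal (foliation_const (\<alpha> / 2) \<beta> c\<^sub>g (max C\<^sub>g c\<^sub>g) (max K 0)) * (\<integral>\<^sup>+x. ennreal (indicator \<Omega> x * h x) \<partial>lborel)"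
proof -
  \<comment> \<open>Extension by zero gives Borel functions on the whole space. On the closure of
    \<open>\<Omega>\<close> it does not change \<open>w\<close>, which vanishes on the
    frontier.\<close>
  define w0 where "w0 x = indicator \<Omega> x * w x" for x
  define h0 where "h0 x = indicator \<Omega> x * h x" for x
  define v' where "v' x k = k \<bullet> V x" for x k :: "real^3"
  have w0b: "w0 \<in> borel_measurable borel"
    using borel_measurable_continuous_on_indicator[of \<Omega> w] \<Omega>(1) continuous_on_subset[OF w(2) closure_subset]
    by (simp add: w0_def[abs_def])
  have h0b: "h0 \<in> borel_measurable borel"
    using borel_measurable_continuous_on_indicator[of \<Omega> h] \<Omega>(1) h(3) by (simp add: h0_def[abs_def])
  have frontier: "x \<notin> \<Omega>" if "x \<in> frontier \<Omega>" for x using that \<Omega>(1) by (simp add: frontier_def interior_open)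
  have w0d: "(w0 has_derivative w' x) (at x)" if x: "x \<in> \<Omega>" for x
    using w(1)[OF x] \<Omega>(1) x by (rule has_derivative_transform_within_open) (simp add: w0_def)
  have w0c: "continuous_on (closure \<Omega>) w0"
    using w(2) by (rule continuous_on_eq) (use w(3) \<Omega>(1) in \<open>auto simp: w0_def indicator_def frontier_def interior_open\<close>)
  have v'lin: "linear (v' x)" for x unfolding v'_def by (intro linearI) (auto simp: inner_add_left)
  have v'b: "\<bar>v' x k\<bar> \<le> \<beta> * norm k" if "x \<in> \<Omega>" for x k
  proof -
    have "\<bar>v' x k\<bar> \<le> norm k * norm (V x)" unfolding v'_def by (rule Cauchy_Schwarz_ineq2)
    also have "\<dots> \<le> norm k * \<beta>" using v(4)[OF that] by (intro mult_left_mono) auto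
    finally show ?thesis by (simp add: mult.commute)
  qed
  have v'c: "continuous_on \<Omega> (\<lambda>x. v' x e)" for e unfolding v'_def by (intro continuous_intros v(2))
  have v'd: "(v has_derivative v' x) (at x)" if "x \<in> \<Omega>" for x
    using v(1)[OF that] unfolding gderiv_def v'_def .
  have ex: "\<exists>(A :: (real \<times> real) \<times> real \<Rightarrow> real^3) B. coord_iso A B \<and> \<alpha> / 2 < \<bar>v' x (A (0, 1))\<bar>" if x: "x \<in> \<Omega>" for x
  proof -
    have "\<exists>i. \<alpha> / 2 < \<bar>V x $ i\<bar>"
    proof (rule ccontr)
      assume "\<not> ?thesis"
      then have "\<bar>V x $ i\<bar> \<le> \<bar>\<alpha> / 2\<bar>" for i using pos by (simp add: not_less)
      then have sq: "(V x $ i)\<^sup>2 \<le> (\<alpha> / 2)\<^sup>2" for i by (simp only: abs_le_square_iff)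
      have "\<alpha>\<^sup>2 \<le> (norm (V x))\<^sup>2" using v(3)[OF x] pos by (intro power_mono) auto
      also have "\<dots> = (V x $ 1)\<^sup>2 + (V x $ 2)\<^sup>2 + (V x $ 3)\<^sup>2"
        unfolding power2_norm_eq_inner inner_vec_def sum_3 by (simp add: power2_eq_square)
      also have "\<dots> \<le> 3 * (\<alpha> / 2)\<^sup>2" using sq[of 1] sq[of 2] sq[of 3] by linarith
      finally show False using pos by (simp add: power_divide field_simps)
    qed
    then obtain i where "\<alpha> / 2 < \<bar>V x $ i\<bar>" by blast
    moreover obtain A :: "(real \<times> real) \<times> real \<Rightarrow> real^3" and B where "coord_iso A B" "A (0, 1) = axis i 1"
      using coord_iso_axis by blast
    moreover have "v' x (axis i 1) = V x $ i" by (simp add: v'_def inner_axis inner_commute)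
    ultimately show ?thesis by (intro exI[of _ A] exI[of _ B]) simp
  qed
  obtain A\<^sub>0 :: "(real \<times> real) \<times> real \<Rightarrow> real^3" and B\<^sub>0 where iso0: "coord_iso A\<^sub>0 B\<^sub>0" using coord_iso_axis by blast
  let ?C = "foliation_const (\<alpha> / 2) \<beta> c\<^sub>g (max C\<^sub>g c\<^sub>g) (max K 0)"
  have "(\<integral>\<^sup>+x. ennreal \<bar>w0 x\<bar> \<partial>lborel) \<le> ennreal ?C * (\<integral>\<^sup>+x. ennreal (h0 x) \<partial>lborel)"
  proof -
    have "\<exists>Q P (A :: nat \<Rightarrow> (real \<times> real) \<times> real \<Rightarrow> real^3) B U \<xi>. graph_atlas v v' (\<alpha> / 2) \<Omega> Q P A B U \<xi>"
      by (rule graph_atlas_exists[OF \<Omega>(1) iso0 _ v'd v'c ex]) (use pos in simp_all)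
    then obtain Q P and A :: "nat \<Rightarrow> (real \<times> real) \<times> real \<Rightarrow> real^3" and B U \<xi> where
      atlas: "graph_atlas v v' (\<alpha> / 2) \<Omega> Q P A B U \<xi>" by blast
    note at = graph_atlasD[OF atlas]
    note chart = graph_chartD[OF at(1)]
    define M where "M i \<psi> p = indicator (U i) p / \<bar>v' (\<xi> i p) (A i (0, 1))\<bar> * (indicator (P i) (\<xi> i p) * \<psi> (\<xi> i p))"
      for i and \<psi> :: "real^3 \<Rightarrow> real" and p
    have Mm: "M i \<psi> \<in> borel_measurable borel" if [measurable]: "\<psi> \<in> borel_measurable borel" for i \<psi>
    proof -
      note [measurable] = chart(3,4) at(4)
      show ?thesis unfolding M_def by measurable
    qed
    have decomp: "(\<integral>\<^sup>+x. ennreal (\<psi> x) \<partial>lborel) = (\<integral>\<^sup>+t. (\<Sum>i. \<integral>\<^sup>+y. ennreal (M i \<psi> (y, t)) \<partial>lborel) \<partial>lborel)"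
      if \<psi>: "\<psi> \<in> borel_measurable borel" "\<And>x. 0 \<le> \<psi> x" "\<And>x. x \<notin> \<Omega> \<Longrightarrow> \<psi> x = 0" for \<psi>
    proof -
      have "(\<integral>\<^sup>+x. ennreal (\<psi> x) \<partial>lborel) = (\<Sum>i. \<integral>\<^sup>+t. \<integral>\<^sup>+y. ennreal (M i \<psi> (y, t)) \<partial>lborel \<partial>lborel)"
        unfolding M_def by (rule graph_atlas_integral[OF atlas \<psi>])
      also have "\<dots> = (\<integral>\<^sup>+t. (\<Sum>i. \<integral>\<^sup>+y. ennreal (M i \<psi> (y, t)) \<partial>lborel) \<partial>lborel)"
        by (rule nn_integral_suminf[symmetric]) (rule borel_measurable_section_integral[OF Mm[OF \<psi>(1)]])
      finally show ?thesis .
    qed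
    have surf: "(\<Sum>i. \<integral>\<^sup>+y. ennreal (M i (\<lambda>x. \<bar>w0 x\<bar>) (y, t)) \<partial>lborel) \<le> ennreal ?C * (\<Sum>i. \<integral>\<^sup>+y. ennreal (M i h0 (y, t)) \<partial>lborel)"
      if t: "t \<in> v ` \<Omega> \<longrightarrow> (\<exists>g D. surface_C1_grad {x\<in>\<Omega>. v x = t} v g D \<and>
           (\<forall>x\<in>\<Omega>. v x = t \<longrightarrow> c\<^sub>g \<le> norm (D x) \<and> norm (D x) \<le> C\<^sub>g) \<and>
           (AE r in lborel. \<forall>S \<in> components {x\<in>\<Omega>. v x = t \<and> g x = r}. C1_curve_reaching_boundary \<Omega> S) \<and>
           (\<forall>r. hausdorff1 {x\<in>\<Omega>. v x = t \<and> g x = r} \<le> ennreal K))" for t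
    proof (cases "t \<in> v ` \<Omega>")
      case False
      \<comment> \<open>A level outside the range of \<open>v\<close> has an empty slice in every
        chart, so both sides are 0.\<close>
      have "M i \<psi> (y, t) = 0" for i \<psi> y
      proof (cases "(y, t) \<in> U i")
        case True
        have \<xi>: "\<xi> i (y, t) \<in> Q i" "v (\<xi> i (y, t)) = t"
          using chart(8,9)[OF True] .
        then have "v (\<xi> i (y, t)) \<in> v ` \<Omega>" using at(2) by blast
        then have "t \<in> v ` \<Omega>" unfolding \<xi>(2) .
        with False show ?thesis by contradiction
      qed (simp add: M_def)
      then show ?thesis by simp
    next
      case True
      then obtain g D where gD: "surface_C1_grad {x\<in>\<Omega>. v x = t} v g D"
        "\<And>x. x \<in> \<Omega> \<Longrightarrow> v x = t \<Longrightarrow> c\<^sub>g \<le> norm (D x) \<and> norm (D x) \<le> C\<^sub>g"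
        "AE r in lborel. \<forall>S \<in> components {x\<in>\<Omega>. v x = t \<and> g x = r}. C1_curve_reaching_boundary \<Omega> S"
        "\<And>r. hausdorff1 {x\<in>\<Omega>. v x = t \<and> g x = r} \<le> ennreal K" using t by blast
      \<comment> \<open>\<open>ennreal\<close> already sends negative reals to 0, so cutting
        \<open>K\<close> off at 0 does not change the length bound.\<close>
      have K: "ennreal (max K 0) = ennreal K" by (simp add: max_def ennreal_neg)
      show ?thesis unfolding M_def foliation_const_def
      proof (rule surface_estimate[where v = v and \<Omega> = \<Omega> and D = D and g = g and w' = w', OF _ atlas])
        show "continuous_on {x \<in> \<Omega>. v x = t} D" using gD(1) by (simp add: surface_C1_grad_def)
        show "v' x (D x) = 0" if "x \<in> {x \<in> \<Omega>. v x = t}" for x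
        proof -
          have "D x \<bullet> grad v x = 0" using gD(1) that unfolding surface_C1_grad_def by blast
          moreover have "grad v x = V x" using that by (intro grad_eqI v(1)) simp
          ultimately show ?thesis by (simp add: v'_def)
        qed
        show "(g has_derivative (\<lambda>h. D x \<bullet> h)) (at x within {x \<in> \<Omega>. v x = t})" if "x \<in> {x \<in> \<Omega>. v x = t}" for x
          using gD(1) that by (simp add: surface_C1_grad_def)
        show "c\<^sub>g \<le> norm (D x)" "norm (D x) \<le> max C\<^sub>g c\<^sub>g" if "x \<in> {x \<in> \<Omega>. v x = t}" for x
          using gD(2)[of x] that by auto
        show "AE r in lborel. \<forall>E\<in>components {x \<in> \<Omega>. v x = t \<and> g x = r}. closure E \<inter> frontier \<Omega> \<noteq> {}"
          using gD(3) by (rule eventually_mono) (auto simp: C1_curve_reaching_boundary_def)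
        show "hausdorff1 {x \<in> \<Omega>. v x = t \<and> g x = r} \<le> ennreal (max K 0)" for r unfolding K by (rule gD(4))
        show "\<bar>w' x \<tau>\<bar> \<le> h0 x * norm \<tau>" if "x \<in> \<Omega>" "v' x \<tau> = 0" for x \<tau>
          using h(1)[OF that(1)] that by (simp add: h0_def v'_def)
        show "0 \<le> h0 x" for x using h(2) by (simp add: h0_def indicator_def)
        show "w0 x = 0" if "x \<in> frontier \<Omega>" for x using frontier[OF that] by (simp add: w0_def)
      qed (use v'lin v'b v'c \<Omega>(2) pos w0d w0c w0b h0b in \<open>simp_all add: less_max_iff_disj\<close>)
    qed
    have "(\<integral>\<^sup>+x. ennreal \<bar>w0 x\<bar> \<partial>lborel) = (\<integral>\<^sup>+t. (\<Sum>i. \<integral>\<^sup>+y. ennreal (M i (\<lambda>x. \<bar>w0 x\<bar>) (y, t)) \<partial>lborel) \<partial>lborel)"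
    proof (rule decomp)
      show "(\<lambda>x. \<bar>w0 x\<bar>) \<in> borel_measurable borel" using w0b by measurable
    qed (auto simp: w0_def)
    also have "\<dots> \<le> (\<integral>\<^sup>+t. ennreal ?C * (\<Sum>i. \<integral>\<^sup>+y. ennreal (M i h0 (y, t)) \<partial>lborel) \<partial>lborel)"
      using fol[unfolded foliated_def] by (intro nn_integral_mono_AE) (auto elim!: eventually_mono intro: surf)
    also have "\<dots> = ennreal ?C * (\<integral>\<^sup>+t. (\<Sum>i. \<integral>\<^sup>+y. ennreal (M i h0 (y, t)) \<partial>lborel) \<partial>lborel)"
      by (intro nn_integral_cmult borel_measurable_suminf_order borel_measurable_section_integral Mm h0b)
    also have "\<dots> = ennreal ?C * (\<integral>\<^sup>+x. ennreal (h0 x) \<partial>lborel)"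
      using h(2) by (subst decomp[OF h0b]) (auto simp: h0_def indicator_def)
    finally show ?thesis .
  qed
  then show ?thesis by (simp add: w0_def h0_def abs_mult)
qed

section \<open>Sobolev functions\<close>

lemma L2_on_measurable: "L2_on X f \<Longrightarrow> f \<in> borel_measurable (lebesgue_on X)"
  by (simp add: L2_on_def)

lemma L2_on_integrable_bound:
  fixes f :: "'a::euclidean_space \<Rightarrow> 'b::euclidean_space" and g :: "'a \<Rightarrow> 'c::euclidean_space"
    and k :: "'a \<Rightarrow> 'd::euclidean_space"
  assumes "L2_on X f" "L2_on X g" "k \<in> borel_measurable (lebesgue_on X)"
    and "\<And>x. norm (k x) \<le> norm (f x) * norm (g x)"
  shows "integrable (lebesgue_on X) k"
proof (rule Bochner_Integration.integrable_bound)
  show "integrable (lebesgue_on X) (\<lambda>x. (norm (f x))\<^sup>2 + (norm (g x))\<^sup>2)"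
    using assms by (simp add: L2_on_def)
  show "AE x in lebesgue_on X. norm (k x) \<le> norm ((norm (f x))\<^sup>2 + (norm (g x))\<^sup>2)"
  proof (rule AE_I2)
    fix x
    have "norm (f x) * norm (g x) \<le> (norm (f x))\<^sup>2 + (norm (g x))\<^sup>2"
      using sum_squares_bound[of "norm (f x)" "norm (g x)"] mult_nonneg_nonneg[OF norm_ge_zero norm_ge_zero, of "f x" "g x"] by linarith
    with assms(4)[of x] show "norm (k x) \<le> norm ((norm (f x))\<^sup>2 + (norm (g x))\<^sup>2)" by simp
  qed
qed (fact assms(3))

lemma L2_on_inner_integrable:
  assumes "L2_on X f" "L2_on X g"
  shows "integrable (lebesgue_on X) (\<lambda>x. f x \<bullet> g x)"
proof (rule L2_on_integrable_bound[OF assms])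
  note [measurable] = assms[THEN L2_on_measurable]
  show "(\<lambda>x. f x \<bullet> g x) \<in> borel_measurable (lebesgue_on X)" by measurable
qed (simp add: Cauchy_Schwarz_ineq2)

lemma L2_on_mult_integrable:
  fixes f g :: "'a::euclidean_space \<Rightarrow> real"
  assumes "L2_on X f" "L2_on X g"
  shows "integrable (lebesgue_on X) (\<lambda>x. f x * g x)"
  using L2_on_inner_integrable[OF assms] by simp

lemma L2_on_scaleR_integrable:
  assumes "L2_on X w" "L2_on X g"
  shows "integrable (lebesgue_on X) (\<lambda>x. w x *\<^sub>R g x)"
proof (rule L2_on_integrable_bound[OF assms])
  note [measurable] = assms[THEN L2_on_measurable]
  show "(\<lambda>x. w x *\<^sub>R g x) \<in> borel_measurable (lebesgue_on X)" by measurable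
qed simp

lemma L2_on_bounded:
  fixes f :: "'a::euclidean_space \<Rightarrow> 'b::euclidean_space"
  assumes "X \<in> lmeasurable" "f \<in> borel_measurable (lebesgue_on X)"
    and "AE x in lebesgue_on X. norm (f x) \<le> B"
  shows "L2_on X f"
  unfolding L2_on_def
proof
  interpret finite_measure "lebesgue_on X" using assms(1) by (rule finite_measure_lebesgue_on)
  note [measurable] = assms(2)
  show "integrable (lebesgue_on X) (\<lambda>x. (norm (f x))\<^sup>2)"
  proof (rule integrable_const_bound)
    show "AE x in lebesgue_on X. norm ((norm (f x))\<^sup>2) \<le> B\<^sup>2"
      using assms(3) by (rule eventually_mono) (simp add: power_mono)
  qed measurable
qed (fact assms(2))

lemma L2_on_continuous:
  fixes f :: "'a::euclidean_space \<Rightarrow> 'b::euclidean_space"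
  assumes "X \<in> lmeasurable" "continuous_on X f" "\<And>x. x \<in> X \<Longrightarrow> norm (f x) \<le> B"
  shows "L2_on X f"
proof (rule L2_on_bounded[OF assms(1)])
  show "f \<in> borel_measurable (lebesgue_on X)"
    using assms by (intro continuous_imp_measurable_on_sets_lebesgue) (auto simp: fmeasurableD)
qed (use assms(3) in \<open>auto intro!: AE_I2 simp: space_restrict_space\<close>)

lemma L2_on_lincomb:
  assumes "L2_on X f" "L2_on X g"
  shows "L2_on X (\<lambda>x. f x + c *\<^sub>R g x)"
  unfolding L2_on_def
proof
  note [measurable] = assms[THEN L2_on_measurable]
  show m: "(\<lambda>x. f x + c *\<^sub>R g x) \<in> borel_measurable (lebesgue_on X)" by measurable
  have eq: "(norm (f x + c *\<^sub>R g x))\<^sup>2 = (norm (f x))\<^sup>2 + 2 * c * (f x \<bullet> g x) + c\<^sup>2 * (norm (g x))\<^sup>2" for x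
    unfolding power2_norm_eq_inner by (simp add: inner_add_left inner_add_right inner_commute algebra_simps power2_eq_square)
  show "integrable (lebesgue_on X) (\<lambda>x. (norm (f x + c *\<^sub>R g x))\<^sup>2)"
    unfolding eq using assms L2_on_inner_integrable[OF assms] by (simp add: L2_on_def)
qed

lemma L2_on_integrable:
  fixes f :: "'a::euclidean_space \<Rightarrow> 'b::euclidean_space"
  assumes "X \<in> lmeasurable" "L2_on X f"
  shows "integrable (lebesgue_on X) f"
proof -
  have "L2_on X (\<lambda>_. 1::real)" using assms(1) by (rule L2_on_continuous[of _ _ 1]) auto
  from L2_on_scaleR_integrable[OF this assms(2)] show ?thesis by simp
qed

section \<open>Gradients and test functions\<close>

lemma GDERIV_frechet:
  assumes "f differentiable (at x)"
  shows "GDERIV f x :> (\<Sum>b\<in>Basis. frechet_derivative f (at x) b *\<^sub>R b)"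
proof -
  let ?f = "frechet_derivative f (at x)"
  have d: "(f has_derivative ?f) (at x)" using assms frechet_derivative_works by blast
  have "?f h = h \<bullet> (\<Sum>b\<in>Basis. ?f b *\<^sub>R b)" for h
  proof -
    have "?f h = ?f (\<Sum>b\<in>Basis. (h \<bullet> b) *\<^sub>R b)" by (simp add: euclidean_representation)
    also have "\<dots> = (\<Sum>b\<in>Basis. (h \<bullet> b) * ?f b)"
      using has_derivative_linear[OF d] by (simp add: linear_sum linear_cmul)
    finally show ?thesis by (simp add: inner_sum_right mult.commute)
  qed
  then have "?f = (\<lambda>h. h \<bullet> (\<Sum>b\<in>Basis. ?f b *\<^sub>R b))" by (rule ext)
  with d show ?thesis unfolding gderiv_def by metis
qed

lemma GDERIV_grad:
  assumes "f differentiable (at x)" shows "GDERIV f x :> grad f x"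
  unfolding grad_eqI[OF GDERIV_frechet[OF assms]] by (rule GDERIV_frechet[OF assms])

lemma GDERIV_lincomb:
  assumes "GDERIV f x :> D" "GDERIV g x :> E"
  shows "GDERIV (\<lambda>x. f x + c * g x) x :> D + c *\<^sub>R E"
  using assms unfolding gderiv_def by (auto intro!: derivative_eq_intros simp: inner_add_right)

lemma k_times_cont_diff_lincomb:
  "k_times_cont_diff k f \<Longrightarrow> k_times_cont_diff k g \<Longrightarrow> k_times_cont_diff k (\<lambda>x. f x + c * g x)"
proof (induction k arbitrary: f g)
  case 0
  then show ?case by (auto intro!: continuous_intros)
next
  case (Suc k)
  have fr: "frechet_derivative (\<lambda>x. f x + c * g x) (at x) b =
      frechet_derivative f (at x) b + c * frechet_derivative g (at x) b" for x b
  proof -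
    have "(f has_derivative frechet_derivative f (at x)) (at x)" "(g has_derivative frechet_derivative g (at x)) (at x)"
      using Suc.prems by (simp_all add: frechet_derivative_works[symmetric])
    then have "((\<lambda>x. f x + c * g x) has_derivative (\<lambda>h. frechet_derivative f (at x) h + c * frechet_derivative g (at x) h)) (at x)"
      by (auto intro!: derivative_eq_intros)
    from frechet_derivative_at[OF this] show ?thesis by (metis)
  qed
  show ?case using Suc by (auto simp: fr)
qed

lemma test_function_lincomb:
  assumes "test_function X f" "test_function X g"
  shows "test_function X (\<lambda>x. f x + c * g x)"
proof -
  obtain S T where "compact S" "S \<subseteq> X" "\<forall>x. x \<notin> S \<longrightarrow> f x = 0" "compact T" "T \<subseteq> X" "\<forall>x. x \<notin> T \<longrightarrow> g x = 0"
    using assms unfolding test_function_def by blast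
  then have "\<exists>S. compact S \<and> S \<subseteq> X \<and> (\<forall>x. x \<notin> S \<longrightarrow> f x + c * g x = 0)"
    by (intro exI[of _ "S \<union> T"]) (auto intro: compact_Un)
  with assms show ?thesis unfolding test_function_def using k_times_cont_diff_lincomb by blast
qed

lemma test_function_grad:
  assumes "test_function X \<phi>"
  shows "GDERIV \<phi> x :> grad \<phi> x" "continuous_on UNIV (grad \<phi>)" "continuous_on UNIV \<phi>"
proof -
  have k: "k_times_cont_diff (Suc 0) \<phi>" using assms unfolding test_function_def by blast
  then have d: "\<phi> differentiable (at x)" for x by simp
  show "GDERIV \<phi> x :> grad \<phi> x" using d by (rule GDERIV_grad)
  have "grad \<phi> = (\<lambda>x. \<Sum>b\<in>Basis. frechet_derivative \<phi> (at x) b *\<^sub>R b)"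
    using grad_eqI[OF GDERIV_frechet[OF d]] by auto
  moreover have "continuous_on UNIV (\<lambda>x. \<Sum>b\<in>Basis. frechet_derivative \<phi> (at x) b *\<^sub>R b)"
    using k by (intro continuous_intros) auto
  ultimately show "continuous_on UNIV (grad \<phi>)" by simp
  show "continuous_on UNIV \<phi>" using d differentiable_imp_continuous_within by (blast intro: continuous_at_imp_continuous_on)
qed

lemma test_function_bounded:
  assumes \<phi>: "test_function X \<phi>"
  obtains S B where "compact S" "S \<subseteq> X" "\<And>x. x \<notin> S \<Longrightarrow> \<phi> x = 0" "\<And>x. x \<notin> S \<Longrightarrow> grad \<phi> x = 0"
    "\<And>x. \<bar>\<phi> x\<bar> \<le> B" "\<And>x. norm (grad \<phi> x) \<le> B"
proof -
  obtain S where S: "compact S" "S \<subseteq> X" "\<And>x. x \<notin> S \<Longrightarrow> \<phi> x = 0"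
    using \<phi> unfolding test_function_def by blast
  have g0: "grad \<phi> x = 0" if x: "x \<notin> S" for x
  proof (rule grad_eqI)
    have "((\<lambda>_. 0) has_derivative (\<lambda>h. h \<bullet> (0::'a))) (at x)" by simp
    moreover have "open (- S)" using S(1) by (simp add: compact_imp_closed open_Compl)
    ultimately have "(\<phi> has_derivative (\<lambda>h. h \<bullet> (0::'a))) (at x)"
      by (rule has_derivative_transform_within_open) (use x S(3) in auto)
    then show "GDERIV \<phi> x :> 0" by (simp add: gderiv_def)
  qed
  have "bounded (\<phi> ` S)" "bounded (grad \<phi> ` S)"
    using test_function_grad(2,3)[OF \<phi>] S(1) continuous_on_subset
    by (blast intro: compact_imp_bounded compact_continuous_image)+
  then obtain B1 B2 where "\<And>x. x \<in> S \<Longrightarrow> \<bar>\<phi> x\<bar> \<le> B1" "\<And>x. x \<in> S \<Longrightarrow> norm (grad \<phi> x) \<le> B2"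
    by (auto simp: bounded_iff)
  then have "\<bar>\<phi> x\<bar> \<le> \<bar>B1\<bar> + \<bar>B2\<bar>" "norm (grad \<phi> x) \<le> \<bar>B1\<bar> + \<bar>B2\<bar>" for x
    using S(3)[of x] g0[of x] by (cases "x \<in> S"; force)+
  with S g0 that show thesis by blast
qed

lemma test_function_L2:
  assumes "X \<in> lmeasurable" "test_function X \<phi>"
  shows "L2_on X \<phi>" "L2_on X (grad \<phi>)"
proof -
  obtain S B where B: "\<And>x. \<bar>\<phi> x\<bar> \<le> B" "\<And>x. norm (grad \<phi> x) \<le> B"
    using test_function_bounded[OF assms(2)] by metis
  show "L2_on X \<phi>" "L2_on X (grad \<phi>)"
    using B test_function_grad(2,3)[OF assms(2)] assms(1)
    by (auto intro!: L2_on_continuous[of _ _ B] intro: continuous_on_subset)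
qed

section \<open>Linear structure of the Sobolev spaces\<close>

lemma H1_grad_lincomb:
  assumes X: "X \<in> lmeasurable" and "H1_grad X u g" "H1_grad X w k"
  shows "H1_grad X (\<lambda>x. u x + c * w x) (\<lambda>x. g x + c *\<^sub>R k x)"
proof -
  have L: "L2_on X u" "L2_on X w" "L2_on X g" "L2_on X k" using assms unfolding H1_grad_def by blast+
  have "(LINT x|lebesgue_on X. (u x + c * w x) *\<^sub>R grad \<phi> x) = - (LINT x|lebesgue_on X. \<phi> x *\<^sub>R (g x + c *\<^sub>R k x))"
    if \<phi>: "test_function X \<phi>" for \<phi>
  proof -
    note L\<phi> = test_function_L2[OF X \<phi>]
    note I = L2_on_scaleR_integrable[OF L(1) L\<phi>(2)] L2_on_scaleR_integrable[OF L(2) L\<phi>(2)]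
      L2_on_scaleR_integrable[OF L\<phi>(1) L(3)] L2_on_scaleR_integrable[OF L\<phi>(1) L(4)]
    have "(LINT x|lebesgue_on X. (u x + c * w x) *\<^sub>R grad \<phi> x) =
        (LINT x|lebesgue_on X. u x *\<^sub>R grad \<phi> x) + c *\<^sub>R (LINT x|lebesgue_on X. w x *\<^sub>R grad \<phi> x)"
      using I by (simp add: scaleR_add_left scaleR_scaleR[symmetric] del: scaleR_scaleR)
    also have "\<dots> = - (LINT x|lebesgue_on X. \<phi> x *\<^sub>R g x) - c *\<^sub>R (LINT x|lebesgue_on X. \<phi> x *\<^sub>R k x)"
      using assms(2,3) \<phi> unfolding H1_grad_def by simp
    also have "\<dots> = - (LINT x|lebesgue_on X. \<phi> x *\<^sub>R (g x + c *\<^sub>R k x))"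
    proof -
      have "(LINT x|lebesgue_on X. \<phi> x *\<^sub>R (g x + c *\<^sub>R k x)) =
          (LINT x|lebesgue_on X. \<phi> x *\<^sub>R g x + c *\<^sub>R (\<phi> x *\<^sub>R k x))"
        by (simp add: scaleR_add_right mult.commute)
      also have "\<dots> = (LINT x|lebesgue_on X. \<phi> x *\<^sub>R g x) + c *\<^sub>R (LINT x|lebesgue_on X. \<phi> x *\<^sub>R k x)"
        using I by (simp del: scaleR_scaleR)
      finally show ?thesis by simp
    qed
    finally show ?thesis .
  qed
  with L2_on_lincomb[OF L(1,2), of c] L2_on_lincomb[OF L(3,4), of c] show ?thesis
    unfolding H1_grad_def by simp
qed

text \<open>The approximating sequences are combined, and the error is controlled by |a + c b|^2
  \<le> 2 |a|^2 + 2 c^2 |b|^2. This supplies the competitors \<open>u + \<epsilon> * w\<close> for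
  the variation of the energy.\<close>

lemma H10_lincomb:
  assumes X: "X \<in> lmeasurable" and "H10 X u" "H10 X w"
  shows "H10 X (\<lambda>x. u x + c * w x)"
proof -
  obtain g \<phi> where g: "H1_grad X u g" "\<And>k::nat. test_function X (\<phi> k)"
    "(\<lambda>k. LINT x|lebesgue_on X. (\<phi> k x - u x)\<^sup>2 + (norm (grad (\<phi> k) x - g x))\<^sup>2) \<longlonglongrightarrow> 0"
    using assms(2) unfolding H10_def by blast
  obtain h \<psi> where h: "H1_grad X w h" "\<And>k::nat. test_function X (\<psi> k)"
    "(\<lambda>k. LINT x|lebesgue_on X. (\<psi> k x - w x)\<^sup>2 + (norm (grad (\<psi> k) x - h x))\<^sup>2) \<longlonglongrightarrow> 0"
    using assms(3) unfolding H10_def by blast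
  let ?\<chi> = "\<lambda>k x. \<phi> k x + c * \<psi> k x"
  let ?A = "\<lambda>k x. (\<phi> k x - u x)\<^sup>2 + (norm (grad (\<phi> k) x - g x))\<^sup>2"
  let ?B = "\<lambda>k x. (\<psi> k x - w x)\<^sup>2 + (norm (grad (\<psi> k) x - h x))\<^sup>2"
  let ?D = "\<lambda>k x. (?\<chi> k x - (u x + c * w x))\<^sup>2 + (norm (grad (?\<chi> k) x - (g x + c *\<^sub>R h x)))\<^sup>2"
  have gr: "grad (?\<chi> k) x = grad (\<phi> k) x + c *\<^sub>R grad (\<psi> k) x" for k x
    by (intro grad_eqI GDERIV_lincomb test_function_grad(1)[OF g(2)] test_function_grad(1)[OF h(2)])
  have I: "integrable (lebesgue_on X) (\<lambda>x. (f x - w x)\<^sup>2 + (norm (grad f x - h x))\<^sup>2)"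
    if "test_function X f" "H1_grad X w h" for f w h
  proof -
    have "L2_on X (\<lambda>x. f x + (-1) *\<^sub>R w x)" "L2_on X (\<lambda>x. grad f x + (-1) *\<^sub>R h x)"
      using test_function_L2[OF X that(1)] that(2) unfolding H1_grad_def by (blast intro: L2_on_lincomb)+
    then show ?thesis by (simp add: L2_on_def)
  qed
  have sq: "(norm (a + c *\<^sub>R b))\<^sup>2 \<le> 2 * (norm a)\<^sup>2 + 2 * c\<^sup>2 * (norm b)\<^sup>2" for a b :: "'z::real_inner"
  proof -
    have "0 \<le> (norm (a - c *\<^sub>R b))\<^sup>2" by simp
    also have "(norm (a - c *\<^sub>R b))\<^sup>2 = 2 * (norm a)\<^sup>2 + 2 * c\<^sup>2 * (norm b)\<^sup>2 - (norm (a + c *\<^sub>R b))\<^sup>2"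
      unfolding power2_norm_eq_inner
      by (simp add: inner_add_left inner_add_right inner_diff_left inner_diff_right inner_commute algebra_simps power2_eq_square)
    finally show ?thesis by simp
  qed
  have le: "?D k x \<le> 2 * ?A k x + 2 * c\<^sup>2 * ?B k x" for k x
    using sq[of "\<phi> k x - u x" "\<psi> k x - w x"] sq[of "grad (\<phi> k) x - g x" "grad (\<psi> k) x - h x"]
    unfolding gr by (simp add: algebra_simps)
  have bound: "(LINT x|lebesgue_on X. ?D k x) \<le> 2 * (LINT x|lebesgue_on X. ?A k x) + 2 * c\<^sup>2 * (LINT x|lebesgue_on X. ?B k x)" for k
  proof -
    have "(LINT x|lebesgue_on X. ?D k x) \<le> (LINT x|lebesgue_on X. 2 * ?A k x + 2 * c\<^sup>2 * ?B k x)"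
    proof (rule integral_mono)
      show "integrable (lebesgue_on X) (?D k)"
        by (rule I[OF test_function_lincomb[OF g(2) h(2)] H1_grad_lincomb[OF X g(1) h(1)]])
      show "integrable (lebesgue_on X) (\<lambda>x. 2 * ?A k x + 2 * c\<^sup>2 * ?B k x)"
        by (intro Bochner_Integration.integrable_add integrable_mult_right I[OF g(2,1)] I[OF h(2,1)])
    qed (rule le)
    also have "\<dots> = (LINT x|lebesgue_on X. 2 * ?A k x) + (LINT x|lebesgue_on X. 2 * c\<^sup>2 * ?B k x)"
      by (intro Bochner_Integration.integral_add integrable_mult_right I[OF g(2,1)] I[OF h(2,1)])
    finally show ?thesis by (simp only: integral_mult_right_zero)
  qed
  have "(\<lambda>k. LINT x|lebesgue_on X. ?D k x) \<longlonglongrightarrow> 0"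
  proof (rule tendsto_sandwich[OF _ _ tendsto_const])
    show "(\<lambda>k. 2 * (LINT x|lebesgue_on X. ?A k x) + 2 * c\<^sup>2 * (LINT x|lebesgue_on X. ?B k x)) \<longlonglongrightarrow> 0"
      using tendsto_add[OF tendsto_mult_left[OF g(3), of 2] tendsto_mult_left[OF h(3), of "2 * c\<^sup>2"]] by simp
  qed (use bound in \<open>auto intro!: always_eventually integral_nonneg_AE\<close>)
  then show ?thesis unfolding H10_def
    using H1_grad_lincomb[OF X g(1) h(1)] test_function_lincomb[OF g(2) h(2)]
    by (intro exI[of _ "\<lambda>x. g x + c *\<^sub>R h x"] conjI exI[of _ ?\<chi>]) auto
qed

text \<open>By translation invariance every difference quotient of \<open>\<psi>\<close> along a
  basis vector has integral 0. The quotients converge to the directional derivative and are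
  dominated by the Lipschitz constant \<open>B\<close> on a fixed ball.\<close>

lemma integral_gradient_zero:
  fixes \<psi> :: "'a::euclidean_space \<Rightarrow> real"
  assumes der: "\<And>x. GDERIV \<psi> x :> \<Psi> x" and cont: "continuous_on UNIV \<Psi>"
    and S: "compact S" "\<And>x. x \<notin> S \<Longrightarrow> \<psi> x = 0" "\<And>x. x \<notin> S \<Longrightarrow> \<Psi> x = 0"
  shows "integrable lborel \<Psi>" "(LINT x|lborel. \<Psi> x) = 0"
proof -
  have c\<psi>: "continuous_on UNIV \<psi>"
    using der has_derivative_continuous unfolding gderiv_def by (blast intro: continuous_at_imp_continuous_on)
  have m [measurable]: "\<psi> \<in> borel_measurable borel" "\<Psi> \<in> borel_measurable borel"
    using c\<psi> cont borel_measurable_continuous_onI by blast+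
  have "bounded (\<Psi> ` S)" using cont S(1) continuous_on_subset by (blast intro: compact_imp_bounded compact_continuous_image)
  then obtain B0 where B0: "\<And>x. x \<in> S \<Longrightarrow> norm (\<Psi> x) \<le> B0" by (auto simp: bounded_iff)
  define B where "B = \<bar>B0\<bar>"
  have B: "norm (\<Psi> x) \<le> B" for x using B0[of x] S(3)[of x] by (cases "x \<in> S") (auto simp: B_def)
  obtain R where R: "R > 0" "S \<subseteq> ball 0 R" using S(1) bounded_subset_ballD compact_imp_bounded by blast
  have out: "x \<notin> S" if "norm x \<ge> R" for x using R(2) that by auto
  have Ib: "integrable lborel (\<lambda>x::'a. B * indicator (cball 0 (R + 1)) x)"
    by (intro integrable_mult_right integrable_real_indicator) (use emeasure_bounded_finite[OF bounded_cball] in auto)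
  show int: "integrable lborel \<Psi>"
  proof (rule Bochner_Integration.integrable_bound[OF Ib])
    have "norm (\<Psi> x) \<le> norm (B * indicator (cball 0 (R + 1)) x)" for x
      using B[of x] S(3)[OF out, of x] by (cases "norm x \<le> R + 1") (auto simp: indicator_def)
    then show "AE x in lborel. norm (\<Psi> x) \<le> norm (B * indicator (cball 0 (R + 1)) x)" by simp
  qed simp
  have I\<psi>: "integrable lborel \<psi>"
  proof -
    have "integrable lborel (\<lambda>x. indicator S x *\<^sub>R \<psi> x)"
      using S(1) c\<psi> continuous_on_subset by (intro borel_integrable_compact) auto
    moreover have "(\<lambda>x. indicator S x *\<^sub>R \<psi> x) = \<psi>" using S(2) by (auto split: split_indicator)
    ultimately show ?thesis by simp
  qed
  have lip: "\<bar>\<psi> x - \<psi> y\<bar> \<le> B * norm (x - y)" for x y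
  proof -
    have "norm (\<psi> x - \<psi> y) \<le> B * norm (x - y)"
    proof (rule differentiable_bound[of UNIV \<psi> "\<lambda>x h. h \<bullet> \<Psi> x"])
      show "(\<psi> has_derivative (\<lambda>h. h \<bullet> \<Psi> z)) (at z within UNIV)" for z using der[of z] by (simp add: gderiv_def)
      show "onorm (\<lambda>h. h \<bullet> \<Psi> z) \<le> B" for z
      proof (rule onorm_bound)
        show "norm (h \<bullet> \<Psi> z) \<le> B * norm h" for h
          using Cauchy_Schwarz_ineq2[of h "\<Psi> z"] mult_left_mono[OF B[of z] norm_ge_zero[of h]] by (simp add: mult.commute)
      qed (simp add: B_def)
    qed auto
    then show ?thesis by simp
  qed
  have zero: "(LINT x|lborel. \<Psi> x \<bullet> e) = 0" if e: "e \<in> Basis" for e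
  proof -
    let ?h = "\<lambda>n::nat. inverse (real (Suc n))"
    let ?q = "\<lambda>n x. (\<psi> (x + ?h n *\<^sub>R e) - \<psi> x) / ?h n"
    have shift: "(LINT x|lborel. \<psi> (x + d)) = (LINT x|lborel. \<psi> x)" "integrable lborel (\<lambda>x. \<psi> (x + d))" for d
    proof -
      have "(LINT x|lborel. \<psi> x) = (LINT x|distr lborel borel ((+) d). \<psi> x)" by (simp add: lborel_distr_plus)
      also have "\<dots> = (LINT x|lborel. \<psi> (d + x))" by (rule integral_distr) auto
      finally show "(LINT x|lborel. \<psi> (x + d)) = (LINT x|lborel. \<psi> x)" by (simp add: add.commute)
      have "integrable (distr lborel borel ((+) d)) \<psi>" using I\<psi> by (simp add: lborel_distr_plus)
      then show "integrable lborel (\<lambda>x. \<psi> (x + d))" by (subst (asm) integrable_distr_eq) (auto simp: add.commute)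
    qed
    have q0: "(LINT x|lborel. ?q n x) = 0" for n
      using shift[of "?h n *\<^sub>R e"] I\<psi> by simp
    have "(\<lambda>n. LINT x|lborel. ?q n x) \<longlonglongrightarrow> (LINT x|lborel. \<Psi> x \<bullet> e)"
    proof (rule integral_dominated_convergence[where w = "\<lambda>x. B * indicator (cball 0 (R + 1)) x"])
      show "AE x in lborel. (\<lambda>n. ?q n x) \<longlonglongrightarrow> \<Psi> x \<bullet> e"
      proof (rule AE_I2)
        fix x
        have "((\<lambda>s. \<psi> (x + s *\<^sub>R e)) has_derivative (\<lambda>s. (s *\<^sub>R e) \<bullet> \<Psi> x)) (at 0)"
        proof -
          have "((\<lambda>s. x + s *\<^sub>R e) has_derivative (\<lambda>s. s *\<^sub>R e)) (at 0)" by (auto intro!: derivative_eq_intros)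
          moreover have "(\<psi> has_derivative (\<lambda>h. h \<bullet> \<Psi> x)) (at (x + 0 *\<^sub>R e))" using der[of x] by (simp add: gderiv_def)
          ultimately show ?thesis by (rule has_derivative_compose)
        qed
        moreover have "(\<lambda>s. (s *\<^sub>R e) \<bullet> \<Psi> x) = (*) (\<Psi> x \<bullet> e)" by (auto simp: inner_commute mult.commute)
        ultimately have "((\<lambda>s. \<psi> (x + s *\<^sub>R e)) has_field_derivative (\<Psi> x \<bullet> e)) (at 0)"
          by (simp add: has_field_derivative_def)
        then have "(\<lambda>s. (\<psi> (x + s *\<^sub>R e) - \<psi> x) / s) \<midarrow>0\<rightarrow> \<Psi> x \<bullet> e" by (simp add: DERIV_def)
        moreover have "filterlim ?h (at 0) sequentially"
          using LIMSEQ_inverse_real_of_nat by (simp add: filterlim_at eventually_sequentially)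
        ultimately show "(\<lambda>n. ?q n x) \<longlonglongrightarrow> \<Psi> x \<bullet> e" by (rule filterlim_compose)
      qed
      show "AE x in lborel. norm (?q n x) \<le> B * indicator (cball 0 (R + 1)) x" for n
      proof (rule AE_I2)
        fix x
        \<comment> \<open>Steps of length at most 1 keep the support of all quotients in the ball of
          radius \<open>R + 1\<close>, so one majorant serves for all \<open>n\<close>.\<close>
        have h: "0 < ?h n" "?h n \<le> 1" by (auto simp: inverse_le_1_iff)
        show "norm (?q n x) \<le> B * indicator (cball 0 (R + 1)) x"
        proof (cases "norm x \<le> R + 1")
          case True
          have "\<bar>\<psi> (x + ?h n *\<^sub>R e) - \<psi> x\<bar> \<le> B * ?h n" using lip[of "x + ?h n *\<^sub>R e" x] e h by simp
          then have "\<bar>\<psi> (x + ?h n *\<^sub>R e) - \<psi> x\<bar> / ?h n \<le> B" using h(1) by (subst pos_divide_le_eq) auto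
          then show ?thesis using True h(1) by (simp add: abs_divide)
        next
          case False
          have "norm x \<le> norm (x + ?h n *\<^sub>R e) + norm (?h n *\<^sub>R e)" using norm_triangle_ineq4[of "x + ?h n *\<^sub>R e" "?h n *\<^sub>R e"] by simp
          then have "norm (x + ?h n *\<^sub>R e) \<ge> R" using False e h by simp
          then have "\<psi> (x + ?h n *\<^sub>R e) = 0" "\<psi> x = 0" using S(2)[OF out] False by auto
          then show ?thesis by (simp add: B_def)
        qed
      qed
    qed (use Ib in auto)
    then show ?thesis unfolding q0 using LIMSEQ_unique tendsto_const by blast
  qed
  show "(LINT x|lborel. \<Psi> x) = 0"
  proof (rule euclidean_eqI)
    fix e :: 'a assume e: "e \<in> Basis"
    have "(LINT x|lborel. \<Psi> x) \<bullet> e = (LINT x|lborel. \<Psi> x \<bullet> e)" using int by (rule integral_inner_left[symmetric])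
    then show "(LINT x|lborel. \<Psi> x) \<bullet> e = 0 \<bullet> e" using zero[OF e] by simp
  qed
qed

section \<open>Classical gradients as weak gradients\<close>

lemma C1_closure_facts:
  fixes u :: "'a::euclidean_space \<Rightarrow> real"
  assumes X: "open X" "bounded X" and u: "C1_closure X u"
  obtains B where "\<And>x. x \<in> X \<Longrightarrow> GDERIV u x :> grad u x" "continuous_on X (grad u)"
    "continuous_on (closure X) u" "\<And>x. x \<in> X \<Longrightarrow> \<bar>u x\<bar> \<le> B" "\<And>x. x \<in> X \<Longrightarrow> norm (grad u x) \<le> B"
proof -
  obtain G where G: "continuous_on (closure X) G" "\<And>x. x \<in> X \<Longrightarrow> GDERIV u x :> G x" and cu: "continuous_on (closure X) u"
    using u unfolding C1_closure_def by blast
  have eq: "grad u x = G x" if "x \<in> X" for x using G(2)[OF that] by (rule grad_eqI)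
  have "compact (closure X)" using X(2) by simp
  then have "bounded (u ` closure X)" "bounded (G ` closure X)"
    using G(1) cu by (blast intro: compact_imp_bounded compact_continuous_image)+
  then obtain B1 B2 where "\<And>x. x \<in> closure X \<Longrightarrow> \<bar>u x\<bar> \<le> B1" "\<And>x. x \<in> closure X \<Longrightarrow> norm (G x) \<le> B2"
    by (auto simp: bounded_iff)
  then have "\<bar>u x\<bar> \<le> max B1 B2" "norm (grad u x) \<le> max B1 B2" if "x \<in> X" for x
    using eq[OF that] that closure_subset[of X] by (metis le_max_iff_disj subsetD)+
  moreover have "continuous_on X (grad u)"
    using continuous_on_subset[OF G(1) closure_subset] by (rule continuous_on_eq) (simp add: eq)
  ultimately show thesis using that G(2) eq cu by metis
qed

text \<open>The product of \<open>u\<close> with a test function, extended by zero, is continuously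
  differentiable on the whole space, and the integral of its gradient vanishes; the product rule
  turns this into integration by parts.\<close>

lemma C1_closure_weak_gradient:
  fixes u :: "'a::euclidean_space \<Rightarrow> real"
  assumes X: "open X" "bounded X" and u: "C1_closure X u"
  shows "H1_grad X u (grad u)"
proof -
  have lm: "X \<in> lmeasurable" using X by (simp add: lmeasurable_open)
  obtain B where d: "\<And>x. x \<in> X \<Longrightarrow> GDERIV u x :> grad u x" and cg: "continuous_on X (grad u)"
    and cu: "continuous_on (closure X) u" and b: "\<And>x. x \<in> X \<Longrightarrow> \<bar>u x\<bar> \<le> B" "\<And>x. x \<in> X \<Longrightarrow> norm (grad u x) \<le> B"
    using C1_closure_facts[OF assms] by blast
  have cu': "continuous_on X u" using cu closure_subset continuous_on_subset by blast
  have L: "L2_on X u" "L2_on X (grad u)"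
    using b cu' cg lm by (auto intro!: L2_on_continuous[of _ _ B])
  have "(LINT x|lebesgue_on X. u x *\<^sub>R grad \<phi> x) = - (LINT x|lebesgue_on X. \<phi> x *\<^sub>R grad u x)"
    if \<phi>: "test_function X \<phi>" for \<phi>
  proof -
    obtain S C where S: "compact S" "S \<subseteq> X" "\<And>x. x \<notin> S \<Longrightarrow> \<phi> x = 0" "\<And>x. x \<notin> S \<Longrightarrow> grad \<phi> x = 0"
      using test_function_bounded[OF \<phi>] by metis
    note t = test_function_grad[OF \<phi>]
    define \<psi> where "\<psi> x = indicator X x * (u x * \<phi> x)" for x
    define \<Psi> where "\<Psi> x = indicator X x *\<^sub>R (u x *\<^sub>R grad \<phi> x + \<phi> x *\<^sub>R grad u x)" for x
    have opS: "open (- S)" using S(1) by (simp add: compact_imp_closed open_Compl)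
    have der: "GDERIV \<psi> x :> \<Psi> x" for x
    proof (cases "x \<in> X")
      case True
      have "((\<lambda>x. u x * \<phi> x) has_derivative (\<lambda>h. u x * (h \<bullet> grad \<phi> x) + (h \<bullet> grad u x) * \<phi> x)) (at x)"
        using d[OF True] t(1)[of x] unfolding gderiv_def by (intro has_derivative_mult)
      then have "(\<psi> has_derivative (\<lambda>h. u x * (h \<bullet> grad \<phi> x) + (h \<bullet> grad u x) * \<phi> x)) (at x)"
        using X(1) True by (rule has_derivative_transform_within_open) (simp add: \<psi>_def)
      then show ?thesis unfolding gderiv_def \<Psi>_def using True by (simp add: inner_add_right algebra_simps)
    next
      case False
      have "((\<lambda>_. 0) has_derivative (\<lambda>h. h \<bullet> (0::'a))) (at x)" by simp
      then have "(\<psi> has_derivative (\<lambda>h. h \<bullet> (0::'a))) (at x)"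
        using opS by (rule has_derivative_transform_within_open) (use False S in \<open>auto simp: \<psi>_def\<close>)
      then show ?thesis using False by (simp add: gderiv_def \<Psi>_def)
    qed
    \<comment> \<open>Two open sets cover the space: \<open>X\<close>, where the product rule
      describes \<open>\<Psi>\<close>, and the complement of the support, where
      \<open>\<Psi>\<close> is 0.\<close>
    have "continuous_on (X \<union> - S) \<Psi>"
    proof (rule continuous_on_open_Un[OF X(1) opS])
      have "continuous_on X (\<lambda>x. u x *\<^sub>R grad \<phi> x + \<phi> x *\<^sub>R grad u x)"
        using continuous_on_subset[OF t(2)] continuous_on_subset[OF t(3)] by (intro continuous_intros cu' cg) auto
      then show "continuous_on X \<Psi>" by (rule continuous_on_eq) (simp add: \<Psi>_def)
      show "continuous_on (- S) \<Psi>" using continuous_on_const[of "- S" "0::'a"]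
        by (rule continuous_on_eq) (simp add: \<Psi>_def S)
    qed
    moreover have "X \<union> - S = UNIV" using S(2) by blast
    ultimately have cont: "continuous_on UNIV \<Psi>" by simp
    have "(LINT x|lborel. \<Psi> x) = 0"
      by (rule integral_gradient_zero(2)[OF der cont S(1)]) (auto simp: \<psi>_def \<Psi>_def S)
    moreover have "\<Psi> \<in> borel_measurable borel" using cont by (rule borel_measurable_continuous_onI)
    then have "(LINT x|lebesgue. \<Psi> x) = (LINT x|lborel. \<Psi> x)" by (intro integral_completion) simp
    moreover have "(LINT x|lebesgue. \<Psi> x) = (LINT x|lebesgue_on X. u x *\<^sub>R grad \<phi> x + \<phi> x *\<^sub>R grad u x)"
      unfolding \<Psi>_def using X(1) by (subst integral_restrict_space) auto
    moreover have "\<dots> = (LINT x|lebesgue_on X. u x *\<^sub>R grad \<phi> x) + (LINT x|lebesgue_on X. \<phi> x *\<^sub>R grad u x)"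
      using L2_on_scaleR_integrable[OF L(1) test_function_L2(2)[OF lm \<phi>]] L2_on_scaleR_integrable[OF test_function_L2(1)[OF lm \<phi>] L(2)]
      by (rule Bochner_Integration.integral_add)
    ultimately show ?thesis by (simp add: eq_neg_iff_add_eq_0)
  qed
  with L show ?thesis unfolding H1_grad_def by blast
qed

section \<open>Flux fields\<close>

text \<open>Expand (|p| - |p + r|)^2 \<ge> 0. The result is a one-sided Taylor expansion of the norm
  with an explicit remainder; as it holds for all \<open>r\<close>, it can be integrated as it
  stands, with no differentiation under the integral sign.\<close>

lemma norm_add_le_second_order:
  fixes p r :: "'a::real_inner"
  assumes "p \<noteq> 0"
  shows "norm (p + r) \<le> norm p + (r \<bullet> p) / norm p + (norm r)\<^sup>2 / (2 * norm p)"
proof -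
  have "0 \<le> (norm p - norm (p + r))\<^sup>2" by simp
  then have "2 * norm p * norm (p + r) \<le> (norm p)\<^sup>2 + (norm (p + r))\<^sup>2"
    by (simp add: power2_diff)
  also have "(norm (p + r))\<^sup>2 = (norm p)\<^sup>2 + 2 * (r \<bullet> p) + (norm r)\<^sup>2"
    unfolding power2_norm_eq_inner by (simp add: inner_add_left inner_add_right inner_commute)
  finally have "norm (p + r) \<le> ((norm p)\<^sup>2 + (norm p)\<^sup>2 + 2 * (r \<bullet> p) + (norm r)\<^sup>2) / (2 * norm p)"
    using assms by (simp add: field_simps)
  also have "\<dots> = norm p + (r \<bullet> p) / norm p + (norm r)\<^sup>2 / (2 * norm p)"
    using assms by (simp add: field_simps power2_eq_square)
  finally show ?thesis .
qed

text \<open>At \<epsilon> = -L / (2k), with k > 0 and k \<ge> C, the linear term is -L^2 / (2k) and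
  the quadratic one at most L^2 / (4k), so a nonzero L would make the sum negative.\<close>

lemma linear_coefficient_zero:
  fixes L C :: real
  assumes "\<And>\<epsilon>. 0 \<le> \<epsilon> * L + \<epsilon>\<^sup>2 * C"
  shows "L = 0"
proof (rule ccontr)
  assume L: "L \<noteq> 0"
  define k where "k = \<bar>C\<bar> + 1"
  have k: "k > 0" "C \<le> k" by (auto simp: k_def)
  have "(- L / (2 * k))\<^sup>2 * C \<le> (- L / (2 * k))\<^sup>2 * k" using k by (intro mult_left_mono) auto
  also have "\<dots> = L\<^sup>2 / (4 * k)" using k by (simp add: field_simps power2_eq_square)
  finally have "0 \<le> (- L / (2 * k)) * L + L\<^sup>2 / (4 * k)" using assms[of "- L / (2 * k)"] by linarith
  also have "\<dots> = - (L\<^sup>2 / (4 * k))" using k by (simp add: field_simps power2_eq_square)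
  finally show False using L k by (simp add: divide_le_0_iff)
qed

text \<open>The Euler--Lagrange equation. It is available because \<open>grad u + F\<close> is bounded away from \<open>0\<close>.\<close>

lemma minimizer_dual_feasible:
  fixes X :: "'a::euclidean_space set"
  assumes X: "open X" "bounded X"
    and a: "a \<in> borel_measurable (lebesgue_on X)" "AE x in lebesgue_on X. 0 \<le> a x \<and> a x \<le> M"
    and H: "L2_on X H" and u: "C1_closure X u" "minimizer X a F H u"
    and F: "continuous_on X F" "\<And>x. x \<in> X \<Longrightarrow> norm (F x) \<le> B"
    and \<delta>: "0 < \<delta>" "\<And>x. x \<in> X \<Longrightarrow> \<delta> \<le> norm (grad u x + F x)"
  shows "dual_feasible X a H (\<lambda>x. (a x / norm (grad u x + F x)) *\<^sub>R (grad u x + F x))"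
proof -
  have lm: "X \<in> lmeasurable" using X by (simp add: lmeasurable_open)
  define p where "p x = grad u x + F x" for x
  define J where "J x = (a x / norm (p x)) *\<^sub>R p x" for x
  obtain B' where cg: "continuous_on X (grad u)" and bg: "\<And>x. x \<in> X \<Longrightarrow> norm (grad u x) \<le> B'"
    using C1_closure_facts[OF X u(1)] by metis
  have gu: "H1_grad X u (grad u)" by (rule C1_closure_weak_gradient[OF X u(1)])
  have Lu: "L2_on X u" using gu by (simp add: H1_grad_def)
  have La: "L2_on X a" using a by (intro L2_on_bounded[of _ _ M] lm) (auto elim: eventually_mono)
  have Lp: "L2_on X p" unfolding p_def
    by (rule L2_on_continuous[where B = "B' + B", OF lm])
      (use cg F bg in \<open>auto intro!: continuous_intros order_trans[OF norm_triangle_ineq] add_mono\<close>)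
  note [measurable] = a(1) Lp[THEN L2_on_measurable]
  have LJ: "L2_on X J"
  proof (rule L2_on_bounded[OF lm])
    show "J \<in> borel_measurable (lebesgue_on X)" unfolding J_def by measurable
    show "AE x in lebesgue_on X. norm (J x) \<le> M" using a(2) by (rule eventually_mono) (auto simp: J_def)
  qed
  have EL: "(LINT x|lebesgue_on X. q x \<bullet> J x + H x * w x) = 0" if w: "H10 X w" "H1_grad X w q" for w q
  proof (rule linear_coefficient_zero)
    fix \<epsilon> :: real
    have Lw: "L2_on X w" "L2_on X q" using w(2) by (auto simp: H1_grad_def)
    let ?M = "\<bar>M\<bar>"
    have I0: "integrable (lebesgue_on X) (\<lambda>x. a x * norm (k x))" if k: "L2_on X k" for k :: "'a \<Rightarrow> 'a"
    proof (rule L2_on_integrable_bound[OF La k])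
      note [measurable] = k[THEN L2_on_measurable]
      show "(\<lambda>x. a x * norm (k x)) \<in> borel_measurable (lebesgue_on X)" by measurable
    qed (simp add: abs_mult)
    have I1: "integrable (lebesgue_on X) (\<lambda>x. a x * norm (p x) + H x * u x)"
      using I0[OF Lp] L2_on_mult_integrable[OF H Lu] by simp
    have I2: "integrable (lebesgue_on X) (\<lambda>x. q x \<bullet> J x + H x * w x)"
      using L2_on_inner_integrable[OF Lw(2) LJ] L2_on_mult_integrable[OF H Lw(1)] by simp
    have I3: "integrable (lebesgue_on X) (\<lambda>x. (norm (q x))\<^sup>2)" using Lw(2) by (simp add: L2_on_def)
    have Lp\<epsilon>: "L2_on X (\<lambda>x. p x + \<epsilon> *\<^sub>R q x)" "L2_on X (\<lambda>x. u x + \<epsilon> * w x)"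
      using L2_on_lincomb[OF Lp Lw(2)] L2_on_lincomb[OF Lu Lw(1), of \<epsilon>] by simp_all
    have "energy X a F H u (grad u) \<le> energy X a F H (\<lambda>x. u x + \<epsilon> * w x) (\<lambda>x. grad u x + \<epsilon> *\<^sub>R q x)"
    proof -
      have "H10 X u" using u(2) by (simp add: minimizer_def)
      then show ?thesis using u(2) gu H10_lincomb[OF lm _ w(1)] H1_grad_lincomb[OF lm gu w(2)]
        unfolding minimizer_def by blast
    qed
    then have "(LINT x|lebesgue_on X. a x * norm (p x) + H x * u x) \<le>
        (LINT x|lebesgue_on X. a x * norm (p x + \<epsilon> *\<^sub>R q x) + H x * (u x + \<epsilon> * w x))"
      unfolding energy_def p_def by (simp add: algebra_simps)
    \<comment> \<open>The energy of the competitor is majorized by a quadratic polynomial in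
      \<open>\<epsilon>\<close> whose linear coefficient is the Euler--Lagrange expression. The
      polynomial equals the energy of \<open>u\<close> at 0, so minimality forces that coefficient
      to vanish.\<close>
    also have "\<dots> \<le> (LINT x|lebesgue_on X. (a x * norm (p x) + H x * u x) + \<epsilon> * (q x \<bullet> J x + H x * w x) +
        \<epsilon>\<^sup>2 * (?M / (2 * \<delta>) * (norm (q x))\<^sup>2))"
    proof (rule integral_mono_AE)
      show "integrable (lebesgue_on X) (\<lambda>x. a x * norm (p x + \<epsilon> *\<^sub>R q x) + H x * (u x + \<epsilon> * w x))"
        using I0[OF Lp\<epsilon>(1)] L2_on_mult_integrable[OF H Lp\<epsilon>(2)] by (rule Bochner_Integration.integrable_add)
      show "integrable (lebesgue_on X) (\<lambda>x. (a x * norm (p x) + H x * u x) + \<epsilon> * (q x \<bullet> J x + H x * w x) +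
        \<epsilon>\<^sup>2 * (?M / (2 * \<delta>) * (norm (q x))\<^sup>2))"
        by (intro Bochner_Integration.integrable_add[OF Bochner_Integration.integrable_add[OF I1]] integrable_mult_right I2 I3)
      have "AE x in lebesgue_on X. x \<in> X" by (rule AE_I2) (simp add: space_restrict_space)
      with a(2) show "AE x in lebesgue_on X. a x * norm (p x + \<epsilon> *\<^sub>R q x) + H x * (u x + \<epsilon> * w x) \<le>
        (a x * norm (p x) + H x * u x) + \<epsilon> * (q x \<bullet> J x + H x * w x) + \<epsilon>\<^sup>2 * (?M / (2 * \<delta>) * (norm (q x))\<^sup>2)"
      proof eventually_elim
        case (elim x)
        have px: "\<delta> \<le> norm (p x)" using \<delta>(2) elim(2) by (simp add: p_def)
        then have p0: "p x \<noteq> 0" using \<delta>(1) by auto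
        have "a x * norm (p x + \<epsilon> *\<^sub>R q x) \<le>
          a x * (norm (p x) + ((\<epsilon> *\<^sub>R q x) \<bullet> p x) / norm (p x) + (norm (\<epsilon> *\<^sub>R q x))\<^sup>2 / (2 * norm (p x)))"
          using elim(1) by (intro mult_left_mono norm_add_le_second_order p0) auto
        also have "\<dots> = a x * norm (p x) + \<epsilon> * (q x \<bullet> J x) + \<epsilon>\<^sup>2 * ((a x / (2 * norm (p x))) * (norm (q x))\<^sup>2)"
          by (simp add: J_def algebra_simps power_mult_distrib)
        also have "\<dots> \<le> a x * norm (p x) + \<epsilon> * (q x \<bullet> J x) + \<epsilon>\<^sup>2 * (?M / (2 * \<delta>) * (norm (q x))\<^sup>2)"
          using elim(1) px \<delta>(1) by (intro add_left_mono mult_left_mono mult_right_mono frac_le) auto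
        finally show ?case by (simp add: algebra_simps)
      qed
    qed
    also have "\<dots> = (LINT x|lebesgue_on X. a x * norm (p x) + H x * u x) +
        \<epsilon> * (LINT x|lebesgue_on X. q x \<bullet> J x + H x * w x) + \<epsilon>\<^sup>2 * (?M / (2 * \<delta>) * (LINT x|lebesgue_on X. (norm (q x))\<^sup>2))"
    proof -
      note J1 = integrable_mult_right[OF I2, of \<epsilon>]
      note J2 = integrable_mult_right[OF integrable_mult_right[OF I3, of "?M / (2 * \<delta>)"], of "\<epsilon>\<^sup>2"]
      show ?thesis
        unfolding Bochner_Integration.integral_add[OF Bochner_Integration.integrable_add[OF I1 J1] J2]
          Bochner_Integration.integral_add[OF I1 J1] integral_mult_right_zero ..
    qed
    finally show "0 \<le> \<epsilon> * (LINT x|lebesgue_on X. q x \<bullet> J x + H x * w x) +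
       \<epsilon>\<^sup>2 * (?M / (2 * \<delta>) * (LINT x|lebesgue_on X. (norm (q x))\<^sup>2))" by linarith
  qed
  have "dual_feasible X a H J"
    unfolding dual_feasible_def
  proof (intro conjI LJ allI impI)
    show "AE x in lebesgue_on X. norm (J x) \<le> a x" using a(2) by (rule eventually_mono) (auto simp: J_def)
  qed (use EL in blast)
  then show ?thesis by (simp add: J_def[abs_def] p_def)
qed

text \<open>No strong duality is used: the competitor $a(\nabla u+F)/|\nabla u+F|$ forces $\int(a-|J|)|\nabla u+F| \le 0$.\<close>

lemma dual_solution_norm_eq:
  fixes X :: "'a::euclidean_space set"
  assumes X: "open X" "bounded X"
    and a: "a \<in> borel_measurable (lebesgue_on X)" "AE x in lebesgue_on X. 0 \<le> a x \<and> a x \<le> M"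
    and H: "L2_on X H" and u: "C1_closure X u" "minimizer X a F H u"
    and F: "continuous_on X F" "\<And>x. x \<in> X \<Longrightarrow> norm (F x) \<le> B"
    and \<delta>: "0 < \<delta>" "\<And>x. x \<in> X \<Longrightarrow> \<delta> \<le> norm (grad u x + F x)"
    and J: "dual_solution X a F H J" "\<And>x. x \<in> X \<Longrightarrow> J x = \<sigma> x *\<^sub>R (grad u x + F x)" "\<And>x. x \<in> X \<Longrightarrow> 0 \<le> \<sigma> x"
  shows "AE x in lebesgue_on X. norm (J x) = a x"
proof -
  have lm: "X \<in> lmeasurable" using X by (simp add: lmeasurable_open)
  define p where "p x = grad u x + F x" for x
  define J' where "J' x = (a x / norm (p x)) *\<^sub>R p x" for x
  have fJ: "dual_feasible X a H J" using J(1) by (simp add: dual_solution_def)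
  have fJ': "dual_feasible X a H J'"
    using minimizer_dual_feasible[OF X a H u F \<delta>] by (simp add: J'_def[abs_def] p_def)
  have LJ: "L2_on X J" "L2_on X J'" using fJ fJ' by (auto simp: dual_feasible_def)
  have gu: "H1_grad X u (grad u)" by (rule C1_closure_weak_gradient[OF X u(1)])
  have Lu: "L2_on X u" "L2_on X (grad u)" using gu by (auto simp: H1_grad_def)
  have LF: "L2_on X F" using F lm by (intro L2_on_continuous) auto
  have u0: "H10 X u" using u(2) by (simp add: minimizer_def)
  \<comment> \<open>On feasible fields the integral of \<open>p \<bullet> b\<close> differs from the
    dual objective by a term independent of \<open>b\<close>; so the maximality of \<open>J\<close>
    carries over to it.\<close>
  have split: "(LINT x|lebesgue_on X. p x \<bullet> b x) = (LINT x|lebesgue_on X. F x \<bullet> b x) - (LINT x|lebesgue_on X. H x * u x)"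
    if b: "dual_feasible X a H b" for b
  proof -
    have Lb: "L2_on X b" using b by (simp add: dual_feasible_def)
    have "(LINT x|lebesgue_on X. grad u x \<bullet> b x + H x * u x) = 0" using b u0 gu unfolding dual_feasible_def by blast
    then have "(LINT x|lebesgue_on X. grad u x \<bullet> b x) + (LINT x|lebesgue_on X. H x * u x) = 0"
      using L2_on_inner_integrable[OF Lu(2) Lb] L2_on_mult_integrable[OF H Lu(1)] by simp
    moreover have "(LINT x|lebesgue_on X. p x \<bullet> b x) = (LINT x|lebesgue_on X. grad u x \<bullet> b x) + (LINT x|lebesgue_on X. F x \<bullet> b x)"
      using L2_on_inner_integrable[OF Lu(2) Lb] L2_on_inner_integrable[OF LF Lb] by (simp add: p_def inner_add_left)
    ultimately show ?thesis by simp
  qed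
  have Lp: "L2_on X p" using L2_on_lincomb[OF Lu(2) LF, of 1] by (simp add: p_def[abs_def])
  note I = L2_on_inner_integrable[OF Lp LJ(1)] L2_on_inner_integrable[OF Lp LJ(2)]
  have le: "(LINT x|lebesgue_on X. p x \<bullet> J' x - p x \<bullet> J x) \<le> 0"
    using split[OF fJ] split[OF fJ'] J(1) fJ' I by (simp add: dual_solution_def)
  have inX: "AE x in lebesgue_on X. x \<in> X" by (rule AE_I2) (simp add: space_restrict_space)
  have leJ: "AE x in lebesgue_on X. norm (J x) \<le> a x" using fJ by (simp add: dual_feasible_def)
  \<comment> \<open>Both fields point along \<open>p\<close>, so the integrand is (a - |J|) |p|,
    which feasibility of \<open>J\<close> makes nonnegative. Its integral is at most 0, hence it
    vanishes almost everywhere, and |p| > 0 can be cancelled.\<close>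
  have eq: "AE x in lebesgue_on X. p x \<bullet> J' x - p x \<bullet> J x = (a x - norm (J x)) * norm (p x) \<and> 0 < norm (p x)"
    using inX
  proof eventually_elim
    case (elim x)
    have p0: "0 < norm (p x)" using \<delta>(1) \<delta>(2)[OF elim] unfolding p_def by linarith
    have "p x \<bullet> J' x = a x * norm (p x)"
      using p0 by (simp add: J'_def power2_norm_eq_inner[symmetric] power2_eq_square)
    moreover have "p x \<bullet> J x = norm (J x) * norm (p x)"
      using J(2)[OF elim] J(3)[OF elim] by (simp add: p_def power2_norm_eq_inner[symmetric] power2_eq_square)
    ultimately show ?case using p0 by (simp add: algebra_simps)
  qed
  have nn: "AE x in lebesgue_on X. 0 \<le> p x \<bullet> J' x - p x \<bullet> J x"
    using eq leJ by eventually_elim simp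
  have int: "integrable (lebesgue_on X) (\<lambda>x. p x \<bullet> J' x - p x \<bullet> J x)" using I by simp
  have "(LINT x|lebesgue_on X. p x \<bullet> J' x - p x \<bullet> J x) = 0"
    using le integral_nonneg_AE[OF nn] by linarith
  then have "AE x in lebesgue_on X. p x \<bullet> J' x - p x \<bullet> J x = 0"
    using integral_nonneg_eq_0_iff_AE[OF int nn] by blast
  with eq show ?thesis by eventually_elim auto
qed

text \<open>What the comparison of two solutions keeps of admissibility: the two extremal properties
  are traded for feasibility of \<open>J\<close> and |J| = a. Fluxes with the same \<open>a\<close>
  then have equal length almost everywhere.\<close>

definition is_flux ::
  "'a::euclidean_space set \<Rightarrow> real \<Rightarrow> real \<Rightarrow> real \<Rightarrow> real \<Rightarrow> ('a \<Rightarrow> real) \<Rightarrow> ('a \<Rightarrow> real) \<Rightarrow> ('a \<Rightarrow> 'a) \<Rightarrow>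
   ('a \<Rightarrow> real) \<Rightarrow> ('a \<Rightarrow> real) \<Rightarrow> ('a \<Rightarrow> 'a) \<Rightarrow> bool" where
  "is_flux X \<sigma>\<^sub>0 \<sigma>\<^sub>1 m M a H F u \<sigma> J \<longleftrightarrow>
     C1_closure X u \<and> H10 X u \<and> continuous_on X F \<and> (\<exists>B. \<forall>x\<in>X. norm (F x) \<le> B) \<and> continuous_on X J \<and>
     dual_feasible X a H J \<and> (AE x in lebesgue_on X. norm (J x) = a x) \<and>
     (\<forall>x\<in>X. \<sigma>\<^sub>0 \<le> \<sigma> x \<and> \<sigma> x \<le> \<sigma>\<^sub>1 \<and> J x = \<sigma> x *\<^sub>R (grad u x + F x) \<and> m \<le> norm (J x) \<and> norm (J x) \<le> M)"

lemma is_fluxD: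
  assumes "is_flux X \<sigma>\<^sub>0 \<sigma>\<^sub>1 m M a H F u \<sigma> J"
  shows "C1_closure X u" "H10 X u" "continuous_on X F" "\<exists>B. \<forall>x\<in>X. norm (F x) \<le> B" "continuous_on X J"
    "dual_feasible X a H J" "AE x in lebesgue_on X. norm (J x) = a x"
    and "x \<in> X \<Longrightarrow> \<sigma>\<^sub>0 \<le> \<sigma> x" "x \<in> X \<Longrightarrow> \<sigma> x \<le> \<sigma>\<^sub>1" "x \<in> X \<Longrightarrow> J x = \<sigma> x *\<^sub>R (grad u x + F x)"
      "x \<in> X \<Longrightarrow> m \<le> norm (J x)" "x \<in> X \<Longrightarrow> norm (J x) \<le> M"
  using assms unfolding is_flux_def by blast+

lemma is_flux_L2:
  assumes X: "open X" "bounded X" and J: "is_flux X \<sigma>\<^sub>0 \<sigma>\<^sub>1 m M a H F u \<sigma> J"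
  shows "L2_on X J" "L2_on X F" "L2_on X u" "L2_on X (grad u)"
  using is_fluxD(3,4,6)[OF J] C1_closure_weak_gradient[OF X is_fluxD(1)[OF J]] L2_on_continuous[OF lmeasurable_open[OF X(2,1)]]
  by (auto simp: dual_feasible_def H1_grad_def)

text \<open>From |J| = \<sigma> |grad u + F| this length lies between
  \<open>m / \<sigma>\<^sub>1\<close> and \<open>M / \<sigma>\<^sub>0\<close>. The lower bound gives
  access to the Euler--Lagrange equation; the upper one bounds \<open>F\<close>, since
  \<open>grad u\<close> is bounded.\<close>

lemma admissible_flux:
  fixes X :: "'a::euclidean_space set"
  assumes X: "open X" "bounded X" and pos: "0 < m" "0 < \<sigma>\<^sub>0" "0 < \<sigma>\<^sub>1"
    and a: "a \<in> borel_measurable (lebesgue_on X)" "AE x in lebesgue_on X. m \<le> a x \<and> a x \<le> M"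
    and H: "L2_on X H" and f: "C1_on X f" and adm: "admissible X \<sigma>\<^sub>0 \<sigma>\<^sub>1 m M a (grad f) H u"
  shows "\<exists>\<sigma> J. is_flux X \<sigma>\<^sub>0 \<sigma>\<^sub>1 m M a H (grad f) u \<sigma> J"
proof -
  obtain \<sigma> J where \<sigma>: "continuous_on X \<sigma>" "\<And>x. x \<in> X \<Longrightarrow> \<sigma>\<^sub>0 \<le> \<sigma> x \<and> \<sigma> x \<le> \<sigma>\<^sub>1"
    and J: "dual_solution X a (grad f) H J"
      "\<And>x. x \<in> X \<Longrightarrow> J x = \<sigma> x *\<^sub>R (grad u x + grad f x) \<and> m \<le> norm (J x) \<and> norm (J x) \<le> M"
    and u: "C1_closure X u" "minimizer X a (grad f) H u"
    using adm unfolding admissible_def by blast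
  obtain B where cg: "continuous_on X (grad u)" and bg: "\<And>x. x \<in> X \<Longrightarrow> norm (grad u x) \<le> B"
    using C1_closure_facts[OF X u(1)] by metis
  have cf: "continuous_on X (grad f)" using f by (simp add: C1_on_def)
  have nJ: "norm (J x) = \<sigma> x * norm (grad u x + grad f x)" if "x \<in> X" for x
    using J(2)[OF that] \<sigma>(2)[OF that] pos by simp
  have up: "norm (grad u x + grad f x) \<le> M / \<sigma>\<^sub>0" if x: "x \<in> X" for x
  proof -
    have "\<sigma>\<^sub>0 * norm (grad u x + grad f x) \<le> M"
    proof -
      have "\<sigma>\<^sub>0 * norm (grad u x + grad f x) \<le> \<sigma> x * norm (grad u x + grad f x)"
        using \<sigma>(2)[OF x] by (intro mult_right_mono) auto
      then show ?thesis using nJ[OF x] J(2)[OF x] by linarith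
    qed
    then show ?thesis using pos by (simp add: field_simps)
  qed
  have low: "m / \<sigma>\<^sub>1 \<le> norm (grad u x + grad f x)" if x: "x \<in> X" for x
  proof -
    have "m \<le> \<sigma>\<^sub>1 * norm (grad u x + grad f x)"
    proof -
      have "\<sigma> x * norm (grad u x + grad f x) \<le> \<sigma>\<^sub>1 * norm (grad u x + grad f x)"
        using \<sigma>(2)[OF x] by (intro mult_right_mono) auto
      then show ?thesis using nJ[OF x] J(2)[OF x] by linarith
    qed
    then show ?thesis using pos by (simp add: field_simps)
  qed
  have bf: "norm (grad f x) \<le> M / \<sigma>\<^sub>0 + B" if x: "x \<in> X" for x
    using norm_triangle_ineq4[of "grad u x + grad f x" "grad u x"] up[OF x] bg[OF x] by simp
  have a': "AE x in lebesgue_on X. 0 \<le> a x \<and> a x \<le> M" using a(2) by (rule eventually_mono) (use pos in auto)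
  have nn: "0 \<le> \<sigma> x" if "x \<in> X" for x using \<sigma>(2)[OF that] pos by linarith
  have "AE x in lebesgue_on X. norm (J x) = a x"
    by (rule dual_solution_norm_eq[OF X a(1) a' H u cf bf _ low J(1) _ nn]) (use pos J(2) in auto)
  moreover have "continuous_on X J"
    using continuous_on_scaleR[OF \<sigma>(1) continuous_on_add[OF cg cf]]
    by (rule continuous_on_eq) (use J(2) in auto)
  moreover have "dual_feasible X a H J" using J(1) by (simp add: dual_solution_def)
  moreover have "H10 X u" using u(2) by (simp add: minimizer_def)
  ultimately have "is_flux X \<sigma>\<^sub>0 \<sigma>\<^sub>1 m M a H (grad f) u \<sigma> J"
    unfolding is_flux_def using \<sigma>(2) J(2) cf bf u(1) by blast
  then show ?thesis by blast
qed

text \<open>Equal norms give P \<bullet> (P - P') = P' \<bullet> (P' - P) = |P - P'|^2 / 2. The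
  inner product on the right is therefore (1/s + 1/s') |P - P'|^2 / 2, and both reciprocals are at
  least 1/S.\<close>

lemma inner_flux_difference:
  fixes P P' :: "'a::real_inner"
  assumes "norm P = norm P'" "0 < s" "0 < s'" "s \<le> S" "s' \<le> S"
  shows "(norm (P - P'))\<^sup>2 \<le> S * ((P - P') \<bullet> ((1 / s) *\<^sub>R P - (1 / s') *\<^sub>R P'))"
proof -
  have eq: "P' \<bullet> P' = P \<bullet> P" using assms(1) by (simp add: power2_norm_eq_inner[symmetric])
  then have n: "(norm (P - P'))\<^sup>2 = 2 * (P \<bullet> P - P \<bullet> P')" "P' \<bullet> P' = P \<bullet> P"
    unfolding power2_norm_eq_inner by (simp_all add: inner_diff_left inner_diff_right inner_commute)
  have S: "1 \<le> S * (1 / s)" "1 \<le> S * (1 / s')" using assms by (simp_all add: field_simps)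
  have "(P - P') \<bullet> ((1 / s) *\<^sub>R P - (1 / s') *\<^sub>R P') = (1 / s + 1 / s') * (P \<bullet> P - P \<bullet> P')"
    using n(2) by (simp add: inner_diff_left inner_diff_right inner_commute algebra_simps)
  also have "\<dots> = (1 / s + 1 / s') * ((norm (P - P'))\<^sup>2 / 2)" using n(1) by simp
  finally have e: "(P - P') \<bullet> ((1 / s) *\<^sub>R P - (1 / s') *\<^sub>R P') = (1 / s + 1 / s') * ((norm (P - P'))\<^sup>2 / 2)" .
  have "S * ((P - P') \<bullet> ((1 / s) *\<^sub>R P - (1 / s') *\<^sub>R P')) = (S * (1 / s) + S * (1 / s')) * ((norm (P - P'))\<^sup>2 / 2)"
    unfolding e by (simp only: distrib_left mult.assoc[symmetric])
  also have "\<dots> \<ge> (1 + 1) * ((norm (P - P'))\<^sup>2 / 2)" using S by (intro mult_right_mono add_mono) auto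
  finally show ?thesis by simp
qed

lemma nn_integral_indicator_eq_integral:
  assumes "open X" "integrable (lebesgue_on X) k" "\<And>x. x \<in> X \<Longrightarrow> 0 \<le> k x"
  shows "(\<integral>\<^sup>+x. ennreal (indicator X x * k x) \<partial>lborel) = ennreal (LINT x|lebesgue_on X. k x)"
proof -
  have "ennreal (LINT x|lebesgue_on X. k x) = (\<integral>\<^sup>+x. ennreal (k x) \<partial>lebesgue_on X)"
    using assms by (intro nn_integral_eq_integral[symmetric]) (auto intro!: AE_I2 simp: space_restrict_space)
  also have "\<dots> = (\<integral>\<^sup>+x. ennreal (k x) * indicator X x \<partial>lebesgue)"
    using assms(1) by (intro nn_integral_restrict_space) auto
  also have "\<dots> = (\<integral>\<^sup>+x. ennreal (k x) * indicator X x \<partial>lborel)" by (rule nn_integral_completion)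
  also have "\<dots> = (\<integral>\<^sup>+x. ennreal (indicator X x * k x) \<partial>lborel)"
    by (intro nn_integral_cong) (simp split: split_indicator)
  finally show ?thesis by simp
qed

section \<open>Stability\<close>

text \<open>The data enter through the L1 norm of \<open>F - F'\<close>, because |J - J'| \<le> 2 M
  holds pointwise and Cauchy--Schwarz for integrals is avoided. The factor
  \<open>\<sigma>\<^sub>1\<close> is the reciprocal of the smallest possible 1 /
  \<open>\<sigma>\<close>.\<close>

lemma flux_stability:
  fixes X :: "'a::euclidean_space set"
  assumes X: "open X" "bounded X" and H: "L2_on X H" and pos: "0 < \<sigma>\<^sub>0" "0 < \<sigma>\<^sub>1"
    and J: "is_flux X \<sigma>\<^sub>0 \<sigma>\<^sub>1 m M a H F u \<sigma> J" and J': "is_flux X \<sigma>\<^sub>0 \<sigma>\<^sub>1 m M a H F' u' \<sigma>' J'"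
  shows "(LINT x|lebesgue_on X. (norm (J x - J' x))\<^sup>2) \<le> 2 * M * \<sigma>\<^sub>1 * (LINT x|lebesgue_on X. norm (F x - F' x))"
proof -
  have lm: "X \<in> lmeasurable" using X by (simp add: lmeasurable_open)
  note D = is_fluxD[OF J] and D' = is_fluxD[OF J'] and L = is_flux_L2[OF X J] and L' = is_flux_L2[OF X J']
  note gu = C1_closure_weak_gradient[OF X D(1)] and gu' = C1_closure_weak_gradient[OF X D'(1)]
  have Ld: "L2_on X (\<lambda>x. J x - J' x)" "L2_on X (\<lambda>x. F x - F' x)" "L2_on X (\<lambda>x. grad u x - grad u' x)"
    using L2_on_lincomb[OF L(1) L'(1), of "-1"] L2_on_lincomb[OF L(2) L'(2), of "-1"] L2_on_lincomb[OF L(4) L'(4), of "-1"]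
    by simp_all
  \<comment> \<open>Both fluxes satisfy the divergence constraint with the same \<open>H\<close>,
    whose terms cancel in the difference.\<close>
  have feas: "(LINT x|lebesgue_on X. grad w x \<bullet> (J x - J' x)) = 0"
    if w: "H10 X w" "H1_grad X w (grad w)" "L2_on X w" "L2_on X (grad w)" for w
  proof -
    note I = L2_on_mult_integrable[OF H w(3)] L2_on_inner_integrable[OF w(4) L(1)] L2_on_inner_integrable[OF w(4) L'(1)]
    have "(LINT x|lebesgue_on X. grad w x \<bullet> J x + H x * w x) = 0" "(LINT x|lebesgue_on X. grad w x \<bullet> J' x + H x * w x) = 0"
      using D(6) D'(6) w(1,2) unfolding dual_feasible_def by blast+
    then show ?thesis using I by (simp add: inner_diff_right)
  qed
  note Iu = L2_on_inner_integrable[OF L(4) Ld(1)] L2_on_inner_integrable[OF L'(4) Ld(1)]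
  have orth: "(LINT x|lebesgue_on X. (grad u x - grad u' x) \<bullet> (J x - J' x)) = 0"
  proof -
    have "(LINT x|lebesgue_on X. (grad u x - grad u' x) \<bullet> (J x - J' x)) =
        (LINT x|lebesgue_on X. grad u x \<bullet> (J x - J' x)) - (LINT x|lebesgue_on X. grad u' x \<bullet> (J x - J' x))"
      unfolding inner_diff_left[of "grad u _" "grad u' _"] by (rule Bochner_Integration.integral_diff[OF Iu])
    then show ?thesis using feas[OF D(2) gu L(3,4)] feas[OF D'(2) gu' L'(3,4)] by simp
  qed
  have inX: "AE x in lebesgue_on X. x \<in> X" by (rule AE_I2) (simp add: space_restrict_space)
  have IF: "integrable (lebesgue_on X) (\<lambda>x. norm (F x - F' x))"
    using L2_on_integrable[OF lm Ld(2)] by (rule integrable_norm)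
  note IG = L2_on_inner_integrable[OF Ld(3) Ld(1)]
  have "(LINT x|lebesgue_on X. (norm (J x - J' x))\<^sup>2) \<le>
     (LINT x|lebesgue_on X. \<sigma>\<^sub>1 * ((grad u x - grad u' x) \<bullet> (J x - J' x)) + 2 * M * \<sigma>\<^sub>1 * norm (F x - F' x))"
  proof (rule integral_mono_AE)
    show "integrable (lebesgue_on X) (\<lambda>x. (norm (J x - J' x))\<^sup>2)" using Ld(1) by (simp add: L2_on_def)
    show "integrable (lebesgue_on X) (\<lambda>x. \<sigma>\<^sub>1 * ((grad u x - grad u' x) \<bullet> (J x - J' x)) + 2 * M * \<sigma>\<^sub>1 * norm (F x - F' x))"
      by (intro Bochner_Integration.integrable_add integrable_mult_right IG IF)
    show "AE x in lebesgue_on X. (norm (J x - J' x))\<^sup>2 \<le>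
        \<sigma>\<^sub>1 * ((grad u x - grad u' x) \<bullet> (J x - J' x)) + 2 * M * \<sigma>\<^sub>1 * norm (F x - F' x)"
      using inX D(7) D'(7)
    proof eventually_elim
      case (elim x)
      let ?d = "J x - J' x"
      have s: "0 < \<sigma> x" "0 < \<sigma>' x" "\<sigma> x \<le> \<sigma>\<^sub>1" "\<sigma>' x \<le> \<sigma>\<^sub>1"
        using D(8,9)[OF elim(1)] D'(8,9)[OF elim(1)] pos(1) by linarith+
      have V: "(1 / \<sigma> x) *\<^sub>R J x = grad u x + F x" "(1 / \<sigma>' x) *\<^sub>R J' x = grad u' x + F' x"
        using D(10)[OF elim(1)] D'(10)[OF elim(1)] s by simp_all
      have "(norm ?d)\<^sup>2 \<le> \<sigma>\<^sub>1 * (?d \<bullet> ((1 / \<sigma> x) *\<^sub>R J x - (1 / \<sigma>' x) *\<^sub>R J' x))"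
        using elim(2,3) s by (intro inner_flux_difference) auto
      also have "\<dots> = \<sigma>\<^sub>1 * ((grad u x - grad u' x) \<bullet> ?d) + \<sigma>\<^sub>1 * (?d \<bullet> (F x - F' x))"
        unfolding V by (simp add: inner_add_right inner_diff_right inner_diff_left inner_commute algebra_simps)
      also have "?d \<bullet> (F x - F' x) \<le> (2 * M) * norm (F x - F' x)"
      proof -
        have "?d \<bullet> (F x - F' x) \<le> norm ?d * norm (F x - F' x)" by (rule norm_cauchy_schwarz)
        also have "norm ?d \<le> 2 * M" using norm_triangle_ineq4[of "J x" "J' x"] D(12)[OF elim(1)] D'(12)[OF elim(1)] by linarith
        finally show ?thesis by (simp add: mult_right_mono)
      qed
      finally show ?case using pos(2) by (simp add: mult_left_mono algebra_simps)
    qed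
  qed
  also have "\<dots> = \<sigma>\<^sub>1 * (LINT x|lebesgue_on X. (grad u x - grad u' x) \<bullet> (J x - J' x)) +
      2 * M * \<sigma>\<^sub>1 * (LINT x|lebesgue_on X. norm (F x - F' x))"
    unfolding Bochner_Integration.integral_add[OF integrable_mult_right[OF IG] integrable_mult_right[OF IF]]
      integral_mult_right_zero ..
  finally show ?thesis by (simp add: orth)
qed

lemma integral_norm_le_of_square:
  fixes d :: "'a::euclidean_space \<Rightarrow> 'b::euclidean_space"
  assumes lm: "X \<in> lmeasurable" and d: "L2_on X d"
    and sq: "(LINT x|lebesgue_on X. (norm (d x))\<^sup>2) \<le> 2 * c * W" and W: "0 \<le> W"
  shows "(LINT x|lebesgue_on X. norm (d x)) \<le> (measure (lebesgue_on X) X / 2 + c) * sqrt W"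
proof -
  interpret finite_measure "lebesgue_on X" using lm by (rule finite_measure_lebesgue_on)
  let ?X = "LINT x|lebesgue_on X. (norm (d x))\<^sup>2" and ?\<mu> = "measure (lebesgue_on X) X"
  have I: "integrable (lebesgue_on X) (\<lambda>x. norm (d x))" "integrable (lebesgue_on X) (\<lambda>x. (norm (d x))\<^sup>2)"
    using L2_on_integrable[OF lm d] d by (auto simp: L2_on_def)
  have young: "(LINT x|lebesgue_on X. norm (d x)) \<le> ?\<mu> * (s / 2) + 1 / (2 * s) * ?X" if s: "s > 0" for s
  proof -
    have "(LINT x|lebesgue_on X. norm (d x)) \<le> (LINT x|lebesgue_on X. s / 2 + 1 / (2 * s) * (norm (d x))\<^sup>2)"
    proof (rule integral_mono[OF I(1)])
      show "integrable (lebesgue_on X) (\<lambda>x. s / 2 + 1 / (2 * s) * (norm (d x))\<^sup>2)"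
        by (intro Bochner_Integration.integrable_add integrable_mult_right I integrable_const)
      fix x
      have "0 \<le> (s - norm (d x))\<^sup>2" by simp
      then have "2 * s * norm (d x) \<le> s\<^sup>2 + (norm (d x))\<^sup>2" by (simp add: power2_diff)
      then show "norm (d x) \<le> s / 2 + 1 / (2 * s) * (norm (d x))\<^sup>2"
        using s by (simp add: field_simps power2_eq_square)
    qed
    also have "\<dots> = (LINT x|lebesgue_on X. s / 2) + 1 / (2 * s) * ?X"
      unfolding Bochner_Integration.integral_add[OF integrable_const integrable_mult_right[OF I(2)]]
        integral_mult_right_zero ..
    also have "(LINT x|lebesgue_on X. s / 2) = ?\<mu> * (s / 2)"
      by (simp add: space_restrict_space)
    finally show ?thesis .
  qed
  show ?thesis
  proof (cases "W = 0")
    case False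
    then have W: "W > 0" using W by simp
    have "(LINT x|lebesgue_on X. norm (d x)) \<le> ?\<mu> * (sqrt W / 2) + 1 / (2 * sqrt W) * ?X"
      using W by (intro young) simp
    also have "1 / (2 * sqrt W) * ?X \<le> 1 / (2 * sqrt W) * (2 * c * W)" using W sq by (intro mult_left_mono) auto
    also have "1 / (2 * sqrt W) * (2 * c * W) = c * sqrt W"
      using W real_sqrt_mult_self[of W] by (simp add: field_simps)
    finally show ?thesis by (simp add: algebra_simps)
  next
    case True
    then have X: "?X \<le> 0" using sq by simp
    moreover have "0 \<le> ?X" by (intro integral_nonneg_AE) simp
    ultimately have "AE x in lebesgue_on X. (norm (d x))\<^sup>2 = 0"
      using integral_nonneg_eq_0_iff_AE[OF I(2)] by simp
    then have "(LINT x|lebesgue_on X. norm (d x)) = 0" by (intro integral_eq_zero_AE) simp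
    then show ?thesis using True by simp
  qed
qed

theorem theorem3p5:
  fixes \<Omega> :: "(real^3) set" and m M K \<sigma>\<^sub>0 \<sigma>\<^sub>1 c\<^sub>g C\<^sub>g :: real
  assumes "open \<Omega>" and "connected \<Omega>" and "bounded \<Omega>" and "lipschitz_boundary \<Omega>"
    and "0 < m" and "0 < \<sigma>\<^sub>0" and "0 < \<sigma>\<^sub>1" and "0 < c\<^sub>g"
  shows "\<exists>C>0. \<forall>a H f f' u u'.
     a \<in> borel_measurable (lebesgue_on \<Omega>) \<and> (AE x in lebesgue_on \<Omega>. m \<le> a x \<and> a x \<le> M) \<and>
     L2_on \<Omega> H \<and>
     C1_on \<Omega> f \<and> continuous_on (closure \<Omega>) f \<and>
     C1_on \<Omega> f' \<and> continuous_on (closure \<Omega>) f' \<and>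
     admissible \<Omega> \<sigma>\<^sub>0 \<sigma>\<^sub>1 m M a (grad f) H u \<and>
     admissible \<Omega> \<sigma>\<^sub>0 \<sigma>\<^sub>1 m M a (grad f') H u' \<and>
     (\<forall>x\<in>frontier \<Omega>. u x = 0 \<and> u' x = 0) \<and>
     foliated \<Omega> (\<lambda>x. u x + f x) c\<^sub>g C\<^sub>g K
     \<longrightarrow> L1_norm \<Omega> (\<lambda>x. u x - u' x) \<le>
         C * max (sqrt (W11_norm \<Omega> (\<lambda>x. f x - f' x))) (W11_norm \<Omega> (\<lambda>x. f x - f' x))"
proof -
  note \<Omega> = assms(1,3) and pos = assms(5-8)
  have lm: "\<Omega> \<in> lmeasurable" using \<Omega> by (simp add: lmeasurable_open)
  define \<mu> where "\<mu> = measure (lebesgue_on \<Omega>) \<Omega>"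
  \<comment> \<open>\<open>m / \<sigma>\<^sub>1\<close> and \<open>M / \<sigma>\<^sub>0\<close> are
    the bounds for |grad v|. In \<open>C\<close>, the division by \<open>\<sigma>\<^sub>0\<close>
    and the summand 1 are the weights of the flux difference and of the data in \<open>h\<close>.
    The maximum with 1 keeps \<open>C\<close> positive for parameters that no admissible function
    realizes, such as a negative \<open>M\<close>.\<close>
  define C1 where "C1 = foliation_const (m / \<sigma>\<^sub>1 / 2) (M / \<sigma>\<^sub>0) c\<^sub>g (max C\<^sub>g c\<^sub>g) (max K 0)"
  define C where "C = max 1 (C1 * ((\<mu> / 2 + M * \<sigma>\<^sub>1) / \<sigma>\<^sub>0 + 1))"
  have main: "L1_norm \<Omega> (\<lambda>x. u x - u' x) \<le>
         C * max (sqrt (W11_norm \<Omega> (\<lambda>x. f x - f' x))) (W11_norm \<Omega> (\<lambda>x. f x - f' x))"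
    if a: "a \<in> borel_measurable (lebesgue_on \<Omega>)" "AE x in lebesgue_on \<Omega>. m \<le> a x \<and> a x \<le> M"
      and H: "L2_on \<Omega> H" and f: "C1_on \<Omega> f" and f': "C1_on \<Omega> f'"
      and adm: "admissible \<Omega> \<sigma>\<^sub>0 \<sigma>\<^sub>1 m M a (grad f) H u" and adm': "admissible \<Omega> \<sigma>\<^sub>0 \<sigma>\<^sub>1 m M a (grad f') H u'"
      and bd: "\<And>x. x \<in> frontier \<Omega> \<Longrightarrow> u x = 0 \<and> u' x = 0"
      and fol: "foliated \<Omega> (\<lambda>x. u x + f x) c\<^sub>g C\<^sub>g K"
    for a H f f' u u'
  proof -
    define W where "W = W11_norm \<Omega> (\<lambda>x. f x - f' x)"
    have W0: "0 \<le> W" unfolding W_def W11_norm_def by (intro add_nonneg_nonneg integral_nonneg_AE) auto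
    \<comment> \<open>That \<open>M\<close> is positive is known only from a point of
      \<open>\<Omega>\<close>, where m \<le> |J| \<le> M; the empty set is split off for this
      reason.\<close>
    show ?thesis
    proof (cases "\<Omega> = {}")
      case True
      have "L1_norm \<Omega> (\<lambda>x. u x - u' x) = 0" unfolding L1_norm_def True by (subst integral_restrict_space) auto
      moreover have "0 \<le> C * max (sqrt W) W" using W0 by (intro mult_nonneg_nonneg) (auto simp: C_def le_max_iff_disj)
      ultimately show ?thesis by (simp add: W_def)
    next
      case False
      obtain \<sigma> J where flux: "is_flux \<Omega> \<sigma>\<^sub>0 \<sigma>\<^sub>1 m M a H (grad f) u \<sigma> J"
        using admissible_flux[OF \<Omega> pos(1-3) a H f adm] by blast
      obtain \<sigma>' J' where flux': "is_flux \<Omega> \<sigma>\<^sub>0 \<sigma>\<^sub>1 m M a H (grad f') u' \<sigma>' J'"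
        using admissible_flux[OF \<Omega> pos(1-3) a H f' adm'] by blast
      note J = is_fluxD[OF flux] and J' = is_fluxD[OF flux'] and L = is_flux_L2[OF \<Omega> flux] and L' = is_flux_L2[OF \<Omega> flux']
      have df: "GDERIV f x :> grad f x" "GDERIV f' x :> grad f' x" if "x \<in> \<Omega>" for x
        using f f' that GDERIV_grad by (auto simp: C1_on_def)
      have gu: "\<And>x. x \<in> \<Omega> \<Longrightarrow> GDERIV u x :> grad u x" "continuous_on \<Omega> (grad u)" "continuous_on (closure \<Omega>) u"
        using C1_closure_facts[OF \<Omega> J(1)] by metis+
      have gu': "\<And>x. x \<in> \<Omega> \<Longrightarrow> GDERIV u' x :> grad u' x" "continuous_on (closure \<Omega>) u'"
        using C1_closure_facts[OF \<Omega> J'(1)] by metis+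
      obtain x\<^sub>0 where "x\<^sub>0 \<in> \<Omega>" using False by blast
      then have M: "0 < M" using J(11)[of x\<^sub>0] J(12)[of x\<^sub>0] pos(1) by linarith
      define V where "V x = grad u x + grad f x" for x
      define d where "d x = J x - J' x" for x
      define e where "e x = grad f x - grad f' x" for x
      define h where "h x = 1 / \<sigma>\<^sub>0 * norm (d x) + norm (e x)" for x
      have Ld: "L2_on \<Omega> d" unfolding d_def
        using L2_on_lincomb[OF L(1) L'(1), of "-1"] by simp
      have Le: "L2_on \<Omega> e" unfolding e_def
        using L2_on_lincomb[OF L(2) L'(2), of "-1"] by simp
      have Id: "integrable (lebesgue_on \<Omega>) (\<lambda>x. norm (d x))" and Ie: "integrable (lebesgue_on \<Omega>) (\<lambda>x. norm (e x))"
        using L2_on_integrable[OF lm Ld] L2_on_integrable[OF lm Le] by (auto intro: integrable_norm)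
      have eW: "(LINT x|lebesgue_on \<Omega>. norm (e x)) \<le> W"
      proof -
        have "grad (\<lambda>x. f x - f' x) x = e x" if "x \<in> \<Omega>" for x
          using GDERIV_lincomb[OF df[OF that], of "-1"] by (intro grad_eqI) (simp add: e_def)
        then have "(LINT x|lebesgue_on \<Omega>. norm (grad (\<lambda>x. f x - f' x) x)) = (LINT x|lebesgue_on \<Omega>. norm (e x))"
          by (intro Bochner_Integration.integral_cong) (auto simp: space_restrict_space)
        then show ?thesis unfolding W_def W11_norm_def by simp
      qed
      have "(LINT x|lebesgue_on \<Omega>. (norm (d x))\<^sup>2) \<le> 2 * M * \<sigma>\<^sub>1 * (LINT x|lebesgue_on \<Omega>. norm (e x))"
        unfolding d_def e_def by (rule flux_stability[OF \<Omega> H pos(2,3) flux flux'])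
      also have "\<dots> \<le> 2 * (M * \<sigma>\<^sub>1) * W" using eW M pos(3) by (simp add: mult_left_mono)
      finally have "(LINT x|lebesgue_on \<Omega>. norm (d x)) \<le> (\<mu> / 2 + M * \<sigma>\<^sub>1) * sqrt W"
        unfolding \<mu>_def by (rule integral_norm_le_of_square[OF lm Ld _ W0])
      then have "1 / \<sigma>\<^sub>0 * (LINT x|lebesgue_on \<Omega>. norm (d x)) \<le> 1 / \<sigma>\<^sub>0 * ((\<mu> / 2 + M * \<sigma>\<^sub>1) * sqrt W)"
        using pos(2) by (intro mult_left_mono) auto
      moreover have "(LINT x|lebesgue_on \<Omega>. h x) = 1 / \<sigma>\<^sub>0 * (LINT x|lebesgue_on \<Omega>. norm (d x)) + (LINT x|lebesgue_on \<Omega>. norm (e x))"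
        unfolding h_def Bochner_Integration.integral_add[OF integrable_mult_right[OF Id] Ie] integral_mult_right_zero ..
      ultimately have "(LINT x|lebesgue_on \<Omega>. h x) \<le> ((\<mu> / 2 + M * \<sigma>\<^sub>1) / \<sigma>\<^sub>0) * sqrt W + 1 * W"
        using eW by simp
      \<comment> \<open>The maximum absorbs the square root from the flux difference and the linear
        contribution of \<open>e\<close> alike.\<close>
      also have "\<dots> \<le> ((\<mu> / 2 + M * \<sigma>\<^sub>1) / \<sigma>\<^sub>0) * max (sqrt W) W + 1 * max (sqrt W) W"
        using M pos by (intro add_mono mult_left_mono) (auto simp: \<mu>_def)
      finally have hW: "(LINT x|lebesgue_on \<Omega>. h x) \<le> ((\<mu> / 2 + M * \<sigma>\<^sub>1) / \<sigma>\<^sub>0 + 1) * max (sqrt W) W"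
        by (simp add: algebra_simps)
      have C1: "0 \<le> C1" unfolding C1_def foliation_const_def using M pos by (auto intro!: mult_nonneg_nonneg add_nonneg_nonneg divide_nonneg_nonneg simp: le_max_iff_disj)
      have Ih: "integrable (lebesgue_on \<Omega>) h" unfolding h_def by (intro Bochner_Integration.integrable_add integrable_mult_right Id Ie)
      have h0: "0 \<le> h x" for x using pos by (simp add: h_def)
      have nV: "norm (J x) = \<sigma> x * norm (V x)" if "x \<in> \<Omega>" for x
        using J(10)[OF that] J(8)[OF that] pos by (simp add: V_def)
      have "(\<integral>\<^sup>+x. ennreal (indicator \<Omega> x * \<bar>u x - u' x\<bar>) \<partial>lborel)
        \<le> ennreal C1 * (\<integral>\<^sup>+x. ennreal (indicator \<Omega> x * h x) \<partial>lborel)"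
        unfolding C1_def
      proof (rule foliation_estimate[OF \<Omega> _ _ _ _ _ _ pos(4) fol])
        show "GDERIV (\<lambda>x. u x + f x) x :> V x" if "x \<in> \<Omega>" for x
          using GDERIV_lincomb[OF gu(1)[OF that] df(1)[OF that], of 1] by (simp add: V_def)
        show "continuous_on \<Omega> V" unfolding V_def by (intro continuous_intros gu(2) J(3))
        show "m / \<sigma>\<^sub>1 \<le> norm (V x)" if x: "x \<in> \<Omega>" for x
        proof -
          have "m \<le> \<sigma> x * norm (V x)" using J(11)[OF x] nV[OF x] by simp
          also have "\<dots> \<le> \<sigma>\<^sub>1 * norm (V x)" using J(9)[OF x] by (intro mult_right_mono) auto
          finally show ?thesis using pos(3) by (simp add: field_simps)
        qed
        show "norm (V x) \<le> M / \<sigma>\<^sub>0" if x: "x \<in> \<Omega>" for x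
        proof -
          have "\<sigma>\<^sub>0 * norm (V x) \<le> \<sigma> x * norm (V x)" using J(8)[OF x] by (intro mult_right_mono) auto
          also have "\<dots> \<le> M" using J(12)[OF x] nV[OF x] by simp
          finally show ?thesis using pos(2) by (simp add: field_simps)
        qed
        show "((\<lambda>x. u x - u' x) has_derivative (\<lambda>\<tau>. \<tau> \<bullet> (grad u x - grad u' x))) (at x)" if "x \<in> \<Omega>" for x
          using GDERIV_lincomb[OF gu(1)[OF that] gu'(1)[OF that], of "-1"] by (simp add: gderiv_def)
        show "continuous_on (closure \<Omega>) (\<lambda>x. u x - u' x)" by (intro continuous_intros gu(3) gu'(2))
        show "\<bar>\<tau> \<bullet> (grad u x - grad u' x)\<bar> \<le> h x * norm \<tau>" if x: "x \<in> \<Omega>" and \<tau>: "\<tau> \<bullet> V x = 0" for x \<tau>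
        proof -
          have s: "0 < \<sigma>' x" "\<sigma>\<^sub>0 \<le> \<sigma>' x" using J'(8)[OF x] pos(2) by linarith+
          \<comment> \<open>A vector orthogonal to \<open>V\<close> is orthogonal to the parallel
            field \<open>J\<close>, so it sees \<open>J'\<close> only through the difference
            \<open>d\<close>. Dividing by \<open>\<sigma>' x\<close> bounds the component of grad u'
            + grad f' along \<open>\<tau>\<close>.\<close>
          have "\<tau> \<bullet> J x = 0" using \<tau> J(10)[OF x] by (simp add: V_def)
          then have "\<tau> \<bullet> d x = - (\<sigma>' x * (\<tau> \<bullet> (grad u' x + grad f' x)))"
            using J'(10)[OF x] by (simp add: d_def inner_diff_right)
          then have eq: "\<tau> \<bullet> (grad u' x + grad f' x) = - (\<tau> \<bullet> d x) / \<sigma>' x" using s by (simp add: field_simps)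
          have "\<tau> \<bullet> (grad u x - grad u' x) = \<tau> \<bullet> V x - \<tau> \<bullet> (grad u' x + grad f' x) - \<tau> \<bullet> e x"
            by (simp add: V_def e_def inner_add_right inner_diff_right)
          also have "\<dots> = (\<tau> \<bullet> d x) / \<sigma>' x - \<tau> \<bullet> e x" unfolding eq \<tau> by simp
          also have "\<bar>\<dots>\<bar> \<le> \<bar>\<tau> \<bullet> d x\<bar> / \<sigma>' x + \<bar>\<tau> \<bullet> e x\<bar>"
            using s abs_triangle_ineq4[of "(\<tau> \<bullet> d x) / \<sigma>' x" "\<tau> \<bullet> e x"] by (simp add: abs_divide)
          also have "\<dots> \<le> (norm \<tau> * norm (d x)) / \<sigma>\<^sub>0 + norm \<tau> * norm (e x)"
            using s pos(2) by (intro add_mono frac_le Cauchy_Schwarz_ineq2) auto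
          finally show ?thesis by (simp add: h_def algebra_simps)
        qed
        show "continuous_on \<Omega> h" unfolding h_def d_def e_def by (intro continuous_intros J(5) J'(5) J(3) J'(3))
      qed (use bd h0 M pos in auto)
      also have "(\<integral>\<^sup>+x. ennreal (indicator \<Omega> x * h x) \<partial>lborel) = ennreal (LINT x|lebesgue_on \<Omega>. h x)"
        by (rule nn_integral_indicator_eq_integral[OF \<Omega>(1) Ih h0])
      also have "(\<integral>\<^sup>+x. ennreal (indicator \<Omega> x * \<bar>u x - u' x\<bar>) \<partial>lborel) = ennreal (L1_norm \<Omega> (\<lambda>x. u x - u' x))"
        unfolding L1_norm_def
      proof (rule nn_integral_indicator_eq_integral[OF \<Omega>(1)])
        have "L2_on \<Omega> (\<lambda>x. u x - u' x)" using L2_on_lincomb[OF L(3) L'(3), of "-1"] by simp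
        then show "integrable (lebesgue_on \<Omega>) (\<lambda>x. \<bar>u x - u' x\<bar>)"
          using L2_on_integrable[OF lm] by (intro integrable_abs)
      qed simp
      finally have "ennreal (L1_norm \<Omega> (\<lambda>x. u x - u' x)) \<le> ennreal (C1 * (LINT x|lebesgue_on \<Omega>. h x))"
        using C1 by (simp add: ennreal_mult')
      then have "L1_norm \<Omega> (\<lambda>x. u x - u' x) \<le> C1 * (LINT x|lebesgue_on \<Omega>. h x)"
        using C1 h0 by (subst (asm) ennreal_le_iff) (auto intro!: mult_nonneg_nonneg integral_nonneg_AE)
      also have "\<dots> \<le> C1 * (((\<mu> / 2 + M * \<sigma>\<^sub>1) / \<sigma>\<^sub>0 + 1) * max (sqrt W) W)" using hW C1 by (rule mult_left_mono)
      also have "\<dots> = C1 * ((\<mu> / 2 + M * \<sigma>\<^sub>1) / \<sigma>\<^sub>0 + 1) * max (sqrt W) W" by simp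
      also have "\<dots> \<le> C * max (sqrt W) W" using W0 by (intro mult_right_mono) (auto simp: C_def le_max_iff_disj)
      finally show ?thesis by (simp add: W_def)
    qed
  qed
  have "0 < C" by (simp add: C_def less_max_iff_disj)
  with main show ?thesis by (intro exI[of _ C]) blast
qed

end
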